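(* Let $\Bbbk$ be a field and let $R=\Bbbk[S]$ be a Cohen-Macaulay homogeneous affine semigroup ring over $\Bbbk$. If $R$ is nearly Gorenstein and has Cohen-Macaulay type $2$, then $R$ is level.
   Context: An affine semigroup is a finitely generated additive sub-semigroup $S$ (containing $0$) of $\mathbb{N}^n$ for some $n$, where $\mathbb N$ is the set of nonnegative integers; $\Bbbk[S]$ is the $\Bbbk$-subalgebra of $\Bbbk[x_1,\dots,x_n]$ spanned by the monomials $\mathbf{x}^{\mathbf a}$, $\mathbf a\in S$. $S$ (and $\Bbbk[S]$) is called homogeneous if all minimal generators of $S$ lie on an affine hyperplane not containing the origin; equivalently, $\Bbbk[S]$ is standard graded by assigning degree $1$ to all the monomials corresponding to the minimal generators of $S$. This is the grading used on $R$; its graded maximal ideal is denoted $\mathbf{m}$. Let $\omega_R$ denote the graded canonical module of $R$. The Cohen-Macaulay type of $R$ is the minimal number of generators of $\omega_R$. For an $R$-module $M$, the trace of $M$ is the ideal $\mathrm{tr}(M)=\sum_{\phi\in \mathrm{Hom}_R(M,R)}\phi(M)$ of $R$. The (Cohen-Macaulay) ring $R$ is nearly Gorenstein if $\mathrm{tr}(\omega_R)\supseteq\mathbf{m}$. It is level if all the degrees of the minimal generators of $\omega_R$ are the same. *)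

theory Defs
  imports
    Complex_Main
    "HOL-Library.Poly_Mapping"
    "HOL-Library.Extended_Nat"
    "HOL-Algebra.Ring_Divisibility"
    "HOL-Algebra.QuotRing"
    "HOL-Algebra.Module"
begin

section \<open>Affine semigroups\<close>

text \<open>
  Exponent vectors are finitely supported functions on \<^typ>\<open>nat\<close>; the vectors of
  \<open>\<nat>\<^sup>n\<close> are those supported on \<open>{..<n}\<close>.
\<close>

type_synonym expo = "nat \<Rightarrow>\<^sub>0 nat"

definition add_submonoid :: "expo set \<Rightarrow> bool" where
  "add_submonoid T \<longleftrightarrow> 0 \<in> T \<and> (\<forall>a\<in>T. \<forall>b\<in>T. a + b \<in> T)"

definition affine_semigroup :: "nat \<Rightarrow> expo set \<Rightarrow> bool" where
  "affine_semigroup n S \<longleftrightarrow>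
     S \<subseteq> {a. Poly_Mapping.keys a \<subseteq> {..<n}} \<and> (\<exists>G. finite G \<and> add_submonoid hull G = S)"

text \<open>
  A submonoid of \<open>\<nat>\<^sup>n\<close> has a unique minimal generating set, consisting of its nonzero
  elements that are not a sum of two nonzero elements (see the two lemmas below).
\<close>

definition min_gens :: "expo set \<Rightarrow> expo set" where
  "min_gens S = {a \<in> S. a \<noteq> 0 \<and> (\<forall>b\<in>S. \<forall>c\<in>S. a = b + c \<longrightarrow> b = 0 \<or> c = 0)}"

lemma add_submonoid_hull: "add_submonoid (add_submonoid hull G)"
  by (rule hull_in) (auto simp: add_submonoid_def)

lemma min_gens_subset_generators:
  assumes "add_submonoid hull G = S"
  shows "min_gens S \<subseteq> G"
proof
  fix a assume a: "a \<in> min_gens S"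
  have S: "add_submonoid S" using add_submonoid_hull[of G] assms by simp
  show "a \<in> G"
  proof (rule ccontr)
    assume "a \<notin> G"
    moreover have "G \<subseteq> S" using assms hull_subset[of G add_submonoid] by simp
    moreover have "add_submonoid (S - {a})"
      using S a unfolding add_submonoid_def min_gens_def by auto
    ultimately have "add_submonoid hull G \<subseteq> S - {a}"
      by (intro hull_minimal) auto
    then show False using assms a unfolding min_gens_def by auto
  qed
qed

lemma min_gens_generate:
  assumes "add_submonoid S"
  shows "add_submonoid hull (min_gens S) = S"
proof
  show "add_submonoid hull (min_gens S) \<subseteq> S"
    using assms by (intro hull_minimal) (auto simp: min_gens_def)
  define w :: "expo \<Rightarrow> nat" where "w a = (\<Sum>i\<in>Poly_Mapping.keys a. Poly_Mapping.lookup a i)" for a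
  have w_super: "w a = (\<Sum>i\<in>I. Poly_Mapping.lookup a i)" if "finite I" "Poly_Mapping.keys a \<subseteq> I" for a I
    unfolding w_def using that by (intro sum.mono_neutral_left) (auto simp: in_keys_iff)
  have w_add: "w (a + b) = w a + w b" for a b
  proof -
    have "w (a + b) = (\<Sum>i\<in>Poly_Mapping.keys a \<union> Poly_Mapping.keys b. Poly_Mapping.lookup (a + b) i)"
      by (rule w_super) (use keys_add[of a b] in auto)
    also have "\<dots> = (\<Sum>i\<in>Poly_Mapping.keys a \<union> Poly_Mapping.keys b. Poly_Mapping.lookup a i)
        + (\<Sum>i\<in>Poly_Mapping.keys a \<union> Poly_Mapping.keys b. Poly_Mapping.lookup b i)"
      by (simp add: lookup_add sum.distrib)
    also have "\<dots> = w a + w b"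
      by (simp add: w_super[symmetric])
    finally show ?thesis .
  qed
  have w_pos: "w a > 0" if "a \<noteq> 0" for a
  proof -
    obtain i where "i \<in> Poly_Mapping.keys a" using \<open>a \<noteq> 0\<close>
      by (metis ex_in_conv keys_eq_empty)
    then show ?thesis unfolding w_def by (intro sum_pos2[of _ i]) (auto simp: in_keys_iff)
  qed
  have H: "add_submonoid (add_submonoid hull (min_gens S))"
    by (rule add_submonoid_hull)
  have "a \<in> S \<Longrightarrow> a \<in> add_submonoid hull (min_gens S)" for a
  proof (induction "w a" arbitrary: a rule: less_induct)
    case less
    show ?case
    proof (cases "a = 0 \<or> a \<in> min_gens S")
      case True
      then show ?thesis
        using H hull_subset[of "min_gens S" add_submonoid] unfolding add_submonoid_def by auto
    next
      case False
      then obtain b c where bc: "b \<in> S" "c \<in> S" "a = b + c" "b \<noteq> 0" "c \<noteq> 0"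
        using less.prems unfolding min_gens_def by auto
      then have "w b < w a" "w c < w a" using w_add w_pos by auto
      then show ?thesis using less.hyps bc H unfolding add_submonoid_def by auto
    qed
  qed
  then show "S \<subseteq> add_submonoid hull (min_gens S)" by blast
qed

definition homogeneous_semigroup :: "nat \<Rightarrow> expo set \<Rightarrow> bool" where
  "homogeneous_semigroup n S \<longleftrightarrow>
     (\<exists>(l :: nat \<Rightarrow> real) c. c \<noteq> 0 \<and> (\<forall>a\<in>min_gens S. (\<Sum>i<n. l i * real (Poly_Mapping.lookup a i)) = c))"

section \<open>Affine semigroup rings\<close>

text \<open>
  \<^typ>\<open>expo \<Rightarrow>\<^sub>0 'k\<close> with its convolution product is the polynomial ring over \<open>'k\<close>; an element
  maps an exponent vector to its coefficient.
\<close>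

definition semigroup_ring :: "expo set \<Rightarrow> (expo \<Rightarrow>\<^sub>0 'k::field) ring" where
  "semigroup_ring S =
     \<lparr>carrier = {f. Poly_Mapping.keys f \<subseteq> S}, mult = (*), one = 1, zero = 0, add = (+)\<rparr>"

definition std_grading :: "expo set \<Rightarrow> int \<Rightarrow> (expo \<Rightarrow>\<^sub>0 'k::field) set" where
  "std_grading S p =
     {f. Poly_Mapping.keys f \<subseteq> {sum_mset A | A. set_mset A \<subseteq> min_gens S \<and> int (size A) = p}}"

lemma semigroup_ring_cring:
  assumes "add_submonoid S"
  shows "cring (semigroup_ring S :: (expo \<Rightarrow>\<^sub>0 'k::field) ring)"
proof (rule cringI)
  have add: "Poly_Mapping.keys (f + g) \<subseteq> S" if "Poly_Mapping.keys f \<subseteq> S" "Poly_Mapping.keys g \<subseteq> S" for f g :: "expo \<Rightarrow>\<^sub>0 'k"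
    using keys_add[of f g] that by auto
  have mult: "Poly_Mapping.keys (f * g) \<subseteq> S" if "Poly_Mapping.keys f \<subseteq> S" "Poly_Mapping.keys g \<subseteq> S" for f g :: "expo \<Rightarrow>\<^sub>0 'k"
    using keys_mult[of f g] that assms unfolding add_submonoid_def by blast
  show "abelian_group (semigroup_ring S :: (expo \<Rightarrow>\<^sub>0 'k) ring)"
  proof (rule abelian_groupI)
    fix f assume "f \<in> carrier (semigroup_ring S :: (expo \<Rightarrow>\<^sub>0 'k) ring)"
    then show "\<exists>g\<in>carrier (semigroup_ring S). g \<oplus>\<^bsub>semigroup_ring S\<^esub> f = \<zero>\<^bsub>semigroup_ring S\<^esub>"
      by (intro bexI[of _ "- f"]) (auto simp: semigroup_ring_def)
  qed (use add in \<open>auto simp: semigroup_ring_def algebra_simps\<close>)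
  show "comm_monoid (semigroup_ring S :: (expo \<Rightarrow>\<^sub>0 'k) ring)"
    by (rule comm_monoidI)
      (use mult assms in \<open>auto simp: semigroup_ring_def add_submonoid_def algebra_simps\<close>)
qed (auto simp: semigroup_ring_def algebra_simps)

section \<open>Cohen-Macaulay rings\<close>

definition regular_seq :: "('a, 'b) ring_scheme \<Rightarrow> 'a list \<Rightarrow> bool" where
  "regular_seq R xs \<longleftrightarrow>
     set xs \<subseteq> carrier R \<and> Idl\<^bsub>R\<^esub> (set xs) \<noteq> carrier R \<and>
     (\<forall>i<length xs. \<forall>a\<in>carrier R.
        (xs ! i) \<otimes>\<^bsub>R\<^esub> a \<in> Idl\<^bsub>R\<^esub> (set (take i xs)) \<longrightarrow> a \<in> Idl\<^bsub>R\<^esub> (set (take i xs)))"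

definition ideal_grade :: "('a, 'b) ring_scheme \<Rightarrow> 'a set \<Rightarrow> enat" where
  "ideal_grade R I = (SUP xs\<in>{xs. regular_seq R xs \<and> set xs \<subseteq> I}. enat (length xs))"

definition prime_height :: "('a, 'b) ring_scheme \<Rightarrow> 'a set \<Rightarrow> enat" where
  "prime_height R P =
     (SUP k\<in>{k. \<exists>p. p k = P \<and> (\<forall>i\<le>k. primeideal (p i) R) \<and> (\<forall>i<k. p i \<subset> p (Suc i))}. enat k)"

text \<open>
  At a maximal ideal \<open>M\<close> of a noetherian ring, \<open>depth R\<^sub>M\<close> is the grade of \<open>M\<close> and
  \<open>dim R\<^sub>M\<close> is the height of \<open>M\<close>, so the condition below is \<open>depth R\<^sub>M = dim R\<^sub>M\<close>; this is
  Kaplansky's form of the definition, which avoids localization.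
\<close>

definition Cohen_Macaulay_ring :: "('a, 'b) ring_scheme \<Rightarrow> bool" where
  "Cohen_Macaulay_ring R \<longleftrightarrow>
     cring R \<and> noetherian_ring R \<and> (\<forall>M. maximalideal M R \<longrightarrow> ideal_grade R M = prime_height R M)"

section \<open>Modules\<close>

text \<open>Modules are abelian groups with scalars: the ring fields \<open>mult\<close> and \<open>one\<close> are irrelevant.\<close>

definition self_module :: "('a, 'b) ring_scheme \<Rightarrow> ('a, 'a) module" where
  "self_module R =
     \<lparr>carrier = carrier R, mult = mult R, one = one R, zero = zero R, add = add R, smult = mult R\<rparr>"

definition power_module :: "('a, 'c) module \<Rightarrow> nat \<Rightarrow> ('a, nat \<Rightarrow> 'c) module" where
  "power_module M q =
     \<lparr>carrier = {..<q} \<rightarrow>\<^sub>E carrier M, mult = undefined, one = undefined,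
      zero = (\<lambda>j\<in>{..<q}. \<zero>\<^bsub>M\<^esub>),
      add = (\<lambda>v w. \<lambda>j\<in>{..<q}. v j \<oplus>\<^bsub>M\<^esub> w j),
      smult = (\<lambda>r v. \<lambda>j\<in>{..<q}. r \<odot>\<^bsub>M\<^esub> v j)\<rparr>"

definition quot_module :: "('a, 'c) module \<Rightarrow> 'c set \<Rightarrow> ('a, 'c set) module" where
  "quot_module M N =
     \<lparr>carrier = a_rcosets\<^bsub>M\<^esub> N, mult = undefined, one = undefined,
      zero = N, add = set_add M,
      smult = (\<lambda>r X. \<Union>x\<in>X. N +>\<^bsub>M\<^esub> (r \<odot>\<^bsub>M\<^esub> x))\<rparr>"

definition module_Hom ::
    "('a, 'b) ring_scheme \<Rightarrow> ('a, 'c) module \<Rightarrow> ('a, 'd) module \<Rightarrow> ('c \<Rightarrow> 'd) set" where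
  "module_Hom R M N =
     {h. h \<in> carrier M \<rightarrow> carrier N \<and>
         (\<forall>x\<in>carrier M. \<forall>y\<in>carrier M. h (x \<oplus>\<^bsub>M\<^esub> y) = h x \<oplus>\<^bsub>N\<^esub> h y) \<and>
         (\<forall>r\<in>carrier R. \<forall>x\<in>carrier M. h (r \<odot>\<^bsub>M\<^esub> x) = r \<odot>\<^bsub>N\<^esub> h x)}"

definition generates :: "('a, 'b) ring_scheme \<Rightarrow> ('a, 'c) module \<Rightarrow> 'c set \<Rightarrow> bool" where
  "generates R M G \<longleftrightarrow>
     G \<subseteq> carrier M \<and> (\<forall>N. submodule N R M \<and> G \<subseteq> N \<longrightarrow> N = carrier M)"

definition fin_gen_module :: "('a, 'b) ring_scheme \<Rightarrow> ('a, 'c) module \<Rightarrow> bool" where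
  "fin_gen_module R M \<longleftrightarrow> (\<exists>G. finite G \<and> generates R M G)"

definition min_num_gens :: "('a, 'b) ring_scheme \<Rightarrow> ('a, 'c) module \<Rightarrow> nat" where
  "min_num_gens R M = (LEAST k. \<exists>G. finite G \<and> card G = k \<and> generates R M G)"

definition trace_ideal :: "('a, 'b) ring_scheme \<Rightarrow> ('a, 'c) module \<Rightarrow> 'a set" where
  "trace_ideal R M = Idl\<^bsub>R\<^esub> (\<Union>h\<in>module_Hom R M (self_module R). h ` carrier M)"

section \<open>Graded modules\<close>

text \<open>
  A grading of a ring or module is the family of its homogeneous components, indexed by \<^typ>\<open>int\<close>.
\<close>

definition graded_module ::
    "('a, 'b) ring_scheme \<Rightarrow> (int \<Rightarrow> 'a set) \<Rightarrow> ('a, 'c) module \<Rightarrow> (int \<Rightarrow> 'c set) \<Rightarrow> bool" where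
  "graded_module R gr M gM \<longleftrightarrow>
     module R M \<and>
     (\<forall>p. additive_subgroup (gM p) M) \<and>
     (\<forall>x\<in>carrier M. \<exists>!c. (\<forall>p. c p \<in> gM p) \<and> finite {p. c p \<noteq> \<zero>\<^bsub>M\<^esub>} \<and>
                          x = finsum M c {p. c p \<noteq> \<zero>\<^bsub>M\<^esub>}) \<and>
     (\<forall>p q. \<forall>r\<in>gr p. \<forall>x\<in>gM q. r \<odot>\<^bsub>M\<^esub> x \<in> gM (p + q))"

definition quot_grading :: "('a, 'c) module \<Rightarrow> 'c set \<Rightarrow> (int \<Rightarrow> 'c set) \<Rightarrow> int \<Rightarrow> 'c set set" where
  "quot_grading M N gM p = (\<lambda>x. N +>\<^bsub>M\<^esub> x) ` gM p"

definition graded_iso ::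
    "('a, 'b) ring_scheme \<Rightarrow> ('a, 'c) module \<Rightarrow> (int \<Rightarrow> 'c set) \<Rightarrow>
     ('a, 'd) module \<Rightarrow> (int \<Rightarrow> 'd set) \<Rightarrow> bool" where
  "graded_iso R M gM N gN \<longleftrightarrow>
     (\<exists>h\<in>module_Hom R M N. bij_betw h (carrier M) (carrier N) \<and> (\<forall>p. h ` gM p = gN p))"

text \<open>
  For the nonnegatively graded rings considered here, whose degree \<open>0\<close> part is a field, this is the
  unique graded maximal ideal.
\<close>

definition graded_max_ideal :: "('a, 'b) ring_scheme \<Rightarrow> (int \<Rightarrow> 'a set) \<Rightarrow> 'a set" where
  "graded_max_ideal R gr = Idl\<^bsub>R\<^esub> (\<Union>p\<in>{0<..}. gr p)"

definition residue_module :: "('a, 'b) ring_scheme \<Rightarrow> (int \<Rightarrow> 'a set) \<Rightarrow> ('a, 'a set) module" where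
  "residue_module R gr = quot_module (self_module R) (graded_max_ideal R gr)"

definition residue_grading :: "('a, 'b) ring_scheme \<Rightarrow> (int \<Rightarrow> 'a set) \<Rightarrow> int \<Rightarrow> 'a set set" where
  "residue_grading R gr = quot_grading (self_module R) (graded_max_ideal R gr) gr"

section \<open>Graded free resolutions and graded Ext\<close>

text \<open>\<open>mat_map M p q A\<close> is the map \<open>M\<^sup>p \<rightarrow> M\<^sup>q\<close> given by a \<open>q \<times> p\<close> matrix over the ring.\<close>

definition mat_map ::
    "('a, 'c) module \<Rightarrow> nat \<Rightarrow> nat \<Rightarrow> (nat \<Rightarrow> nat \<Rightarrow> 'a) \<Rightarrow> (nat \<Rightarrow> 'c) \<Rightarrow> nat \<Rightarrow> 'c" where
  "mat_map M p q A v = (\<lambda>l\<in>{..<q}. \<Oplus>\<^bsub>M\<^esub>j\<in>{..<p}. A l j \<odot>\<^bsub>M\<^esub> v j)"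

text \<open>
  A resolution \<open>\<dots> \<rightarrow> F\<^sub>1 \<rightarrow> F\<^sub>0 \<rightarrow> M \<rightarrow> 0\<close> by graded free modules of finite rank:
  \<open>F\<^sub>i\<close> has a basis of \<open>b i\<close> homogeneous elements, the \<open>j\<close>-th one in degree \<open>s i j\<close>;
  the \<open>b i \<times> b (i + 1)\<close> matrix \<open>D i\<close> describes \<open>F\<^bsub>i+1\<^esub> \<rightarrow> F\<^sub>i\<close>, and the augmentation
  \<open>F\<^sub>0 \<rightarrow> M\<close> sends the \<open>j\<close>-th basis element to \<open>e j\<close>.
\<close>

definition graded_free_resolution ::
    "('a, 'b) ring_scheme \<Rightarrow> (int \<Rightarrow> 'a set) \<Rightarrow> ('a, 'c) module \<Rightarrow> (int \<Rightarrow> 'c set) \<Rightarrow>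
     (nat \<Rightarrow> nat) \<Rightarrow> (nat \<Rightarrow> nat \<Rightarrow> int) \<Rightarrow> (nat \<Rightarrow> nat \<Rightarrow> nat \<Rightarrow> 'a) \<Rightarrow> (nat \<Rightarrow> 'c) \<Rightarrow> bool" where
  "graded_free_resolution R gr M gM b s D e \<longleftrightarrow>
     (let F = (\<lambda>i. {..<b i} \<rightarrow>\<^sub>E carrier R);
          d = (\<lambda>i. mat_map (self_module R) (b (Suc i)) (b i) (D i));
          aug = (\<lambda>v. \<Oplus>\<^bsub>M\<^esub>j\<in>{..<b 0}. v j \<odot>\<^bsub>M\<^esub> e j)
      in (\<forall>j<b 0. e j \<in> gM (s 0 j)) \<and>
         (\<forall>i. \<forall>j<b i. \<forall>l<b (Suc i). D i j l \<in> gr (s (Suc i) l - s i j)) \<and>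
         aug ` F 0 = carrier M \<and>
         {v \<in> F 0. aug v = \<zero>\<^bsub>M\<^esub>} = d 0 ` F 1 \<and>
         (\<forall>i. {v \<in> F (Suc i). d i v = (\<lambda>j\<in>{..<b i}. \<zero>\<^bsub>R\<^esub>)} = d (Suc i) ` F (Suc (Suc i))))"

text \<open>
  The \<open>i\<close>-th cohomology of \<open>Hom(F, N)\<close>, where \<open>Hom(F\<^sub>i, N)\<close> is identified with
  \<open>N\<^bsup>b i\<^esup>\<close> by evaluation on the basis; a homomorphism of degree \<open>p\<close> sends a basis element of
  degree \<open>s\<close> to one of degree \<open>p + s\<close>.
\<close>

definition coboundary ::
    "(nat \<Rightarrow> nat) \<Rightarrow> (nat \<Rightarrow> nat \<Rightarrow> nat \<Rightarrow> 'a) \<Rightarrow> ('a, 'c) module \<Rightarrow> nat \<Rightarrow> (nat \<Rightarrow> 'c) \<Rightarrow> nat \<Rightarrow> 'c" where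
  "coboundary b D N i = mat_map N (b i) (b (Suc i)) (\<lambda>l j. D i j l)"

definition cocycles ::
    "(nat \<Rightarrow> nat) \<Rightarrow> (nat \<Rightarrow> nat \<Rightarrow> nat \<Rightarrow> 'a) \<Rightarrow> ('a, 'c) module \<Rightarrow> nat \<Rightarrow> (nat \<Rightarrow> 'c) set" where
  "cocycles b D N i =
     {v \<in> {..<b i} \<rightarrow>\<^sub>E carrier N. coboundary b D N i v = (\<lambda>l\<in>{..<b (Suc i)}. \<zero>\<^bsub>N\<^esub>)}"

definition coboundaries ::
    "(nat \<Rightarrow> nat) \<Rightarrow> (nat \<Rightarrow> nat \<Rightarrow> nat \<Rightarrow> 'a) \<Rightarrow> ('a, 'c) module \<Rightarrow> nat \<Rightarrow> (nat \<Rightarrow> 'c) set" where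
  "coboundaries b D N i =
     (case i of 0 \<Rightarrow> {\<lambda>j\<in>{..<b 0}. \<zero>\<^bsub>N\<^esub>}
      | Suc i' \<Rightarrow> coboundary b D N i' ` ({..<b i'} \<rightarrow>\<^sub>E carrier N))"

definition cocycle_module ::
    "(nat \<Rightarrow> nat) \<Rightarrow> (nat \<Rightarrow> nat \<Rightarrow> nat \<Rightarrow> 'a) \<Rightarrow> ('a, 'c) module \<Rightarrow> nat \<Rightarrow> ('a, nat \<Rightarrow> 'c) module" where
  "cocycle_module b D N i = (power_module N (b i)) \<lparr>carrier := cocycles b D N i\<rparr>"

definition Ext_module ::
    "(nat \<Rightarrow> nat) \<Rightarrow> (nat \<Rightarrow> nat \<Rightarrow> nat \<Rightarrow> 'a) \<Rightarrow> ('a, 'c) module \<Rightarrow> nat \<Rightarrow> ('a, (nat \<Rightarrow> 'c) set) module" where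
  "Ext_module b D N i = quot_module (cocycle_module b D N i) (coboundaries b D N i)"

definition Ext_grading ::
    "(nat \<Rightarrow> nat) \<Rightarrow> (nat \<Rightarrow> nat \<Rightarrow> int) \<Rightarrow> (nat \<Rightarrow> nat \<Rightarrow> nat \<Rightarrow> 'a) \<Rightarrow>
     ('a, 'c) module \<Rightarrow> (int \<Rightarrow> 'c set) \<Rightarrow> nat \<Rightarrow> int \<Rightarrow> (nat \<Rightarrow> 'c) set set" where
  "Ext_grading b s D N gN i =
     quot_grading (cocycle_module b D N i) (coboundaries b D N i)
       (\<lambda>p. {v \<in> cocycles b D N i. \<forall>j<b i. v j \<in> gN (p + s i j)})"

section \<open>The graded canonical module\<close>

text \<open>
  Following Bruns and Herzog: a finitely generated graded module \<open>C\<close> over a Cohen-Macaulay graded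
  ring \<open>R\<close> with graded maximal ideal \<open>m\<close> of height \<open>d\<close> is a graded canonical module if, as graded
  modules, \<open>Ext\<^sup>i(R/m, C)\<close> is \<open>R/m\<close> for \<open>i = d\<close> and zero otherwise.  It is unique up to graded
  isomorphism.  For the rings considered here \<open>d = dim R\<close>.  Since Ext does not depend on the
  resolution, it does not matter which graded free resolution of \<open>R/m\<close> is used.
\<close>

definition graded_canonical_module ::
    "('a, 'b) ring_scheme \<Rightarrow> (int \<Rightarrow> 'a set) \<Rightarrow> ('a, 'c) module \<Rightarrow> (int \<Rightarrow> 'c set) \<Rightarrow> bool" where
  "graded_canonical_module R gr C gC \<longleftrightarrow>
     graded_module R gr C gC \<and> fin_gen_module R C \<and>
     (\<exists>b s D e.
        graded_free_resolution R gr (residue_module R gr) (residue_grading R gr) b s D e \<and>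
        (\<forall>i. if enat i = prime_height R (graded_max_ideal R gr)
             then graded_iso R (Ext_module b D C i) (Ext_grading b s D C gC i)
                               (residue_module R gr) (residue_grading R gr)
             else carrier (Ext_module b D C i) = {\<zero>\<^bsub>Ext_module b D C i\<^esub>}))"

text \<open>In the following three notions \<open>W\<close> is the graded canonical module of \<open>R\<close>.\<close>

definition CM_type :: "('a, 'b) ring_scheme \<Rightarrow> ('a, 'c) module \<Rightarrow> nat" where
  "CM_type R W = min_num_gens R W"

definition nearly_Gorenstein ::
    "('a, 'b) ring_scheme \<Rightarrow> (int \<Rightarrow> 'a set) \<Rightarrow> ('a, 'c) module \<Rightarrow> bool" where
  "nearly_Gorenstein R gr W \<longleftrightarrow> graded_max_ideal R gr \<subseteq> trace_ideal R W"

definition min_homogeneous_gens ::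
    "('a, 'b) ring_scheme \<Rightarrow> ('a, 'c) module \<Rightarrow> (int \<Rightarrow> 'c set) \<Rightarrow> 'c set \<Rightarrow> bool" where
  "min_homogeneous_gens R M gM G \<longleftrightarrow>
     G \<subseteq> (\<Union>p. gM p) \<and> generates R M G \<and> (\<forall>H. H \<subset> G \<longrightarrow> \<not> generates R M H)"

definition level :: "('a, 'b) ring_scheme \<Rightarrow> ('a, 'c) module \<Rightarrow> (int \<Rightarrow> 'c set) \<Rightarrow> bool" where
  "level R W gW \<longleftrightarrow> (\<forall>G. min_homogeneous_gens R W gW G \<longrightarrow> (\<exists>p. G \<subseteq> gW p))"

end

theory Submission
  imports Defs "HOL-Library.Product_Plus"
begin

text \<open>
  Let \<open>R\<close> be the semigroup ring, \<open>m\<close> its graded maximal ideal and \<open>W\<close> the canonical module.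
  If \<open>W\<close> is not level, graded Nakayama leaves two homogeneous generators \<open>y1\<close>, \<open>y2\<close>, neither of
  them superfluous, whose degrees differ by some \<open>\<delta> > 0\<close> (\<open>not_level_generators\<close>).

  Suppose \<open>W\<close> is torsion-free of rank one.  Then there are homogeneous \<open>r\<close> and \<open>s \<noteq> 0\<close> with
  \<open>r y1 = s y2\<close> and \<open>deg r = deg s + \<delta>\<close>, and a homomorphism \<open>W \<rightarrow> R\<close> is determined by its values
  \<open>f\<close> on \<open>y1\<close> and \<open>g\<close> on \<open>y2\<close>, which satisfy \<open>r f = s g\<close>.  A nonzero constant term of \<open>f\<close> would make
  \<open>r\<close> a multiple of \<open>s\<close>, and then \<open>y2\<close> a multiple of \<open>y1\<close>.  So \<open>f\<close> has no constant term, and comparing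
  degrees in \<open>r f = s g\<close> shows that \<open>g\<close> has no component in degrees \<open>0\<close> and \<open>1\<close>.  Hence every element of
  degree \<open>1\<close> in the trace comes from components of degree \<open>1\<close> of such \<open>f\<close>, and \<open>r\<close> maps it into \<open>s R\<close>.  If the
  trace contains \<open>m\<close>, this gives \<open>r m \<subseteq> s R\<close>.  When \<open>m\<close> has height at least \<open>2\<close>, the Cohen-Macaulay
  property provides a regular sequence of length two in \<open>m\<close>, which forces \<open>r \<in> s R\<close>: a contradiction
  (\<open>two_generators_contradiction\<close>, \<open>depth_condition\<close>).  When the height is at most \<open>1\<close>, the semigroup
  has at most one minimal generator, and \<open>s\<close> divides \<open>r\<close> for reasons of degree.

  Torsion-freeness and rank one have to be extracted from the characterization of \<open>W\<close> by Ext.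
  Write \<open>W\<close> as \<open>R\<^sup>2/K\<close>, let \<open>k\<close> be the residue field and \<open>d\<close> the height of \<open>m\<close>.  The tool is
  \<open>prime_chain_of_ext_zero\<close>: if \<open>Ext\<^sup>i(k, M)\<close> vanishes for \<open>i < n\<close>, then above the annihilator of any
  nonzero homogeneous element of \<open>M\<close> there is a strict chain of \<open>n + 1\<close> primes that ends in \<open>m\<close>.
  Since \<open>Ext\<^sup>i(k, W) = 0\<close> for \<open>i < d\<close>, a nonzero homogeneous torsion element would allow the prime \<open>0\<close> to be
  put below such a chain, which is then longer than the height of \<open>m\<close> permits.  Rank one
  amounts to \<open>K \<noteq> 0\<close>: if \<open>K = 0\<close>, then \<open>Ext\<^sup>d(k, W) = Ext\<^sup>d(k, R)\<^sup>2\<close> is one-dimensional,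
  so \<open>Ext\<^sup>d(k, R) = 0\<close>, and the chain of primes is again too long.
\<close>

section \<open>Graded domains\<close>

text \<open>
  Rings are subsets of a type of class \<open>idom\<close>, so that arithmetic takes place in that type and
  only membership has to be tracked.
\<close>

definition ideal_of :: "'r::comm_ring_1 set \<Rightarrow> 'r set \<Rightarrow> bool" where
  "ideal_of R I \<longleftrightarrow>
     I \<subseteq> R \<and> 0 \<in> I \<and> (\<forall>a\<in>I. \<forall>b\<in>I. a + b \<in> I) \<and> (\<forall>r\<in>R. \<forall>a\<in>I. r * a \<in> I)"

definition prime_of :: "'r::comm_ring_1 set \<Rightarrow> 'r set \<Rightarrow> bool" where
  "prime_of R P \<longleftrightarrow>
     ideal_of R P \<and> 1 \<notin> P \<and> (\<forall>a\<in>R. \<forall>b\<in>R. a * b \<in> P \<longrightarrow> a \<in> P \<or> b \<in> P)"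

text \<open>
  The grading is given by the projections \<open>pr p\<close> onto the components of degree \<open>p\<close>, and the
  noetherian hypothesis by the maximality principle for families of ideals, which is the form used
  below.
\<close>

locale graded_domain =
  fixes R :: "'r::idom set" and pr :: "nat \<Rightarrow> 'r \<Rightarrow> 'r"
  assumes one: "1 \<in> R"
    and uminus: "a \<in> R \<Longrightarrow> - a \<in> R"
    and add: "a \<in> R \<Longrightarrow> b \<in> R \<Longrightarrow> a + b \<in> R"
    and mult: "a \<in> R \<Longrightarrow> b \<in> R \<Longrightarrow> a * b \<in> R"
    and pr_closed: "a \<in> R \<Longrightarrow> pr p a \<in> R"
    and pr_add: "a \<in> R \<Longrightarrow> b \<in> R \<Longrightarrow> pr p (a + b) = pr p a + pr p b"
    and pr_pr: "a \<in> R \<Longrightarrow> pr p (pr q a) = (if p = q then pr q a else 0)"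
    and pr_sum: "a \<in> R \<Longrightarrow> \<exists>n. a = (\<Sum>p<n. pr p a)"
    and pr_mult: "a \<in> R \<Longrightarrow> b \<in> R \<Longrightarrow> pr p a = a \<Longrightarrow> pr (p + q) (a * b) = a * pr q b"
    and pr_mult_less: "a \<in> R \<Longrightarrow> b \<in> R \<Longrightarrow> pr p a = a \<Longrightarrow> q < p \<Longrightarrow> pr q (a * b) = 0"
    and pr_one: "pr 0 1 = 1"
    and degree_0_unit: "a \<in> R \<Longrightarrow> pr 0 a = a \<Longrightarrow> a \<noteq> 0 \<Longrightarrow> \<exists>b\<in>R. a * b = 1"
    and noetherian: "F \<noteq> {} \<Longrightarrow> (\<And>I. I \<in> F \<Longrightarrow> ideal_of R I) \<Longrightarrow> \<exists>I\<in>F. \<forall>J\<in>F. I \<subseteq> J \<longrightarrow> J = I"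
begin

lemma zero: "0 \<in> R"
  using add[OF one uminus[OF one]] by simp

lemma diff: "a \<in> R \<Longrightarrow> b \<in> R \<Longrightarrow> a - b \<in> R"
  using add[of a "- b"] uminus by simp

lemma power: "a \<in> R \<Longrightarrow> a ^ n \<in> R"
  by (induction n) (auto simp: one mult)

lemma sum: "(\<And>i. i \<in> A \<Longrightarrow> f i \<in> R) \<Longrightarrow> sum f A \<in> R"
  by (induction A rule: infinite_finite_induct) (auto simp: zero add)

lemma pr_zero: "pr p 0 = 0"
  using pr_add[OF zero zero, of p] by (metis add.right_neutral add_left_cancel)

lemma pr_uminus: "a \<in> R \<Longrightarrow> pr p (- a) = - pr p a"
  using pr_add[of a "- a" p] uminus pr_zero by (simp add: eq_neg_iff_add_eq_0 add.commute)

lemma pr_diff: "a \<in> R \<Longrightarrow> b \<in> R \<Longrightarrow> pr p (a - b) = pr p a - pr p b"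
  using pr_add[of a "- b" p] pr_uminus uminus by simp

lemma pr_of_sum: "(\<And>i. i \<in> A \<Longrightarrow> f i \<in> R) \<Longrightarrow> pr p (sum f A) = (\<Sum>i\<in>A. pr p (f i))"
  by (induction A rule: infinite_finite_induct) (auto simp: pr_zero pr_add sum)

definition homog :: "'r \<Rightarrow> nat \<Rightarrow> bool" where
  "homog a p \<longleftrightarrow> a \<in> R \<and> pr p a = a"

lemma homogD: "homog a p \<Longrightarrow> a \<in> R" "homog a p \<Longrightarrow> pr p a = a"
  by (auto simp: homog_def)

lemma homog_pr: "a \<in> R \<Longrightarrow> homog (pr p a) p"
  by (simp add: homog_def pr_closed pr_pr)

lemma pr_homog: "homog a p \<Longrightarrow> pr q a = (if q = p then a else 0)"
  unfolding homog_def using pr_pr[of a q p] by auto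

lemma homog_zero: "homog 0 p"
  by (simp add: homog_def zero pr_zero)

lemma homog_one: "homog 1 0"
  by (simp add: homog_def one pr_one)

lemma homog_add: "homog a p \<Longrightarrow> homog b p \<Longrightarrow> homog (a + b) p"
  by (simp add: homog_def add pr_add)

lemma homog_mult: "homog a p \<Longrightarrow> homog b q \<Longrightarrow> homog (a * b) (p + q)"
  by (simp add: homog_def mult pr_mult)

lemma homog_power: "homog a p \<Longrightarrow> homog (a ^ n) (n * p)"
  by (induction n) (auto simp: homog_one intro: homog_mult)

definition irrelevant :: "'r set" where
  "irrelevant = {a \<in> R. pr 0 a = 0}"

lemma homog_irrelevant: "homog a p \<Longrightarrow> p > 0 \<Longrightarrow> a \<in> irrelevant"
  by (simp add: irrelevant_def homogD pr_homog)

lemma pr_0_mult: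
  assumes "a \<in> R" "b \<in> R"
  shows "pr 0 (a * b) = pr 0 a * pr 0 b"
proof -
  obtain n where n: "a = (\<Sum>p<n. pr p a)" using pr_sum assms by blast
  have "pr 0 a = (\<Sum>p<n. pr 0 (pr p a))"
    using n pr_of_sum[of "{..<n}" "\<lambda>p. pr p a" 0] assms pr_closed by auto
  also have "\<dots> = (\<Sum>p<n. if p = 0 then pr p a else 0)"
    by (rule sum.cong) (auto simp: pr_pr assms)
  finally have pr0: "pr 0 a = (\<Sum>p<n. if p = 0 then pr p a else 0)" .
  have *: "pr 0 (pr p a * b) = (if p = 0 then pr p a * pr 0 b else 0)" for p
    using pr_mult[of "pr 0 a" b 0 0] pr_mult_less[of "pr p a" b p 0] assms
    by (auto simp: pr_closed pr_pr)
  have "a * b = (\<Sum>p<n. pr p a * b)"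
    using n by (metis sum_distrib_right)
  then have "pr 0 (a * b) = (\<Sum>p<n. pr 0 (pr p a * b))"
    using pr_of_sum[of "{..<n}" "\<lambda>p. pr p a * b" 0] assms pr_closed mult by auto
  also have "\<dots> = (\<Sum>p<n. if p = 0 then pr p a else 0) * pr 0 b"
    by (simp add: * sum_distrib_right if_distrib cong: if_cong)
  finally show ?thesis using pr0 by simp
qed

lemma ideal_of_irrelevant: "ideal_of R irrelevant"
  unfolding ideal_of_def irrelevant_def
  by (auto simp: zero pr_zero add pr_add mult pr_0_mult)

lemma prime_of_irrelevant: "prime_of R irrelevant"
  unfolding prime_of_def using ideal_of_irrelevant
  by (auto simp: irrelevant_def pr_one pr_0_mult)

lemma prime_of_0: "prime_of R {0}"
  by (auto simp: prime_of_def ideal_of_def zero)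

lemma ideal_of_principal: "a \<in> R \<Longrightarrow> ideal_of R {r * a |r. r \<in> R}"
proof -
  assume a: "a \<in> R"
  have "0 \<in> {r * a |r. r \<in> R}" using zero by force
  moreover have "u + v \<in> {r * a |r. r \<in> R}" if "u \<in> {r * a |r. r \<in> R}" "v \<in> {r * a |r. r \<in> R}" for u v
    using that add by (auto simp: distrib_right[symmetric])
  moreover have "s * u \<in> {r * a |r. r \<in> R}" if "s \<in> R" "u \<in> {r * a |r. r \<in> R}" for s u
    using that mult by (auto simp: mult.assoc[symmetric])
  ultimately show ?thesis using mult a unfolding ideal_of_def by blast
qed

lemma ideal_sum: "ideal_of R I \<Longrightarrow> (\<And>i. i \<in> A \<Longrightarrow> f i \<in> I) \<Longrightarrow> sum f A \<in> I"
  by (induction A rule: infinite_finite_induct) (auto simp: ideal_of_def)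

text \<open>
  Take an ideal that is maximal among those containing \<open>I\<close> and disjoint from the multiplicative
  set of all \<open>s * t ^ c\<close> with \<open>s\<close> outside \<open>P\<close>.  As in Krull's theorem it is prime; being disjoint
  from the complement of \<open>P\<close>, it lies inside \<open>P\<close>.
\<close>

lemma exists_prime_avoiding:
  assumes I: "ideal_of R I" and P: "prime_of R P" and t: "t \<in> R"
    and avoid: "\<And>s c. s \<in> R - P \<Longrightarrow> s * t ^ c \<notin> I"
  shows "\<exists>Q. prime_of R Q \<and> I \<subseteq> Q \<and> Q \<subseteq> P \<and> t \<notin> Q"
proof -
  define F where "F = {J. ideal_of R J \<and> I \<subseteq> J \<and> (\<forall>s\<in>R - P. \<forall>c. s * t ^ c \<notin> J)}"
  have "I \<in> F" using I avoid by (simp add: F_def)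
  then have "F \<noteq> {}" by blast
  moreover have "\<And>J. J \<in> F \<Longrightarrow> ideal_of R J" by (simp add: F_def)
  ultimately obtain J where J: "J \<in> F" and max: "\<And>J'. J' \<in> F \<Longrightarrow> J \<subseteq> J' \<Longrightarrow> J' = J"
    using noetherian[of F] by blast
  have idJ: "ideal_of R J" and av: "s \<in> R - P \<Longrightarrow> s * t ^ c \<notin> J" for s c
    using J by (auto simp: F_def)
  have oneP: "1 \<in> R - P" using P one by (auto simp: prime_of_def)
  have enlarge: "\<exists>s\<in>R - P. \<exists>c. \<exists>j\<in>J. \<exists>x\<in>R. s * t ^ c = j + x * a" if a: "a \<in> R" "a \<notin> J" for a
  proof -
    define J' where "J' = {j + x * a |j x. j \<in> J \<and> x \<in> R}"
    have "ideal_of R J'"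
    proof -
      have "0 \<in> J'"
        using idJ zero unfolding J'_def ideal_of_def
        by (metis (mono_tags, lifting) add.left_neutral mem_Collect_eq mult_zero_left)
      moreover have "u + v \<in> J'" if uv: "u \<in> J'" "v \<in> J'" for u v
      proof -
        obtain j x j' x' where "u = j + x * a" "j \<in> J" "x \<in> R" "v = j' + x' * a" "j' \<in> J" "x' \<in> R"
          using uv unfolding J'_def by blast
        then have "u + v = (j + j') + (x + x') * a" "j + j' \<in> J" "x + x' \<in> R"
          using idJ by (simp_all add: algebra_simps add ideal_of_def)
        then show ?thesis unfolding J'_def by blast
      qed
      moreover have "r * u \<in> J'" if ur: "u \<in> J'" "r \<in> R" for u r
      proof -
        obtain j x where "u = j + x * a" "j \<in> J" "x \<in> R" using ur unfolding J'_def by blast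
        then have "r * u = r * j + (r * x) * a" "r * j \<in> J" "r * x \<in> R"
          using idJ ur by (simp_all add: distrib_left mult.assoc mult ideal_of_def)
        then show ?thesis unfolding J'_def by blast
      qed
      moreover have "J' \<subseteq> R"
        using idJ a unfolding J'_def ideal_of_def by (auto intro!: add mult)
      ultimately show ?thesis unfolding ideal_of_def by blast
    qed
    moreover have "J \<subseteq> J'" using zero unfolding J'_def by (metis (mono_tags, lifting) add.right_neutral mem_Collect_eq mult_zero_left subsetI)
    moreover have "a \<in> J'"
      using idJ one unfolding J'_def ideal_of_def
      by (metis (mono_tags, lifting) add.left_neutral mem_Collect_eq mult_1)
    ultimately have "ideal_of R J'" "J \<subseteq> J'" "J' \<notin> F" using max[of J'] a by blast+
    then obtain s c where "s \<in> R - P" "s * t ^ c \<in> J'" using J unfolding F_def by blast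
    then show ?thesis unfolding J'_def by blast
  qed
  have "prime_of R J"
    unfolding prime_of_def
  proof (intro conjI ballI impI)
    show "ideal_of R J" by (rule idJ)
    show "1 \<notin> J" using av[OF oneP, of 0] by simp
    fix a b assume ab: "a \<in> R" "b \<in> R" "a * b \<in> J"
    show "a \<in> J \<or> b \<in> J"
    proof (rule ccontr)
      assume "\<not> ?thesis"
      then have nJ: "a \<notin> J" "b \<notin> J" by auto
      obtain s c j x where 1: "s \<in> R - P" "j \<in> J" "x \<in> R" "s * t ^ c = j + x * a"
        using enlarge[OF ab(1) nJ(1)] by blast
      obtain s' c' j' x' where 2: "s' \<in> R - P" "j' \<in> J" "x' \<in> R" "s' * t ^ c' = j' + x' * b"
        using enlarge[OF ab(2) nJ(2)] by blast
      have "(s * s') * t ^ (c + c') = (s * t ^ c) * (s' * t ^ c')"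
        by (simp add: power_add mult_ac)
      also have "\<dots> = (j' + x' * b) * j + ((x * a) * j' + (x * x') * (a * b))"
        unfolding 1 2 by (simp add: algebra_simps)
      also have "\<dots> \<in> J"
      proof -
        have cl: "u + v \<in> J" if "u \<in> J" "v \<in> J" for u v using that idJ by (simp add: ideal_of_def)
        have sc: "r * u \<in> J" if "r \<in> R" "u \<in> J" for r u using that idJ by (simp add: ideal_of_def)
        have "j' \<in> R" using 2 idJ by (auto simp: ideal_of_def)
        then show ?thesis
          using cl[OF sc[of "j' + x' * b" j] cl[OF sc[of "x * a" j'] sc[of "x * x'" "a * b"]]]
            1 2 ab by (simp add: add mult)
      qed
      finally have "(s * s') * t ^ (c + c') \<in> J" .
      moreover have "s * s' \<in> R - P" using 1 2 P by (auto simp: prime_of_def mult)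
      ultimately show False using av by blast
    qed
  qed
  moreover have "J \<subseteq> P"
  proof
    fix s assume s: "s \<in> J"
    then have "s \<in> R" using idJ by (auto simp: ideal_of_def)
    then show "s \<in> P" using av[of s 0] s by (metis DiffI mult.right_neutral power_0)
  qed
  moreover have "t \<notin> J" using av[OF oneP, of 1] by simp
  moreover have "I \<subseteq> J" using J by (auto simp: F_def)
  ultimately show ?thesis by blast
qed

end

section \<open>Graded modules over a graded domain\<close>

definition submodule_of :: "'r set \<Rightarrow> ('r \<Rightarrow> 'm \<Rightarrow> 'm) \<Rightarrow> 'm::ab_group_add set \<Rightarrow> 'm set \<Rightarrow> bool" where
  "submodule_of R scale M N \<longleftrightarrow>
     N \<subseteq> M \<and> 0 \<in> N \<and> (\<forall>x\<in>N. \<forall>y\<in>N. x + y \<in> N) \<and> (\<forall>r\<in>R. \<forall>x\<in>N. scale r x \<in> N)"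

locale graded_module_over = graded_domain R pr
  for R :: "'r::idom set" and pr :: "nat \<Rightarrow> 'r \<Rightarrow> 'r" +
  fixes M :: "'m::ab_group_add set" and scale :: "'r \<Rightarrow> 'm \<Rightarrow> 'm" (infixr \<open>\<bullet>\<close> 75)
    and prM :: "nat \<Rightarrow> 'm \<Rightarrow> 'm"
  assumes zeroM: "0 \<in> M"
    and addM: "x \<in> M \<Longrightarrow> y \<in> M \<Longrightarrow> x + y \<in> M"
    and scaleM: "r \<in> R \<Longrightarrow> x \<in> M \<Longrightarrow> r \<bullet> x \<in> M"
    and scale_right_distrib: "r \<bullet> (x + y) = r \<bullet> x + r \<bullet> y"
    and scale_left_distrib: "(r + s) \<bullet> x = r \<bullet> x + s \<bullet> x"
    and scale_scale: "r \<bullet> s \<bullet> x = (r * s) \<bullet> x"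
    and scale_one: "1 \<bullet> x = x"
    and prM_closed: "x \<in> M \<Longrightarrow> prM p x \<in> M"
    and prM_add: "x \<in> M \<Longrightarrow> y \<in> M \<Longrightarrow> prM p (x + y) = prM p x + prM p y"
    and prM_prM: "x \<in> M \<Longrightarrow> prM p (prM q x) = (if p = q then prM q x else 0)"
    and prM_sum: "x \<in> M \<Longrightarrow> \<exists>n. x = (\<Sum>p<n. prM p x)"
    and prM_scale: "r \<in> R \<Longrightarrow> x \<in> M \<Longrightarrow> pr p r = r \<Longrightarrow> prM (p + q) (r \<bullet> x) = r \<bullet> prM q x"
    and prM_scale_less: "r \<in> R \<Longrightarrow> x \<in> M \<Longrightarrow> pr p r = r \<Longrightarrow> q < p \<Longrightarrow> prM q (r \<bullet> x) = 0"
    and noetherianM: "F \<noteq> {} \<Longrightarrow> (\<And>N. N \<in> F \<Longrightarrow> submodule_of R scale M N) \<Longrightarrow>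
          \<exists>N\<in>F. \<forall>N'\<in>F. N \<subseteq> N' \<longrightarrow> N' = N"
begin

lemma scale_zero_right: "r \<bullet> 0 = 0"
  using scale_right_distrib[of r 0 0] by simp

lemma scale_zero_left: "0 \<bullet> x = 0"
  using scale_left_distrib[of 0 0 x] by simp

lemma scale_minus_left: "(- r) \<bullet> x = - (r \<bullet> x)"
  using scale_left_distrib[of r "- r" x] scale_zero_left[of x]
  by (simp add: eq_neg_iff_add_eq_0 add.commute)

lemma scale_minus_right: "r \<bullet> (- x) = - (r \<bullet> x)"
  using scale_right_distrib[of r x "- x"] scale_zero_right[of r]
  by (simp add: eq_neg_iff_add_eq_0 add.commute)

lemma uminusM: "x \<in> M \<Longrightarrow> - x \<in> M"
  using scaleM[OF uminus[OF one], of x] by (simp add: scale_minus_left scale_one)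

lemma diffM: "x \<in> M \<Longrightarrow> y \<in> M \<Longrightarrow> x - y \<in> M"
  using addM[of x "- y"] uminusM by simp

lemma scale_diff_right: "r \<bullet> (x - y) = r \<bullet> x - r \<bullet> y"
  using scale_right_distrib[of r x "- y"] by (simp add: scale_minus_right)

lemma scale_sum_right: "r \<bullet> (\<Sum>i\<in>A. f i) = (\<Sum>i\<in>A. r \<bullet> f i)"
  by (induction A rule: infinite_finite_induct) (auto simp: scale_zero_right scale_right_distrib)

lemma scale_sum_left: "(\<Sum>i\<in>A. f i) \<bullet> x = (\<Sum>i\<in>A. f i \<bullet> x)"
  by (induction A rule: infinite_finite_induct) (auto simp: scale_zero_left scale_left_distrib)

lemma sumM: "(\<And>i. i \<in> A \<Longrightarrow> f i \<in> M) \<Longrightarrow> sum f A \<in> M"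
  by (induction A rule: infinite_finite_induct) (auto simp: zeroM addM)

lemma prM_zero: "prM p 0 = 0"
  using prM_add[OF zeroM zeroM, of p] by simp

lemma prM_of_sum: "(\<And>i. i \<in> A \<Longrightarrow> f i \<in> M) \<Longrightarrow> prM p (sum f A) = (\<Sum>i\<in>A. prM p (f i))"
  by (induction A rule: infinite_finite_induct) (auto simp: prM_zero prM_add sumM)

abbreviation submod :: "'m set \<Rightarrow> bool" where
  "submod \<equiv> submodule_of R scale M"

lemma submodD:
  assumes "submod N"
  shows "x \<in> N \<Longrightarrow> x \<in> M" "0 \<in> N" "x \<in> N \<Longrightarrow> y \<in> N \<Longrightarrow> x + y \<in> N"
    "r \<in> R \<Longrightarrow> x \<in> N \<Longrightarrow> r \<bullet> x \<in> N"
  using assms by (auto simp: submodule_of_def)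

lemma submod_uminus: "submod N \<Longrightarrow> x \<in> N \<Longrightarrow> - x \<in> N"
  using submodD(4)[of N "- 1" x] uminus[OF one] by (simp add: scale_minus_left scale_one)

lemma submod_diff: "submod N \<Longrightarrow> x \<in> N \<Longrightarrow> y \<in> N \<Longrightarrow> x - y \<in> N"
  using submodD(3)[of N x "- y"] submod_uminus by simp

lemma submod_sum: "submod N \<Longrightarrow> (\<And>i. i \<in> A \<Longrightarrow> f i \<in> N) \<Longrightarrow> sum f A \<in> N"
  by (induction A rule: infinite_finite_induct) (auto simp: submodD)

definition graded_submod :: "'m set \<Rightarrow> bool" where
  "graded_submod N \<longleftrightarrow> submod N \<and> (\<forall>x\<in>N. \<forall>p. prM p x \<in> N)"

definition homM :: "'m \<Rightarrow> nat \<Rightarrow> bool" where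
  "homM x p \<longleftrightarrow> x \<in> M \<and> prM p x = x"

lemma homM_prM: "x \<in> M \<Longrightarrow> homM (prM p x) p"
  by (simp add: homM_def prM_closed prM_prM)

lemma prM_homM: "homM x p \<Longrightarrow> prM q x = (if q = p then x else 0)"
  unfolding homM_def using prM_prM[of x q p] by auto

lemma homM_scale: "homog r p \<Longrightarrow> homM x q \<Longrightarrow> homM (r \<bullet> x) (p + q)"
  by (simp add: homog_def homM_def scaleM prM_scale)

lemma prM_scale_homM:
  assumes r: "r \<in> R" and x: "homM x q"
  shows "prM (p + q) (r \<bullet> x) = pr p r \<bullet> x"
proof -
  have xM: "x \<in> M" using x by (simp add: homM_def)
  obtain n where n: "r = (\<Sum>p<n. pr p r)" using pr_sum r by blast
  have "pr p r = (\<Sum>p'<n. pr p (pr p' r))"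
    using n pr_of_sum[of "{..<n}" "\<lambda>p. pr p r" p] r pr_closed by auto
  also have "\<dots> = (\<Sum>p'<n. if p = p' then pr p' r else 0)"
    by (rule sum.cong) (auto simp: pr_pr r)
  finally have pr: "pr p r = (\<Sum>p'<n. if p = p' then pr p' r else 0)" .
  have *: "prM (p + q) (pr p' r \<bullet> x) = (if p = p' then pr p' r else 0) \<bullet> x" for p'
    using prM_homM[OF homM_scale[OF homog_pr[OF r] x], of "p + q" p'] by (simp add: scale_zero_left)
  have "r \<bullet> x = (\<Sum>p<n. pr p r \<bullet> x)"
    using n by (metis scale_sum_left)
  then have "prM (p + q) (r \<bullet> x) = (\<Sum>p'<n. prM (p + q) (pr p' r \<bullet> x))"
    using prM_of_sum[of "{..<n}" "\<lambda>p. pr p r \<bullet> x" "p + q"] r pr_closed scaleM xM by auto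
  also have "\<dots> = (\<Sum>p'<n. if p = p' then pr p' r else 0) \<bullet> x"
    by (subst *) (simp only: scale_sum_left)
  finally show ?thesis using pr by simp
qed

lemma in_graded_submodI:
  assumes "submod N" "x \<in> M" "\<And>p. prM p x \<in> N"
  shows "x \<in> N"
  using prM_sum[of x] submod_sum[of N] assms by metis

lemma proper_graded_submod:
  assumes N: "graded_submod N" "N \<noteq> M"
  shows "\<exists>y q. homM y q \<and> y \<notin> N"
proof -
  have "submod N" using N by (simp add: graded_submod_def)
  moreover from this obtain x where x: "x \<in> M" "x \<notin> N" using N by (auto simp: submodule_of_def)
  ultimately obtain p where "prM p x \<notin> N" using in_graded_submodI by blast
  then show ?thesis using homM_prM x by blast
qed

subsection \<open>Annihilators\<close>

definition ann :: "'m set \<Rightarrow> 'm \<Rightarrow> 'r set" where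
  "ann N y = {r \<in> R. r \<bullet> y \<in> N}"

lemma ideal_ann: "submod N \<Longrightarrow> ideal_of R (ann N y)"
  unfolding ideal_of_def ann_def
  by (auto simp: zero scale_zero_left submodD add mult scale_left_distrib scale_scale[symmetric])

lemma pr_ann:
  assumes "graded_submod N" "homM y q" "r \<in> ann N y"
  shows "pr p r \<in> ann N y"
proof -
  have "r \<in> R" "r \<bullet> y \<in> N" using assms by (auto simp: ann_def)
  then have "prM (p + q) (r \<bullet> y) \<in> N" using assms by (simp add: graded_submod_def)
  then show ?thesis
    using prM_scale_homM[OF \<open>r \<in> R\<close> assms(2), of p] \<open>r \<in> R\<close> by (simp add: ann_def pr_closed)
qed

text \<open>
  The maximal annihilators of homogeneous elements of \<open>M/N\<close> play the part of the associated
  primes.  Every homogeneous zero divisor on \<open>M/N\<close> lies in one of them, and if none of them contains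
  \<open>m\<close>, avoiding all of them at once produces a homogeneous regular element.
\<close>

definition max_ann :: "'m set \<Rightarrow> 'r set \<Rightarrow> bool" where
  "max_ann N P \<longleftrightarrow> (\<exists>y q. homM y q \<and> y \<notin> N \<and> P = ann N y) \<and>
     (\<forall>y q. homM y q \<and> y \<notin> N \<and> P \<subseteq> ann N y \<longrightarrow> ann N y = P)"

lemma max_ann_exists:
  assumes N: "submod N" and y: "homM y q" "y \<notin> N"
  shows "\<exists>P. max_ann N P \<and> ann N y \<subseteq> P"
proof -
  define F where "F = {ann N z |z p. homM z p \<and> z \<notin> N \<and> ann N y \<subseteq> ann N z}"
  have "ann N y \<in> F" using y by (auto simp: F_def)
  moreover have "\<And>I. I \<in> F \<Longrightarrow> ideal_of R I" using N by (auto simp: F_def ideal_ann)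
  ultimately obtain P where P: "P \<in> F" and max: "\<And>J. J \<in> F \<Longrightarrow> P \<subseteq> J \<Longrightarrow> J = P"
    using noetherian[of F] by blast
  have "max_ann N P"
    unfolding max_ann_def
  proof (intro conjI allI impI)
    show "\<exists>y q. homM y q \<and> y \<notin> N \<and> P = ann N y" using P by (auto simp: F_def)
    fix z p assume z: "homM z p \<and> z \<notin> N \<and> P \<subseteq> ann N z"
    have "ann N z \<in> F" using z P by (auto simp: F_def)
    then show "ann N z = P" using max z by blast
  qed
  then show ?thesis using P by (auto simp: F_def)
qed

lemma max_ann_ideal: "submod N \<Longrightarrow> max_ann N P \<Longrightarrow> ideal_of R P"
  by (auto simp: max_ann_def ideal_ann)

lemma max_ann_pr: "graded_submod N \<Longrightarrow> max_ann N P \<Longrightarrow> r \<in> P \<Longrightarrow> pr p r \<in> P"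
  by (auto simp: max_ann_def pr_ann)

lemma max_ann_prime:
  assumes N: "submod N" and P: "max_ann N P" and ab: "homog a p" "homog b q" "a * b \<in> P"
  shows "a \<in> P \<or> b \<in> P"
proof -
  obtain y k where y: "homM y k" "y \<notin> N" "P = ann N y" using P by (auto simp: max_ann_def)
  show ?thesis
  proof (rule ccontr)
    assume not: "\<not> ?thesis"
    have b: "homM (b \<bullet> y) (q + k)" using homM_scale ab y by blast
    have "b \<bullet> y \<notin> N" using not y ab by (auto simp: ann_def homogD)
    moreover have "r \<bullet> b \<bullet> y \<in> N" if "r \<bullet> y \<in> N" for r
      using submodD(4)[OF N homogD(1)[OF ab(2)] that] by (simp add: scale_scale mult.commute)
    then have "P \<subseteq> ann N (b \<bullet> y)"
      using y by (auto simp: ann_def)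
    ultimately have "ann N (b \<bullet> y) = P" using P b by (auto simp: max_ann_def)
    moreover have "a \<in> ann N (b \<bullet> y)" using ab y by (auto simp: ann_def scale_scale homogD)
    ultimately show False using not by blast
  qed
qed

text \<open>
  Equivalently, \<open>Hom(k, M/N) = 0\<close>.
\<close>

definition no_socle :: "'m set \<Rightarrow> bool" where
  "no_socle N \<longleftrightarrow> (\<forall>y\<in>M. (\<forall>f\<in>irrelevant. f \<bullet> y \<in> N) \<longrightarrow> y \<in> N)"

text \<open>
  Without a socle, \<open>P\<close> misses some homogeneous element of positive degree.  Distinct maximal
  annihilators are incomparable, so that element can be multiplied by one from each member of \<open>Q\<close>
  that is not in \<open>P\<close>.
\<close>

lemma max_ann_separate:
  assumes N: "graded_submod N" "no_socle N" and P: "max_ann N P"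
    and Q: "finite Q" "\<And>P'. P' \<in> Q \<Longrightarrow> max_ann N P'" "P \<notin> Q"
  shows "\<exists>g e. e > 0 \<and> homog g e \<and> g \<notin> P \<and> (\<forall>P'\<in>Q. g \<in> P')"
  using Q
proof (induction Q rule: finite_induct)
  case empty
  obtain y q where y: "homM y q" "y \<notin> N" "P = ann N y" using P by (auto simp: max_ann_def)
  obtain f where f: "f \<in> irrelevant" "f \<bullet> y \<notin> N"
    using N y by (auto simp: no_socle_def homM_def)
  then have fR: "f \<in> R" "pr 0 f = 0" by (auto simp: irrelevant_def)
  have sub: "submod N" using N by (simp add: graded_submod_def)
  obtain n where n: "f = (\<Sum>p<n. pr p f)" using pr_sum fR by blast
  have "\<exists>p. pr p f \<bullet> y \<notin> N"
  proof (rule ccontr)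
    assume "\<not> ?thesis"
    then have "(\<Sum>p<n. pr p f \<bullet> y) \<in> N" by (intro submod_sum[OF sub]) auto
    then show False using n f by (metis scale_sum_left)
  qed
  then obtain p where p: "pr p f \<bullet> y \<notin> N" by blast
  have "p > 0" using p fR sub by (cases p) (auto simp: scale_zero_left submodD)
  then show ?case using p y fR homog_pr[of f p] by (auto simp: ann_def)
next
  case (insert P' Q)
  then obtain g e where g: "e > 0" "homog g e" "g \<notin> P" "\<forall>P'\<in>Q. g \<in> P'" by auto
  have sub: "submod N" using N by (simp add: graded_submod_def)
  have P': "max_ann N P'" "P' \<noteq> P" using insert by auto
  obtain y q where y: "homM y q" "y \<notin> N" "P = ann N y" using P by (auto simp: max_ann_def)
  have "\<not> P' \<subseteq> P" using P' y by (metis max_ann_def)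
  then obtain a where a: "a \<in> P'" "a \<notin> P" by blast
  have aR: "a \<in> R" using a max_ann_ideal[OF sub P'(1)] by (auto simp: ideal_of_def)
  obtain n where n: "a = (\<Sum>p<n. pr p a)" using pr_sum aR by blast
  have "\<exists>p. pr p a \<notin> P"
    using n a ideal_sum[OF max_ann_ideal[OF sub P], of "{..<n}" "\<lambda>p. pr p a"] by auto
  then obtain p where p: "pr p a \<notin> P" by blast
  have hp: "homog (pr p a) p" using homog_pr aR .
  have pP': "pr p a \<in> P'" using max_ann_pr[OF N(1) P'(1)] a by blast
  have "g * pr p a \<notin> P" using max_ann_prime[OF sub P g(2) hp] g p by blast
  moreover have "homog (g * pr p a) (e + p)" using homog_mult g hp by blast
  moreover have "g * pr p a \<in> P'"
    using pP' g max_ann_ideal[OF sub P'(1)] by (auto simp: ideal_of_def homogD)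
  moreover have "g * pr p a \<in> P''" if "P'' \<in> Q" for P''
    using that g hp insert max_ann_ideal[OF sub, of P''] by (auto simp: ideal_of_def homogD mult.commute[of g])
  ultimately show ?case using g by (intro exI[of _ "g * pr p a"] exI[of _ "e + p"]) auto
qed

text \<open>
  For a finite set \<open>Q\<close> of maximal annihilators let \<open>A Q\<close> consist of the elements that are killed,
  modulo \<open>N\<close>, by the intersection of \<open>Q\<close>.  These submodules grow with \<open>Q\<close>.  If \<open>A Q\<close> is maximal
  among them, \<open>Q\<close> already contains every maximal annihilator: an element with annihilator \<open>P\<close> lies in
  \<open>A (insert P Q)\<close> and so in \<open>A Q\<close>, which contradicts the separation of \<open>P\<close> from \<open>Q\<close>.
\<close>

lemma finite_max_ann:
  assumes N: "graded_submod N" "no_socle N"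
  shows "finite {P. max_ann N P}"
proof -
  have sub: "submod N" using N by (simp add: graded_submod_def)
  define A where "A Q = {x \<in> M. \<forall>g\<in>R. (\<forall>P\<in>Q. g \<in> P) \<longrightarrow> g \<bullet> x \<in> N}" for Q :: "'r set set"
  have subA: "submod (A Q)" for Q
  proof -
    have "g \<bullet> r \<bullet> x \<in> N" if "r \<in> R" "g \<bullet> x \<in> N" for g r x
      using submodD(4)[OF sub that] by (simp add: scale_scale mult.commute)
    then show ?thesis
      unfolding submodule_of_def A_def
      by (auto simp: zeroM addM scaleM scale_zero_right scale_right_distrib submodD[OF sub])
  qed
  define F where "F = A ` {Q. finite Q \<and> (\<forall>P\<in>Q. max_ann N P)}"
  have "A {} \<in> F" by (auto simp: F_def)
  then have "F \<noteq> {}" by blast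
  moreover have "\<And>U. U \<in> F \<Longrightarrow> submod U" using subA by (auto simp: F_def)
  ultimately obtain U where U: "U \<in> F" and max: "\<And>V. V \<in> F \<Longrightarrow> U \<subseteq> V \<Longrightarrow> V = U"
    using noetherianM[of F]  by blast
  obtain Q where Q: "finite Q" "\<And>P. P \<in> Q \<Longrightarrow> max_ann N P" "U = A Q" using U by (auto simp: F_def)
  have "P \<in> Q" if P: "max_ann N P" for P
  proof (rule ccontr)
    assume nQ: "P \<notin> Q"
    obtain y q where y: "homM y q" "y \<notin> N" "P = ann N y" using P by (auto simp: max_ann_def)
    obtain g e where g: "homog g e" "g \<notin> P" "\<forall>P'\<in>Q. g \<in> P'"
      using max_ann_separate[OF N P Q(1,2) nQ] by blast
    have "A (insert P Q) \<in> F" using Q P by (auto simp: F_def)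
    moreover have "A Q \<subseteq> A (insert P Q)" by (auto simp: A_def)
    ultimately have "A (insert P Q) = A Q" using max Q by blast
    moreover have "y \<in> A (insert P Q)" using y by (auto simp: A_def ann_def homM_def)
    ultimately have "g \<bullet> y \<in> N" using g by (auto simp: A_def homogD)
    then show False using g y by (auto simp: ann_def homogD)
  qed
  then show ?thesis using Q finite_subset[of "{P. max_ann N P}" Q] by blast
qed

text \<open>
  Homogeneous prime avoidance.  The powers in the induction step only equalize the degrees of the
  two summands.
\<close>

lemma max_ann_avoid:
  assumes N: "graded_submod N" "no_socle N"
    and Q: "finite Q" "\<And>P'. P' \<in> Q \<Longrightarrow> max_ann N P'"
  shows "\<exists>f e. e > 0 \<and> homog f e \<and> (\<forall>P\<in>Q. f \<notin> P)"
  using Q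
proof (induction Q rule: finite_induct)
  case empty
  then show ?case by (intro exI[of _ 0] exI[of _ 1]) (simp add: homog_zero)
next
  case (insert P Q)
  have sub: "submod N" using N by (simp add: graded_submod_def)
  obtain f e where f: "e > 0" "homog f e" "\<forall>P\<in>Q. f \<notin> P" using insert by auto
  show ?case
  proof (cases "f \<in> P")
    case False
    then show ?thesis using f by auto
  next
    case True
    obtain g k where g: "k > 0" "homog g k" "g \<notin> P" "\<forall>P'\<in>Q. g \<in> P'"
      using max_ann_separate[OF N, of P Q] insert by auto
    have pow: "homog a q \<Longrightarrow> max_ann N P' \<Longrightarrow> n > 0 \<Longrightarrow> a ^ n \<in> P' \<longleftrightarrow> a \<in> P'" for a q n P'
    proof (induction n)
      case (Suc n)
      have "a * a ^ n \<in> P' \<longleftrightarrow> a \<in> P' \<or> a ^ n \<in> P'"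
        using max_ann_prime[OF sub Suc.prems(2) Suc.prems(1) homog_power[OF Suc.prems(1)], of n]
          max_ann_ideal[OF sub Suc.prems(2)] homogD(1)[OF Suc.prems(1)]
          homogD(1)[OF homog_power[OF Suc.prems(1), of n]]
        unfolding ideal_of_def by (metis mult.commute)
      then show ?case
        using Suc by (cases "n = 0") auto
    qed auto
    have ideal_diff: "a + b \<in> P' \<Longrightarrow> a \<in> P' \<Longrightarrow> b \<in> P'" if "max_ann N P'" for a b P'
    proof -
      assume "a + b \<in> P'" "a \<in> P'"
      then have "(a + b) + (- 1) * a \<in> P'"
        using max_ann_ideal[OF sub that] uminus[OF one] unfolding ideal_of_def by blast
      then show "b \<in> P'" by simp
    qed
    let ?h = "f ^ k + g ^ e"
    have "homog ?h (k * e)"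
      using homog_add[OF homog_power[OF f(2), of k]] homog_power[OF g(2), of e] by (simp add: mult.commute)
    moreover have "?h \<notin> P"
      using ideal_diff[of P "f ^ k" "g ^ e"] pow[OF f(2), of P k] pow[OF g(2), of P e] True f g insert.prems
      by auto
    moreover have "?h \<notin> P'" if "P' \<in> Q" for P'
      using ideal_diff[of P' "g ^ e" "f ^ k"] pow[OF f(2), of P' k] pow[OF g(2), of P' e] f g insert.prems that
      by (auto simp: add.commute)
    ultimately show ?thesis using f g by (intro exI[of _ ?h] exI[of _ "k * e"]) auto
  qed
qed

lemma regular_element_exists:
  assumes N: "graded_submod N" "no_socle N"
  shows "\<exists>t e. e > 0 \<and> homog t e \<and> (\<forall>y\<in>M. t \<bullet> y \<in> N \<longrightarrow> y \<in> N)"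
proof -
  have sub: "submod N" using N by (simp add: graded_submod_def)
  obtain t e where t: "e > 0" "homog t e" "\<And>P. max_ann N P \<Longrightarrow> t \<notin> P"
    using max_ann_avoid[OF N finite_max_ann[OF N]] by auto
  have "y \<in> N" if y: "y \<in> M" "t \<bullet> y \<in> N" for y
  proof (rule in_graded_submodI[OF sub y(1)])
    fix p
    have "prM (e + p) (t \<bullet> y) = t \<bullet> prM p y"
      using prM_scale[of t y e p] y t by (auto simp: homogD)
    then have "t \<in> ann N (prM p y)"
      using N y t by (auto simp: ann_def homogD graded_submod_def) metis
    then show "prM p y \<in> N"
      using max_ann_exists[OF sub homM_prM[OF y(1)], of p] t by blast
  qed
  then show ?thesis using t by blast
qed

end

subsection \<open>Dividing by a regular element\<close>

context graded_module_over
begin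

text \<open>
  The submodule \<open>N + t M\<close>, so that \<open>M/(N + t M)\<close> is the quotient of \<open>M/N\<close> by \<open>t\<close>.
\<close>

definition extend :: "'m set \<Rightarrow> 'r \<Rightarrow> 'm set" where
  "extend N t = {x + t \<bullet> w |x w. x \<in> N \<and> w \<in> M}"

lemma extend_superset: "N \<subseteq> extend N t"
proof
  fix x assume "x \<in> N"
  then have "x = x + t \<bullet> 0 \<and> x \<in> N \<and> 0 \<in> M" by (simp add: scale_zero_right zeroM)
  then show "x \<in> extend N t" unfolding extend_def by blast
qed

lemma scale_in_extend:
  assumes "submod N" "w \<in> M"
  shows "t \<bullet> w \<in> extend N t"
proof -
  have "t \<bullet> w = 0 + t \<bullet> w \<and> 0 \<in> N \<and> w \<in> M" using assms submodD(2)[OF assms(1)] by simp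
  then show ?thesis unfolding extend_def by blast
qed

lemma submod_extend:
  assumes N: "submod N" and t: "t \<in> R"
  shows "submod (extend N t)"
  unfolding submodule_of_def
proof (intro conjI ballI)
  show "extend N t \<subseteq> M"
    using t submodD(1)[OF N] by (auto simp: extend_def intro!: addM scaleM)
  show "0 \<in> extend N t" using extend_superset[of N t] submodD(2)[OF N] by blast
next
  fix x y assume "x \<in> extend N t" "y \<in> extend N t"
  then obtain u w u' w' where "x = u + t \<bullet> w" "u \<in> N" "w \<in> M" "y = u' + t \<bullet> w'" "u' \<in> N" "w' \<in> M"
    unfolding extend_def by blast
  then have "x + y = (u + u') + t \<bullet> (w + w')" "u + u' \<in> N" "w + w' \<in> M"
    using submodD(3)[OF N] by (simp_all add: scale_right_distrib addM)
  then show "x + y \<in> extend N t" unfolding extend_def by blast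
next
  fix r x assume r: "r \<in> R" and "x \<in> extend N t"
  then obtain u w where "x = u + t \<bullet> w" "u \<in> N" "w \<in> M" unfolding extend_def by blast
  then have "r \<bullet> x = r \<bullet> u + t \<bullet> (r \<bullet> w)" "r \<bullet> u \<in> N" "r \<bullet> w \<in> M"
    using submodD(4)[OF N] r by (simp_all add: scale_right_distrib scaleM scale_scale mult.commute)
  then show "r \<bullet> x \<in> extend N t" unfolding extend_def by blast
qed

lemma prM_scale_homog:
  assumes "homog t e" "w \<in> M"
  shows "\<exists>w'\<in>M. prM p (t \<bullet> w) = t \<bullet> w' \<and> (p < e \<longrightarrow> w' = 0) \<and> (e \<le> p \<longrightarrow> w' = prM (p - e) w)"
proof (cases "p < e")
  case True
  then show ?thesis
    using prM_scale_less[of t w e p] assms by (auto simp: homog_def zeroM scale_zero_right)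
next
  case False
  then show ?thesis
    using prM_scale[of t w e "p - e"] assms by (auto simp: homog_def prM_closed)
qed

lemma graded_extend:
  assumes N: "graded_submod N" and t: "homog t e"
  shows "graded_submod (extend N t)"
  unfolding graded_submod_def
proof (intro conjI ballI allI)
  have sub: "submod N" using N by (simp add: graded_submod_def)
  show "submod (extend N t)" using submod_extend sub t by (simp add: homogD)
  fix x p assume "x \<in> extend N t"
  then obtain u w where x: "x = u + t \<bullet> w" "u \<in> N" "w \<in> M" unfolding extend_def by blast
  obtain w' where "w' \<in> M" "prM p (t \<bullet> w) = t \<bullet> w'" using prM_scale_homog[OF t x(3)] by blast
  moreover have "prM p x = prM p u + prM p (t \<bullet> w)"
    using x submodD(1)[OF sub] homogD(1)[OF t] by (simp add: prM_add scaleM)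
  moreover have "prM p u \<in> N" using N x by (simp add: graded_submod_def)
  ultimately show "prM p x \<in> extend N t" unfolding extend_def by auto
qed

text \<open>
  A homogeneous element outside \<open>N\<close> can be divided by \<open>t\<close> modulo \<open>N\<close> only finitely often, since
  each division lowers its degree.  The last quotient \<open>z\<close> is nonzero modulo \<open>N + t M\<close>, and as \<open>t\<close> is
  regular it has the same annihilator modulo \<open>N\<close> as \<open>y\<close>.
\<close>

lemma divide_out:
  assumes N: "graded_submod N" and t: "homog t e" "e > 0" "\<forall>y\<in>M. t \<bullet> y \<in> N \<longrightarrow> y \<in> N"
  shows "homM y q \<Longrightarrow> y \<notin> N \<Longrightarrow>
    \<exists>z q'. homM z q' \<and> z \<notin> extend N t \<and> (\<forall>r\<in>R. r \<bullet> y \<in> N \<longrightarrow> r \<bullet> z \<in> N)"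
proof (induction q arbitrary: y rule: less_induct)
  case (less q)
  have sub: "submod N" using N by (simp add: graded_submod_def)
  show ?case
  proof (cases "y \<in> extend N t")
    case False
    then show ?thesis using less.prems by blast
  next
    case True
    then obtain u w where y: "y = u + t \<bullet> w" "u \<in> N" "w \<in> M" unfolding extend_def by blast
    obtain w' where w': "w' \<in> M" "prM q (t \<bullet> w) = t \<bullet> w'" "q < e \<longrightarrow> w' = 0" "e \<le> q \<longrightarrow> w' = prM (q - e) w"
      using prM_scale_homog[OF t(1) y(3)] by blast
    have "prM q y = prM q u + prM q (t \<bullet> w)"
      using y submodD(1)[OF sub] homogD(1)[OF t(1)] by (simp add: prM_add scaleM)
    then have y': "y = prM q u + t \<bullet> w'"
      using less.prems w' by (simp add: homM_def)
    have u: "prM q u \<in> N" using N y by (simp add: graded_submod_def)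
    have "e \<le> q"
    proof (rule ccontr)
      assume "\<not> e \<le> q"
      then show False using w' y' u less.prems by (simp add: scale_zero_right)
    qed
    then have hw: "homM w' (q - e)" using w' homM_prM y by simp
    have "w' \<notin> N"
      using y' u less.prems submodD(3)[OF sub u, of "t \<bullet> w'"] submodD(4)[OF sub, of t w'] t
      by (auto simp: homogD)
    then obtain z q' where z: "homM z q'" "z \<notin> extend N t" "\<forall>r\<in>R. r \<bullet> w' \<in> N \<longrightarrow> r \<bullet> z \<in> N"
      using less.IH[OF _ hw] t \<open>e \<le> q\<close> by auto
    have "r \<bullet> z \<in> N" if r: "r \<in> R" "r \<bullet> y \<in> N" for r
    proof -
      have "t \<bullet> r \<bullet> w' = r \<bullet> y - r \<bullet> prM q u"
        unfolding y' by (simp add: scale_right_distrib scale_scale mult.commute)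
      also have "\<dots> \<in> N" by (rule submod_diff[OF sub r(2) submodD(4)[OF sub r(1) u]])
      finally show ?thesis using t(3) r w' z scaleM by blast
    qed
    then show ?thesis using z by blast
  qed
qed

end

section \<open>Vanishing of Ext and chains of primes\<close>

text \<open>
  \<open>D\<close> and \<open>eps\<close> are what remains of a free resolution of the residue field \<open>k\<close> in the proof below:
  a complex of finite free modules, and elements \<open>eps j\<close> that represent the images of the basis of
  the first module in \<open>k\<close>.  The last two conditions say that the composition with the first
  differential vanishes in \<open>k\<close> and that \<open>k\<close> is generated by these images.
\<close>

locale free_complex = graded_module_over R pr M scale prM
  for R :: "'r::idom set" and pr and M :: "'m::ab_group_add set"
    and scale (infixr \<open>\<bullet>\<close> 75) and prM +
  fixes b :: "nat \<Rightarrow> nat" and D :: "nat \<Rightarrow> nat \<Rightarrow> nat \<Rightarrow> 'r" and eps :: "nat \<Rightarrow> 'r"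
  assumes D_closed: "j < b i \<Longrightarrow> l < b (Suc i) \<Longrightarrow> D i j l \<in> R"
    and D_D: "j < b i \<Longrightarrow> q < b (Suc (Suc i)) \<Longrightarrow> (\<Sum>l<b (Suc i). D i j l * D (Suc i) l q) = 0"
    and eps_closed: "j < b 0 \<Longrightarrow> eps j \<in> R"
    and eps_D: "l < b (Suc 0) \<Longrightarrow> (\<Sum>j<b 0. D 0 j l * eps j) \<in> irrelevant"
    and eps_surj: "\<exists>r. (\<forall>j<b 0. r j \<in> R) \<and> 1 - (\<Sum>j<b 0. r j * eps j) \<in> irrelevant"
begin

definition delta :: "nat \<Rightarrow> (nat \<Rightarrow> 'm) \<Rightarrow> nat \<Rightarrow> 'm" where
  "delta i v l = (\<Sum>j<b i. D i j l \<bullet> v j)"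

text \<open>
  A cochain with values in \<open>M/N\<close> is handled through a lift \<open>v\<close> to \<open>M\<close>; \<open>boundary\<close> says that it is
  a coboundary modulo \<open>N\<close>, and \<open>ext_zero\<close> that \<open>Ext\<^sup>i(k, M/N)\<close> vanishes.
\<close>

definition boundary :: "nat \<Rightarrow> 'm set \<Rightarrow> (nat \<Rightarrow> 'm) \<Rightarrow> bool" where
  "boundary i N v \<longleftrightarrow>
     (case i of 0 \<Rightarrow> \<forall>j<b 0. v j \<in> N
      | Suc k \<Rightarrow> \<exists>w. (\<forall>j<b k. w j \<in> M) \<and> (\<forall>j<b i. v j - delta k w j \<in> N))"

lemma boundary_0: "boundary 0 N v \<longleftrightarrow> (\<forall>j<b 0. v j \<in> N)"
  by (simp add: boundary_def)

lemma boundary_Suc: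
  "boundary (Suc k) N v \<longleftrightarrow> (\<exists>w. (\<forall>j<b k. w j \<in> M) \<and> (\<forall>j<b (Suc k). v j - delta k w j \<in> N))"
  by (simp add: boundary_def)

definition ext_zero :: "nat \<Rightarrow> 'm set \<Rightarrow> bool" where
  "ext_zero i N \<longleftrightarrow>
     (\<forall>v. (\<forall>j<b i. v j \<in> M) \<longrightarrow> (\<forall>l<b (Suc i). delta i v l \<in> N) \<longrightarrow> boundary i N v)"

lemma ext_zeroD:
  "ext_zero i N \<Longrightarrow> \<forall>j<b i. v j \<in> M \<Longrightarrow> \<forall>l<b (Suc i). delta i v l \<in> N \<Longrightarrow> boundary i N v"
  unfolding ext_zero_def by (erule allE, erule mp[OF mp])

lemma delta_closed: "(\<And>j. j < b i \<Longrightarrow> v j \<in> M) \<Longrightarrow> l < b (Suc i) \<Longrightarrow> delta i v l \<in> M"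
  unfolding delta_def by (intro sumM scaleM D_closed) auto

lemma delta_submod: "submod N \<Longrightarrow> (\<And>j. j < b i \<Longrightarrow> v j \<in> N) \<Longrightarrow> l < b (Suc i) \<Longrightarrow> delta i v l \<in> N"
  unfolding delta_def by (intro submod_sum submodD(4) D_closed) auto

lemma delta_diff: "delta i (\<lambda>j. v j - w j) l = delta i v l - delta i w l"
  by (simp add: delta_def scale_diff_right sum_subtractf)

lemma delta_scale: "delta i (\<lambda>j. r \<bullet> v j) l = r \<bullet> delta i v l"
  by (simp add: delta_def scale_sum_right scale_scale mult.commute)

lemma delta_delta:
  assumes "q < b (Suc (Suc i))"
  shows "delta (Suc i) (delta i v) q = 0"
proof -
  have "delta (Suc i) (delta i v) q = (\<Sum>l<b (Suc i). \<Sum>j<b i. (D i j l * D (Suc i) l q) \<bullet> v j)"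
    by (simp add: delta_def scale_sum_right scale_scale mult.commute)
  also have "\<dots> = (\<Sum>j<b i. (\<Sum>l<b (Suc i). D i j l * D (Suc i) l q) \<bullet> v j)"
    by (subst sum.swap) (simp add: scale_sum_left)
  also have "\<dots> = 0"
    using D_D assms by (simp add: scale_zero_left)
  finally show ?thesis .
qed

text \<open>
  A socle element \<open>y\<close> is the same as a homomorphism from \<open>k\<close> to \<open>M/N\<close>; composed with the
  augmentation it is the cocycle with entries \<open>eps j \<bullet> y\<close>.
\<close>

lemma ext_zero_0_imp_no_socle:
  assumes N: "submod N" and E: "ext_zero 0 N"
  shows "no_socle N"
  unfolding no_socle_def
proof (intro ballI impI)
  fix y assume y: "y \<in> M" and soc: "\<forall>f\<in>irrelevant. f \<bullet> y \<in> N"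
  have "delta 0 (\<lambda>j. eps j \<bullet> y) l \<in> N" if "l < b (Suc 0)" for l
  proof -
    have "delta 0 (\<lambda>j. eps j \<bullet> y) l = (\<Sum>j<b 0. D 0 j l * eps j) \<bullet> y"
      by (simp add: delta_def scale_scale scale_sum_left)
    then show ?thesis using soc eps_D that by simp
  qed
  moreover have "\<forall>j<b 0. eps j \<bullet> y \<in> M" using scaleM eps_closed y by blast
  ultimately have *: "eps j \<bullet> y \<in> N" if "j < b 0" for j
    using ext_zeroD[OF E, of "\<lambda>j. eps j \<bullet> y"] that by (simp add: boundary_0)
  obtain r where r: "\<And>j. j < b 0 \<Longrightarrow> r j \<in> R" "1 - (\<Sum>j<b 0. r j * eps j) \<in> irrelevant"
    using eps_surj by blast
  have "(\<Sum>j<b 0. r j * eps j) \<bullet> y = (\<Sum>j<b 0. r j \<bullet> eps j \<bullet> y)"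
    by (simp add: scale_sum_left scale_scale)
  also have "\<dots> \<in> N"
    by (rule submod_sum[OF N]) (use submodD(4)[OF N] r * in auto)
  finally have "(\<Sum>j<b 0. r j * eps j) \<bullet> y \<in> N" .
  moreover have "(1 - (\<Sum>j<b 0. r j * eps j)) \<bullet> y \<in> N" using soc r by blast
  ultimately have "(1 - (\<Sum>j<b 0. r j * eps j)) \<bullet> y + (\<Sum>j<b 0. r j * eps j) \<bullet> y \<in> N"
    using submodD(3)[OF N] by blast
  then show "y \<in> N" by (simp add: scale_left_distrib[symmetric] scale_one)
qed

text \<open>
  This is the part of the long exact sequence of \<open>0 \<rightarrow> M/N \<rightarrow> M/N \<rightarrow> M/(N + t M) \<rightarrow> 0\<close> between
  \<open>Ext\<^sup>i(k, M/N)\<close> and \<open>Ext\<^sup>i\<^sup>+\<^sup>1(k, M/N)\<close>, with the connecting homomorphism \<open>v \<mapsto> z\<close> spelled out.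
\<close>

lemma ext_zero_extend:
  assumes N: "submod N" and t: "t \<in> R" "\<forall>y\<in>M. t \<bullet> y \<in> N \<longrightarrow> y \<in> N"
    and E: "ext_zero i N" "ext_zero (Suc i) N"
  shows "ext_zero i (extend N t)"
proof -
  have "boundary i (extend N t) v"
    if v: "\<forall>j<b i. v j \<in> M" "\<forall>l<b (Suc i). delta i v l \<in> extend N t" for v
  proof -
    have "\<forall>l<b (Suc i). \<exists>z. z \<in> M \<and> delta i v l - t \<bullet> z \<in> N"
      using v(2) unfolding extend_def by fastforce
    then obtain z where z: "\<And>l. l < b (Suc i) \<Longrightarrow> z l \<in> M" "\<And>l. l < b (Suc i) \<Longrightarrow> delta i v l - t \<bullet> z l \<in> N"
      by metis
    have "delta (Suc i) z q \<in> N" if q: "q < b (Suc (Suc i))" for q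
    proof -
      have "delta (Suc i) (\<lambda>l. delta i v l - t \<bullet> z l) q \<in> N"
        using z q by (intro delta_submod[OF N]) auto
      then have "- (t \<bullet> delta (Suc i) z q) \<in> N"
        using delta_delta[OF q, of v] by (simp add: delta_diff delta_scale)
      then have "t \<bullet> delta (Suc i) z q \<in> N" using submod_uminus[OF N] by fastforce
      moreover have "delta (Suc i) z q \<in> M" using z q by (intro delta_closed) auto
      ultimately show ?thesis using t by blast
    qed
    then have "boundary (Suc i) N z"
      by (intro ext_zeroD[OF E(2)]) (auto simp: z)
    then obtain w where w: "\<And>j. j < b i \<Longrightarrow> w j \<in> M" "\<And>j. j < b (Suc i) \<Longrightarrow> z j - delta i w j \<in> N"
      unfolding boundary_Suc by blast
    define v' where "v' = (\<lambda>j. v j - t \<bullet> w j)"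
    have "delta i v' l \<in> N" if l: "l < b (Suc i)" for l
    proof -
      have "delta i v' l = (delta i v l - t \<bullet> z l) + t \<bullet> (z l - delta i w l)"
        by (simp add: v'_def delta_diff delta_scale scale_diff_right)
      then show ?thesis
        using submodD(3)[OF N z(2)[OF l] submodD(4)[OF N t(1) w(2)[OF l]]] by simp
    qed
    moreover have "v' j \<in> M" if "j < b i" for j
      using v(1) w(1)[OF that] t(1) that by (simp add: v'_def diffM scaleM)
    ultimately have *: "boundary i N v'"
      by (intro ext_zeroD[OF E(1)]) auto
    have ext: "x - t \<bullet> w j \<in> N \<Longrightarrow> x \<in> extend N t" if "j < b i" for x j
      using w(1)[OF that] unfolding extend_def by (metis (mono_tags, lifting) diff_add_cancel mem_Collect_eq)
    show ?thesis
    proof (cases i)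
      case 0
      then show ?thesis using * ext by (auto simp: v'_def boundary_0)
    next
      case (Suc k)
      then obtain w' where w': "\<forall>j<b k. w' j \<in> M" "\<And>j. j < b i \<Longrightarrow> v' j - delta k w' j \<in> N" using * by (auto simp: boundary_Suc)
      have "v j - delta k w' j \<in> extend N t" if j: "j < b i" for j
      proof (rule ext[OF j])
        have "v j - delta k w' j - t \<bullet> w j = v' j - delta k w' j" by (simp add: v'_def algebra_simps)
        then show "v j - delta k w' j - t \<bullet> w j \<in> N" using w'(2)[OF j] by (simp only:)
      qed
      then show ?thesis using Suc w' by (auto simp: boundary_Suc)
    qed
  qed
  then show ?thesis unfolding ext_zero_def by blast
qed

text \<open>
  By induction on \<open>n\<close>.  Choose a homogeneous element \<open>t\<close> that is regular on \<open>M/N\<close>, divide \<open>y\<close> by it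
  as often as possible, and apply the induction hypothesis to the quotient \<open>z\<close> in \<open>M/(N + t M)\<close>.  The
  smallest prime of the resulting chain contains \<open>t\<close> and the annihilator of \<open>z\<close> modulo \<open>N\<close>.  Since
  \<open>t\<close> is not a zero divisor modulo that annihilator, there is a strictly smaller prime that still
  contains the annihilator but not \<open>t\<close>.
\<close>

theorem prime_chain_of_ext_zero:
  assumes "\<And>i. i < n \<Longrightarrow> ext_zero i N" "graded_submod N" "homM y q" "y \<notin> N"
  shows "\<exists>p. (\<forall>i\<le>n. prime_of R (p i)) \<and> (\<forall>i<n. p i \<subset> p (Suc i)) \<and> p n = irrelevant \<and> ann N y \<subseteq> p 0"
  using assms
proof (induction n arbitrary: N y q)
  case 0
  have sub: "submod N" using 0 by (simp add: graded_submod_def)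
  have "pr 0 r = 0" if r: "r \<in> ann N y" for r
  proof (rule ccontr)
    assume nz: "pr 0 r \<noteq> 0"
    have rR: "r \<in> R" using r by (simp add: ann_def)
    have "pr 0 r \<in> ann N y" using pr_ann 0 r by blast
    then have "pr 0 r \<bullet> y \<in> N" by (simp add: ann_def)
    moreover obtain s where s: "s \<in> R" "pr 0 r * s = 1"
      using degree_0_unit[of "pr 0 r"] nz rR by (auto simp: pr_closed pr_pr)
    ultimately have "s \<bullet> pr 0 r \<bullet> y \<in> N" using submodD(4)[OF sub] by blast
    then show False using s 0 by (simp add: scale_scale mult.commute scale_one)
  qed
  then have "ann N y \<subseteq> irrelevant" by (auto simp: irrelevant_def ann_def)
  then show ?case using prime_of_irrelevant by (intro exI[of _ "\<lambda>_. irrelevant"]) auto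
next
  case (Suc n)
  have sub: "submod N" using Suc by (simp add: graded_submod_def)
  have "no_socle N" using ext_zero_0_imp_no_socle[OF sub] Suc.prems by blast
  then obtain t e where t: "e > 0" "homog t e" "\<forall>y\<in>M. t \<bullet> y \<in> N \<longrightarrow> y \<in> N"
    using regular_element_exists Suc.prems by blast
  have tR: "t \<in> R" using t by (simp add: homogD)
  obtain z q' where z: "homM z q'" "z \<notin> extend N t" "\<forall>r\<in>R. r \<bullet> y \<in> N \<longrightarrow> r \<bullet> z \<in> N"
    using divide_out[OF Suc.prems(2) t(2,1,3) Suc.prems(3,4)] by blast
  have zM: "z \<in> M" using z by (simp add: homM_def)
  have E: "\<And>i. i < n \<Longrightarrow> ext_zero i (extend N t)"
    using ext_zero_extend[OF sub tR t(3)] Suc.prems(1) by simp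
  obtain p where p: "\<And>i. i \<le> n \<Longrightarrow> prime_of R (p i)" "\<And>i. i < n \<Longrightarrow> p i \<subset> p (Suc i)"
      "p n = irrelevant" "ann (extend N t) z \<subseteq> p 0"
    using Suc.IH[OF E graded_extend[OF Suc.prems(2) t(2)] z(1,2)] by auto
  have regular: "s \<in> R \<Longrightarrow> s * t ^ c \<in> ann N z \<Longrightarrow> s \<in> ann N z" for s c
  proof (induction c)
    case (Suc c)
    have "t \<bullet> (s * t ^ c) \<bullet> z = (s * t ^ Suc c) \<bullet> z" by (simp add: scale_scale mult_ac)
    then have "t \<bullet> (s * t ^ c) \<bullet> z \<in> N" using Suc.prems by (simp add: ann_def)
    moreover have "s * t ^ c \<in> R" using Suc.prems tR by (simp add: mult power)
    ultimately have "s * t ^ c \<in> ann N z" using t zM scaleM by (simp add: ann_def)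
    then show ?case using Suc by blast
  qed simp
  have sub_ann: "ann N z \<subseteq> p 0" using p(4) extend_superset[of N t] by (auto simp: ann_def)
  have "\<exists>Q. prime_of R Q \<and> ann N z \<subseteq> Q \<and> Q \<subseteq> p 0 \<and> t \<notin> Q"
    using regular sub_ann by (intro exists_prime_avoiding[OF ideal_ann[OF sub] p(1) tR]) auto
  then obtain Q where Q: "prime_of R Q" "ann N z \<subseteq> Q" "Q \<subseteq> p 0" "t \<notin> Q" by blast
  have "t \<in> p 0" using p(4) scale_in_extend[OF sub zM] tR by (auto simp: ann_def)
  then have strict: "Q \<subset> p 0" using Q by blast
  have "ann N y \<subseteq> Q" using z Q by (auto simp: ann_def)
  then show ?case
    using p Q strict
    by (intro exI[of _ "\<lambda>i. case i of 0 \<Rightarrow> Q | Suc k \<Rightarrow> p k"]) (auto split: nat.split)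
qed

text \<open>
  If all Ext vanish on a nonzero module, they also vanish on its quotient by a regular element,
  which is again nonzero.  A maximal \<open>N\<close> of this kind cannot be enlarged.
\<close>

lemma ext_zero_all_imp_trivial:
  assumes "graded_submod N" "\<And>i. ext_zero i N"
  shows "N = M"
proof (rule ccontr)
  assume nM: "N \<noteq> M"
  define F where "F = {N. graded_submod N \<and> N \<noteq> M \<and> (\<forall>i. ext_zero i N)}"
  have "F \<noteq> {}" using assms nM by (auto simp: F_def)
  moreover have "\<And>N. N \<in> F \<Longrightarrow> submod N" by (auto simp: F_def graded_submod_def)
  ultimately obtain U where U: "U \<in> F" and max: "\<And>V. V \<in> F \<Longrightarrow> U \<subseteq> V \<Longrightarrow> V = U"
    using noetherianM[of F] by blast
  have gU: "graded_submod U" "submod U" "U \<noteq> M" "\<And>i. ext_zero i U"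
    using U by (auto simp: F_def graded_submod_def)
  obtain y q where y: "homM y q" "y \<notin> U" using proper_graded_submod gU by blast
  have "no_socle U" using ext_zero_0_imp_no_socle gU by blast
  then obtain t e where t: "e > 0" "homog t e" "\<forall>y\<in>M. t \<bullet> y \<in> U \<longrightarrow> y \<in> U"
    using regular_element_exists gU by blast
  have tR: "t \<in> R" using t by (simp add: homogD)
  obtain z q' where z: "homM z q'" "z \<notin> extend U t"
    using divide_out[OF gU(1) t(2,1,3) y] by blast
  have zM: "z \<in> M" using z by (simp add: homM_def)
  have "extend U t \<noteq> M" using zM z by blast
  then have "extend U t \<in> F"
    using ext_zero_extend[OF gU(2) tR t(3)] gU graded_extend[OF gU(1) t(2)] by (simp add: F_def)
  then have "extend U t = U" using max extend_superset by blast
  then have "t \<bullet> z \<in> U" using scale_in_extend[OF gU(2) zM, of t] by simp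
  then show False using t zM z extend_superset[of U t] by blast
qed

end

context free_complex
begin

text \<open>
  A torsion element has a nonzero annihilator, so the zero ideal can be put below the chain of
  primes over it.
\<close>

lemma torsion_free_of_ext_zero:
  assumes E: "\<And>i. i < d \<Longrightarrow> ext_zero i N" and N: "graded_submod N"
    and height: "\<And>p. \<forall>i\<le>Suc d. prime_of R (p i) \<Longrightarrow> \<forall>i<Suc d. p i \<subset> p (Suc i) \<Longrightarrow> p (Suc d) \<noteq> irrelevant"
    and y: "homM y q" and r: "r \<in> R" "r \<noteq> 0" "r \<bullet> y \<in> N"
  shows "y \<in> N"
proof (rule ccontr)
  assume nN: "y \<notin> N"
  obtain p where p: "\<forall>i\<le>d. prime_of R (p i)" "\<forall>i<d. p i \<subset> p (Suc i)" "p d = irrelevant"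
      "ann N y \<subseteq> p 0"
    using prime_chain_of_ext_zero[of d N y q] E N y nN by metis
  have "r \<in> p 0" using p r by (auto simp: ann_def)
  moreover have "0 \<in> p 0" using p by (auto simp: prime_of_def ideal_of_def)
  ultimately have strict: "{0} \<subset> p 0" using r by blast
  define q' where "q' = (\<lambda>i. case i of 0 \<Rightarrow> {0} | Suc k \<Rightarrow> p k)"
  have "\<forall>i\<le>Suc d. prime_of R (q' i)" using p prime_of_0 by (auto simp: q'_def split: nat.split)
  moreover have "\<forall>i<Suc d. q' i \<subset> q' (Suc i)" using p strict by (auto simp: q'_def split: nat.split)
  ultimately show False using height[of q'] p by (simp add: q'_def)
qed

lemma not_ext_zero_height:
  assumes E: "\<And>i. i \<le> d \<Longrightarrow> ext_zero i N" and N: "graded_submod N" "N \<noteq> M"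
    and height: "\<And>p. \<forall>i\<le>Suc d. prime_of R (p i) \<Longrightarrow> \<forall>i<Suc d. p i \<subset> p (Suc i) \<Longrightarrow> p (Suc d) \<noteq> irrelevant"
  shows False
proof -
  obtain y q where y: "homM y q" "y \<notin> N" using proper_graded_submod[OF N] by auto
  have "\<And>i. i < Suc d \<Longrightarrow> ext_zero i N" using E by simp
  then obtain p where "\<forall>i\<le>Suc d. prime_of R (p i)" "\<forall>i<Suc d. p i \<subset> p (Suc i)" "p (Suc d) = irrelevant"
    using prime_chain_of_ext_zero[OF _ N(1) y] by metis
  then show False using height by simp
qed

end

section \<open>Submodules of the free module of rank two\<close>

context graded_domain
begin

lemma pr_vanish:
  assumes "a \<in> R" "a = (\<Sum>p<n. pr p a)" "n \<le> p"
  shows "pr p a = 0"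
proof -
  have "pr p a = (\<Sum>q<n. pr p (pr q a))"
    using assms pr_of_sum[of "{..<n}" "\<lambda>q. pr q a" p] pr_closed by auto
  also have "\<dots> = 0" using assms by (intro sum.neutral) (auto simp: pr_pr)
  finally show ?thesis .
qed

lemma pr_sum_larger:
  assumes "a \<in> R" "a = (\<Sum>p<n. pr p a)" "n \<le> m"
  shows "a = (\<Sum>p<m. pr p a)"
proof -
  have "(\<Sum>p<n. pr p a) = (\<Sum>p<m. pr p a)"
    by (rule sum.mono_neutral_left) (use assms pr_vanish[OF assms(1,2)] in auto)
  then show ?thesis using assms by simp
qed

lemma pr_1_mult:
  assumes "a \<in> R" "g \<in> R" "pr 0 g = 0"
  shows "pr 1 (a * g) = pr 0 a * pr 1 g"
proof -
  obtain n where n: "a = (\<Sum>p<n. pr p a)" using pr_sum assms by blast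
  have n1: "a = (\<Sum>p<Suc n. pr p a)" using pr_sum_larger[OF assms(1) n, of "Suc n"] by simp
  have *: "pr 1 (pr p a * g) = (if p = 0 then pr 0 a * pr 1 g else 0)" for p
  proof -
    consider "p = 0" | "p = 1" | "p > 1" by linarith
    then show ?thesis
      using pr_mult[of "pr p a" g p 1] pr_mult[of "pr p a" g p 0] pr_mult_less[of "pr p a" g p 1] assms
      by cases (auto simp: pr_closed pr_pr)
  qed
  have "a * g = (\<Sum>p<Suc n. pr p a * g)"
    using n1 by (metis sum_distrib_right)
  then have "pr 1 (a * g) = (\<Sum>p<Suc n. pr 1 (pr p a * g))"
    using pr_of_sum[of "{..<Suc n}" "\<lambda>p. pr p a * g" 1] assms(1,2) pr_closed mult by auto
  also have "\<dots> = (\<Sum>p<Suc n. if p = 0 then pr 0 a * pr 1 g else 0)" by (simp only: *)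
  also have "\<dots> = pr 0 a * pr 1 g" by (simp del: sum.lessThan_Suc)
  finally show ?thesis .
qed

definition pair_scale :: "'r \<Rightarrow> 'r \<times> 'r \<Rightarrow> 'r \<times> 'r" where
  "pair_scale r x = (r * fst x, r * snd x)"

text \<open>
  The grading of \<open>R\<^sup>2\<close> in which the basis elements have the degrees \<open>0\<close> and \<open>\<delta>\<close>.
\<close>

definition pair_pr :: "nat \<Rightarrow> nat \<Rightarrow> 'r \<times> 'r \<Rightarrow> 'r \<times> 'r" where
  "pair_pr \<delta> p x = (pr p (fst x), if p < \<delta> then 0 else pr (p - \<delta>) (snd x))"

text \<open>
  A submodule \<open>N\<close> is determined, among those that contain or are contained in it, by the ideal \<open>A N\<close> of
  first coordinates and the ideal \<open>B N\<close> of second coordinates of its elements \<open>(0, b)\<close>.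
\<close>

lemma noetherian_pairs:
  assumes "F \<noteq> {}" and sub: "\<And>N. N \<in> F \<Longrightarrow> submodule_of R pair_scale (R \<times> R) N"
  shows "\<exists>N\<in>F. \<forall>N'\<in>F. N \<subseteq> N' \<longrightarrow> N' = N"
proof -
  have subD: "N \<subseteq> R \<times> R" "(0, 0) \<in> N" "x \<in> N \<Longrightarrow> y \<in> N \<Longrightarrow> x + y \<in> N"
    "r \<in> R \<Longrightarrow> x \<in> N \<Longrightarrow> pair_scale r x \<in> N" if "N \<in> F" for N x y r
    using sub[OF that] by (auto simp: submodule_of_def zero_prod_def)
  define A where "A N = {a. \<exists>b. (a, b) \<in> N}" for N :: "('r \<times> 'r) set"
  define B where "B N = {b. (0, b) \<in> N}" for N :: "('r \<times> 'r) set"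
  have idA: "ideal_of R (A N)" if N: "N \<in> F" for N
    unfolding ideal_of_def
  proof (intro conjI ballI)
    show "A N \<subseteq> R" "0 \<in> A N" using subD(1,2)[OF N] by (auto simp: A_def)
    show "a + a' \<in> A N" if "a \<in> A N" "a' \<in> A N" for a a'
      using subD(3)[OF N] that by (force simp: A_def)
    show "r * a \<in> A N" if "r \<in> R" "a \<in> A N" for r a
      using subD(4)[OF N] that by (force simp: A_def pair_scale_def)
  qed
  have idB: "ideal_of R (B N)" if N: "N \<in> F" for N
    unfolding ideal_of_def
  proof (intro conjI ballI)
    show "B N \<subseteq> R" "0 \<in> B N" using subD(1,2)[OF N] by (auto simp: B_def)
    show "a + a' \<in> B N" if "a \<in> B N" "a' \<in> B N" for a a'
      using subD(3)[OF N] that by (force simp: B_def)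
    show "r * a \<in> B N" if "r \<in> R" "a \<in> B N" for r a
      using subD(4)[OF N] that by (force simp: B_def pair_scale_def)
  qed
  have "A ` F \<noteq> {}" using assms by blast
  then obtain I where I: "I \<in> A ` F" "\<forall>J\<in>A ` F. I \<subseteq> J \<longrightarrow> J = I"
    using noetherian[of "A ` F"] idA by blast
  define F' where "F' = {N \<in> F. A N = I}"
  have "B ` F' \<noteq> {}" using I by (auto simp: F'_def)
  then obtain J where J: "J \<in> B ` F'" "\<forall>L\<in>B ` F'. J \<subseteq> L \<longrightarrow> L = J"
    using noetherian[of "B ` F'"] idB unfolding F'_def by blast
  then obtain N where N: "N \<in> F" "A N = I" "B N = J" by (auto simp: F'_def)
  have "N' = N" if N': "N' \<in> F" "N \<subseteq> N'" for N'
  proof -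
    have "A N \<subseteq> A N'" "B N \<subseteq> B N'" using N' by (auto simp: A_def B_def)
    then have AN: "A N' = I" using I N N' by blast
    then have BN: "B N' = J" using J N N' \<open>B N \<subseteq> B N'\<close> by (auto simp: F'_def)
    have "x \<in> N" if x: "x \<in> N'" for x
    proof -
      obtain a b where ab: "x = (a, b)" by (cases x)
      then have "a \<in> A N" using x AN N by (auto simp: A_def)
      then obtain b' where b': "(a, b') \<in> N" by (auto simp: A_def)
      have "pair_scale (- 1) (a, b') \<in> N'" using subD(4)[OF N'(1)] uminus[OF one] b' N' by blast
      then have "x + pair_scale (- 1) (a, b') \<in> N'" using subD(3)[OF N'(1)] x by blast
      then have "b - b' \<in> B N'" using ab by (simp add: pair_scale_def B_def)
      then have "b - b' \<in> B N" using BN N by simp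
      then have "(0, b - b') \<in> N" by (simp add: B_def)
      then have "(0, b - b') + (a, b') \<in> N" by (rule subD(3)[OF N(1) _ b'])
      then show ?thesis using ab by simp
    qed
    then show ?thesis using N' by blast
  qed
  then show ?thesis using N by blast
qed

lemma pairs: "graded_module_over R pr (R \<times> R) pair_scale (pair_pr \<delta>)"
proof
  show "\<exists>n. x = (\<Sum>p<n. pair_pr \<delta> p x)" if "x \<in> R \<times> R" for x
  proof -
    have x: "fst x \<in> R" "snd x \<in> R" using that by auto
    obtain n m where n: "fst x = (\<Sum>p<n. pr p (fst x))" and m: "snd x = (\<Sum>p<m. pr p (snd x))"
      using pr_sum x by blast
    define k where "k = n + m"
    have 1: "fst x = (\<Sum>p<k + \<delta>. pr p (fst x))"
      by (rule pr_sum_larger[OF x(1) n]) (simp add: k_def)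
    have 2: "snd x = (\<Sum>p<k. pr p (snd x))"
      by (rule pr_sum_larger[OF x(2) m]) (simp add: k_def)
    have "(\<Sum>p<k + \<delta>. if p < \<delta> then 0 else pr (p - \<delta>) (snd x)) = (\<Sum>p\<in>{\<delta>..<k + \<delta>}. pr (p - \<delta>) (snd x))"
      by (rule sum.mono_neutral_cong_right) auto
    also have "\<dots> = (\<Sum>p<k. pr p (snd x))"
      using sum.shift_bounds_nat_ivl[of "\<lambda>p. pr (p - \<delta>) (snd x)" 0 \<delta> k] by (simp add: atLeast0LessThan)
    finally have 3: "snd x = (\<Sum>p<k + \<delta>. if p < \<delta> then 0 else pr (p - \<delta>) (snd x))"
      using 2 by simp
    have "x = (\<Sum>p<k + \<delta>. pair_pr \<delta> p x)"
      using 1 3 by (intro prod_eqI) (simp_all add: fst_sum snd_sum pair_pr_def)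
    then show ?thesis by blast
  qed
  show "\<exists>N\<in>F. \<forall>N'\<in>F. N \<subseteq> N' \<longrightarrow> N' = N"
    if "F \<noteq> {}" "\<And>N. N \<in> F \<Longrightarrow> submodule_of R pair_scale (R \<times> R) N" for F
    using noetherian_pairs that by blast
  show "pair_pr \<delta> (p + q) (pair_scale r x) = pair_scale r (pair_pr \<delta> q x)"
    if "r \<in> R" "x \<in> R \<times> R" "pr p r = r" for r x p q
  proof -
    have x: "fst x \<in> R" "snd x \<in> R" using that by auto
    have "pr (p + q - \<delta>) (r * snd x) = (if q < \<delta> then 0 else r * pr (q - \<delta>) (snd x))" if "\<not> p + q < \<delta>"
      using pr_mult[OF \<open>r \<in> R\<close> x(2) \<open>pr p r = r\<close>, of "q - \<delta>"]
        pr_mult_less[OF \<open>r \<in> R\<close> x(2) \<open>pr p r = r\<close>, of "p + q - \<delta>"] that by auto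
    then show ?thesis
      using pr_mult[OF \<open>r \<in> R\<close> x(1) \<open>pr p r = r\<close>] by (auto simp: pair_pr_def pair_scale_def)
  qed
  show "pair_pr \<delta> q (pair_scale r x) = 0"
    if "r \<in> R" "x \<in> R \<times> R" "pr p r = r" "q < p" for r x p q
    using that pr_mult_less[of r _ p] by (auto simp: pair_pr_def pair_scale_def zero_prod_def)
qed (auto simp: pair_scale_def pair_pr_def zero add mult algebra_simps pr_add pr_closed pr_pr zero_prod_def pr_zero
      split: if_splits)

text \<open>
  \<open>R\<^sup>2/K\<close> stands for the canonical module, with \<open>(1, 0)\<close> and \<open>(0, 1)\<close> for its generators.  The
  hypothesis \<open>trace\<close> says that \<open>m\<close> lies in the trace, a homomorphism to \<open>R\<close> being a pair \<open>(f, g)\<close> that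
  annihilates \<open>K\<close>.  A nonzero homogeneous element \<open>(r, - s)\<close> of \<open>K\<close> is the relation \<open>r y1 = s y2\<close>.  The
  values of all these homomorphisms lie in the ideal \<open>J\<close> of the elements without constant term whose
  component of degree \<open>1\<close> is multiplied by \<open>r\<close> into \<open>s R\<close>.
\<close>

lemma two_generators_contradiction:
  assumes \<delta>: "\<delta> > 0"
    and K: "graded_module_over.graded_submod R (R \<times> R) pair_scale (pair_pr \<delta>) K"
    and torsion_free: "\<And>y q r. graded_module_over.homM (R \<times> R) (pair_pr \<delta>) y q \<Longrightarrow>
           r \<in> R \<Longrightarrow> r \<noteq> 0 \<Longrightarrow> pair_scale r y \<in> K \<Longrightarrow> y \<in> K"
    and nz: "K \<noteq> {0}"
    and y1: "(1, 0) \<notin> K" and y2: "\<And>c. c \<in> R \<Longrightarrow> (c, - 1) \<notin> K"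
    and trace: "\<And>J. ideal_of R J \<Longrightarrow>
           (\<And>f g. f \<in> R \<Longrightarrow> g \<in> R \<Longrightarrow> (\<And>a b. (a, b) \<in> K \<Longrightarrow> a * f + b * g = 0) \<Longrightarrow> f \<in> J \<and> g \<in> J) \<Longrightarrow>
           irrelevant \<subseteq> J"
    and depth: "\<And>r s e. homog r (e + \<delta>) \<Longrightarrow> homog s e \<Longrightarrow> s \<noteq> 0 \<Longrightarrow>
           (\<And>f. homog f 1 \<Longrightarrow> \<exists>g\<in>R. r * f = s * g) \<Longrightarrow> \<exists>c\<in>R. r = s * c"
  shows False
proof -
  interpret P: graded_module_over R pr "R \<times> R" pair_scale "pair_pr \<delta>" by (rule pairs)
  have subK: "P.submod K" using K by (simp add: P.graded_submod_def)
  obtain x where x: "x \<in> K" "x \<noteq> 0" using nz P.submodD(2)[OF subK] by blast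
  then have xM: "x \<in> R \<times> R" using P.submodD(1)[OF subK] by blast
  obtain n where n: "x = (\<Sum>p<n. pair_pr \<delta> p x)" using P.prM_sum[OF xM] by blast
  have "\<exists>p. pair_pr \<delta> p x \<noteq> 0"
  proof (rule ccontr)
    assume "\<not> ?thesis"
    then have "(\<Sum>p<n. pair_pr \<delta> p x) = 0" by (intro sum.neutral) auto
    then show False using n x by simp
  qed
  then obtain p where p: "pair_pr \<delta> p x \<noteq> 0" by blast
  have pK: "pair_pr \<delta> p x \<in> K" using K x by (simp add: P.graded_submod_def)
  have h1: "P.homM (1, 0) 0"
    unfolding P.homM_def by (simp add: pair_pr_def one zero pr_one pr_zero)
  define r where "r = pr p (fst x)"
  have r: "homog r p" using xM by (auto simp: r_def intro!: homog_pr)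
  have no_r0: "r = 0" if "(r, 0) \<in> K"
  proof (rule ccontr)
    assume "r \<noteq> 0"
    then have "(1, 0) \<in> K" using torsion_free[OF h1, of r] r that by (simp add: pair_scale_def homogD)
    then show False using y1 by blast
  qed
  have "\<delta> \<le> p"
  proof (rule ccontr)
    assume "\<not> \<delta> \<le> p"
    then have "pair_pr \<delta> p x = (r, 0)" by (simp add: pair_pr_def r_def)
    then show False using p pK no_r0 by (simp add: zero_prod_def)
  qed
  define e where "e = p - \<delta>"
  define s where "s = - pr e (snd x)"
  have pe: "p = e + \<delta>" using \<open>\<delta> \<le> p\<close> by (simp add: e_def)
  have rs: "pair_pr \<delta> p x = (r, - s)" using \<open>\<delta> \<le> p\<close> by (simp add: pair_pr_def r_def s_def e_def)
  have s: "homog s e"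
    using xM by (auto simp: s_def homog_def pr_uminus pr_closed pr_pr uminus)
  have re: "homog r (e + \<delta>)" using r pe by simp
  have R: "r \<in> R" "s \<in> R" using r s by (auto simp: homogD)
  have s0: "s \<noteq> 0"
  proof
    assume "s = 0"
    then show False using rs p pK no_r0 by (simp add: zero_prod_def)
  qed
  \<comment> \<open>If \<open>s\<close> divided \<open>r\<close>, cancelling \<open>s\<close> in the relation would make the second generator superfluous.\<close>
  have ndvd: False if c: "c \<in> R" "r = s * c" for c
  proof -
    have "r = pr (e + \<delta>) (s * c)" using re c by (simp add: homogD)
    also have "\<dots> = s * pr \<delta> c" using pr_mult[of s c e \<delta>] s c R by (simp add: homogD)
    finally have r: "r = s * pr \<delta> c" .
    have "P.homM (pr \<delta> c, - 1) \<delta>"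
      using c by (simp add: P.homM_def pair_pr_def pr_closed pr_pr uminus one pr_uminus pr_one)
    moreover have "pair_scale s (pr \<delta> c, - 1) \<in> K"
      using pK rs r by (simp add: pair_scale_def)
    ultimately have "(pr \<delta> c, - 1) \<in> K" using torsion_free R s0 by blast
    then show False using y2 pr_closed c by blast
  qed
  define J where "J = {g \<in> R. pr 0 g = 0 \<and> (\<exists>h\<in>R. r * pr 1 g = s * h)}"
  have JI: "g \<in> R \<Longrightarrow> pr 0 g = 0 \<Longrightarrow> h \<in> R \<Longrightarrow> r * pr 1 g = s * h \<Longrightarrow> g \<in> J" for g h
    unfolding J_def by blast
  have JD: "g \<in> R" "pr 0 g = 0" "\<exists>h\<in>R. r * pr 1 g = s * h" if "g \<in> J" for g
    using that unfolding J_def by blast+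
  have "ideal_of R J"
    unfolding ideal_of_def
  proof (intro conjI ballI)
    show "J \<subseteq> R" by (auto simp: J_def)
    show "0 \<in> J" by (rule JI[OF zero _ zero]) (simp_all add: pr_zero)
    show "g + g' \<in> J" if gg: "g \<in> J" "g' \<in> J" for g g'
    proof -
      obtain h h' where h: "h \<in> R" "r * pr 1 g = s * h" "h' \<in> R" "r * pr 1 g' = s * h'"
        using JD(3)[OF gg(1)] JD(3)[OF gg(2)] by blast
      have "r * pr 1 (g + g') = s * (h + h')"
        by (simp only: pr_add[OF JD(1)[OF gg(1)] JD(1)[OF gg(2)]] distrib_left h)
      then show ?thesis
        using JD[OF gg(1)] JD[OF gg(2)] h by (intro JI[of "g + g'" "h + h'"]) (simp_all add: add pr_add)
    qed
    show "a * g \<in> J" if ag: "a \<in> R" "g \<in> J" for a g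
    proof -
      obtain h where h: "h \<in> R" "r * pr 1 g = s * h" using JD(3)[OF ag(2)] by blast
      have "r * (pr 0 a * pr 1 g) = pr 0 a * (r * pr 1 g)" by (simp add: mult.left_commute)
      also have "\<dots> = s * (pr 0 a * h)" unfolding h by (simp add: mult.left_commute)
      finally have "r * pr 1 (a * g) = s * (pr 0 a * h)"
        using pr_1_mult[OF ag(1) JD(1,2)[OF ag(2)]] by simp
      then show ?thesis
        using ag(1) JD(1,2)[OF ag(2)] h
        by (intro JI[of "a * g" "pr 0 a * h"]) (simp_all add: mult pr_closed pr_0_mult)
    qed
  qed
  moreover have "f \<in> J \<and> g \<in> J"
    if fg: "f \<in> R" "g \<in> R" "\<And>a b. (a, b) \<in> K \<Longrightarrow> a * f + b * g = 0" for f g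
  proof -
    have eq: "r * f = s * g" using fg(3)[of r "- s"] pK rs by simp
    have deg_f: "pr (e + (\<delta> + k)) (r * f) = r * pr k f" for k
      using pr_mult[OF R(1) fg(1), of "e + \<delta>" k] re by (simp add: homogD add.assoc)
    have deg_g: "pr (e + k) (s * g) = s * pr k g" for k
      using pr_mult[OF R(2) fg(2), of e k] s by (simp add: homogD)
    have f0: "pr 0 f = 0"
    proof (rule ccontr)
      assume nz: "pr 0 f \<noteq> 0"
      then obtain u where u: "u \<in> R" "pr 0 f * u = 1"
        using degree_0_unit[of "pr 0 f"] fg by (auto simp: pr_closed pr_pr)
      have "r * pr 0 f = s * pr \<delta> g" using deg_f[of 0] deg_g[of \<delta>] eq by simp
      then have "r * (pr 0 f * u) = s * (pr \<delta> g * u)" by (simp add: mult.assoc[symmetric])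
      then have "r = s * (pr \<delta> g * u)" using u by simp
      then show False using ndvd[of "pr \<delta> g * u"] u fg by (auto simp: mult pr_closed)
    qed
    have "r * pr 1 f = s * pr (\<delta> + 1) g" using deg_f[of 1] deg_g[of "\<delta> + 1"] eq by simp
    then have "f \<in> J" by (rule JI[OF fg(1) f0 pr_closed[OF fg(2)]])
    \<comment> \<open>Either \<open>r * f\<close> starts above degree \<open>e + k\<close>, or \<open>k = \<delta> = 1\<close> and the constant term of \<open>f\<close> decides.\<close>
    have low: "pr (e + k) (r * f) = 0" if "k \<le> 1" for k
    proof (cases "k = \<delta>")
      case True
      then show ?thesis using deg_f[of 0] f0 by simp
    next
      case False
      then have "e + k < e + \<delta>" using that \<delta> by auto
      then show ?thesis using pr_mult_less[OF R(1) fg(1), of "e + \<delta>" "e + k"] re by (simp add: homogD)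
    qed
    have "pr 0 g = 0" "pr 1 g = 0"
      using deg_g[of 0] deg_g[of 1] low[of 0] low[of 1] eq s0 by auto
    then have "g \<in> J" by (intro JI[OF fg(2) _ zero]) simp_all
    with \<open>f \<in> J\<close> show ?thesis by blast
  qed
  ultimately have "irrelevant \<subseteq> J" by (rule trace)
  have "\<exists>g\<in>R. r * f = s * g" if f: "homog f 1" for f
  proof -
    have "f \<in> J" using f \<open>irrelevant \<subseteq> J\<close> homog_irrelevant by auto
    then show ?thesis using JD(3)[of f] homogD(2)[OF f] by simp
  qed
  then show False using depth[OF re s s0] ndvd by blast
qed

end

section \<open>Homogeneous affine semigroups\<close>

text \<open>
  The degree of an element is the number of minimal generators in any of its expressions as a sum.
\<close>

locale graded_semigroup =
  fixes S :: "expo set" and dg :: "expo \<Rightarrow> nat"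
  assumes monoid: "add_submonoid S"
    and deg_add: "a \<in> S \<Longrightarrow> b \<in> S \<Longrightarrow> dg (a + b) = dg a + dg b"
    and deg_min_gens: "a \<in> min_gens S \<Longrightarrow> dg a = 1"
begin

lemma zero_in: "0 \<in> S" and add_in: "a \<in> S \<Longrightarrow> b \<in> S \<Longrightarrow> a + b \<in> S"
  using monoid by (auto simp: add_submonoid_def)

lemma deg_zero: "dg 0 = 0"
  using deg_add[OF zero_in zero_in] by simp

lemma min_gens_in: "a \<in> min_gens S \<Longrightarrow> a \<in> S"
  by (simp add: min_gens_def)

lemma sum_mset_in: "set_mset A \<subseteq> S \<Longrightarrow> sum_mset A \<in> S"
  by (induction A) (auto simp: zero_in add_in)

lemma deg_sum_mset: "set_mset A \<subseteq> min_gens S \<Longrightarrow> dg (sum_mset A) = size A"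
proof (induction A)
  case (add x A)
  then have "sum_mset A \<in> S" using min_gens_in by (intro sum_mset_in) auto
  then show ?case using add min_gens_in by (auto simp: deg_add deg_min_gens)
qed (simp add: deg_zero)

lemma sum_min_gens:
  assumes "a \<in> S"
  shows "\<exists>A. set_mset A \<subseteq> min_gens S \<and> a = sum_mset A"
proof -
  let ?T = "{sum_mset A |A. set_mset A \<subseteq> min_gens S}"
  have "add_submonoid ?T"
    unfolding add_submonoid_def
  proof (intro conjI ballI)
    show "0 \<in> ?T" by (auto intro!: exI[of _ "{#}"])
    fix x y assume "x \<in> ?T" "y \<in> ?T"
    then obtain A B where "x = sum_mset A" "set_mset A \<subseteq> min_gens S" "y = sum_mset B" "set_mset B \<subseteq> min_gens S"
      by auto
    then have "x + y = sum_mset (A + B)" "set_mset (A + B) \<subseteq> min_gens S" by auto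
    then show "x + y \<in> ?T" by blast
  qed
  moreover have "min_gens S \<subseteq> ?T"
  proof
    fix x assume "x \<in> min_gens S"
    then have "x = sum_mset {#x#}" "set_mset {#x#} \<subseteq> min_gens S" by auto
    then show "x \<in> ?T" by blast
  qed
  ultimately have "add_submonoid hull (min_gens S) \<subseteq> ?T" by (rule hull_minimal[rotated])
  then show ?thesis using min_gens_generate[OF monoid] assms by auto
qed

lemma deg_eq_0: "a \<in> S \<Longrightarrow> dg a = 0 \<Longrightarrow> a = 0"
  using sum_min_gens[of a] deg_sum_mset by auto

lemma split_min_gen:
  assumes "a \<in> S" "a \<noteq> 0"
  shows "\<exists>x\<in>min_gens S. \<exists>b\<in>S. a = b + x"
proof -
  obtain A where A: "set_mset A \<subseteq> min_gens S" "a = sum_mset A" using sum_min_gens assms by blast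
  then obtain x B where "A = add_mset x B" using assms by (cases A) auto
  then show ?thesis
    using A sum_mset_in[of B] min_gens_in by (intro bexI[of _ x] bexI[of _ "sum_mset B"]) (auto simp: add.commute)
qed

lemma std_grading_eq:
  "std_grading S p = {f. Poly_Mapping.keys f \<subseteq> S \<and> (\<forall>a\<in>Poly_Mapping.keys f. int (dg a) = p)}"
proof -
  have "{sum_mset A |A. set_mset A \<subseteq> min_gens S \<and> int (size A) = p} = {a \<in> S. int (dg a) = p}" (is "?A = ?B")
  proof
    show "?A \<subseteq> ?B"
    proof safe
      fix A assume A: "set_mset A \<subseteq> min_gens S"
      then have "set_mset A \<subseteq> S" using min_gens_in by blast
      then show "sum_mset A \<in> S" by (rule sum_mset_in)
      show "int (dg (sum_mset A)) = int (size A)" using deg_sum_mset[OF A] by simp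
    qed
    show "?B \<subseteq> ?A"
    proof safe
      fix a assume "a \<in> S"
      then obtain A where A: "set_mset A \<subseteq> min_gens S" "a = sum_mset A" using sum_min_gens by blast
      then have "int (size A) = int (dg a)" using deg_sum_mset by simp
      then show "\<exists>A. a = sum_mset A \<and> set_mset A \<subseteq> min_gens S \<and> int (size A) = int (dg a)" using A by blast
    qed
  qed
  then show ?thesis unfolding std_grading_def by auto
qed

end

text \<open>
  Dividing the functional that defines the hyperplane by its value there gives an additive map
  that is \<open>1\<close> on the minimal generators, hence a natural number on \<open>S\<close>.
\<close>

lemma graded_semigroup_exists:
  assumes "affine_semigroup n S" "homogeneous_semigroup n S"
  shows "\<exists>dg. graded_semigroup S dg"
proof -
  have mon: "add_submonoid S" using assms(1) add_submonoid_hull by (auto simp: affine_semigroup_def)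
  obtain l :: "nat \<Rightarrow> real" and c where c: "c \<noteq> 0"
    "\<And>a. a \<in> min_gens S \<Longrightarrow> (\<Sum>i<n. l i * real (Poly_Mapping.lookup a i)) = c"
    using assms(2) unfolding homogeneous_semigroup_def by blast
  define h where "h a = (\<Sum>i<n. l i * real (Poly_Mapping.lookup a i)) / c" for a
  have h_add: "h (a + b) = h a + h b" for a b
    by (simp add: h_def lookup_add sum.distrib distrib_left add_divide_distrib)
  have h_gen: "h a = 1" if "a \<in> min_gens S" for a using c that by (simp add: h_def)
  let ?T = "{a. \<exists>k::nat. h a = real k}"
  have "add_submonoid ?T"
    unfolding add_submonoid_def
  proof (intro conjI ballI)
    have "h 0 = real 0" by (simp add: h_def)
    then show "0 \<in> ?T" by blast
    fix a b assume "a \<in> ?T" "b \<in> ?T"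
    then obtain k m where "h a = real k" "h b = real m" by auto
    then have "h (a + b) = real (k + m)" by (simp add: h_add)
    then show "a + b \<in> ?T" by blast
  qed
  moreover have "min_gens S \<subseteq> ?T" using h_gen by (auto intro!: exI[of _ "1::nat"])
  ultimately have "S \<subseteq> ?T" using min_gens_generate[OF mon] hull_minimal[of "min_gens S" ?T add_submonoid] by simp
  then have h_nat: "h a = real (nat \<lfloor>h a\<rfloor>)" if "a \<in> S" for a using that by auto
  have "graded_semigroup S (\<lambda>a. nat \<lfloor>h a\<rfloor>)"
  proof
    show "add_submonoid S" by (rule mon)
    show "nat \<lfloor>h a\<rfloor> = 1" if "a \<in> min_gens S" for a using h_gen that by simp
    show "nat \<lfloor>h (a + b)\<rfloor> = nat \<lfloor>h a\<rfloor> + nat \<lfloor>h b\<rfloor>" if "a \<in> S" "b \<in> S" for a b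
    proof -
      have "h (a + b) = real (nat \<lfloor>h a\<rfloor> + nat \<lfloor>h b\<rfloor>)" using h_add h_nat[of a] h_nat[of b] that by simp
      then show ?thesis by (metis floor_of_nat nat_int)
    qed
  qed
  then show ?thesis by blast
qed

section \<open>The semigroup ring as a graded domain\<close>

definition sring :: "expo set \<Rightarrow> (expo \<Rightarrow>\<^sub>0 'k::field) set" where
  "sring S = {f. Poly_Mapping.keys f \<subseteq> S}"

lemma sring_iff: "f \<in> sring S \<longleftrightarrow> Poly_Mapping.keys f \<subseteq> S"
  by (simp add: sring_def)

definition part :: "(expo \<Rightarrow> nat) \<Rightarrow> nat \<Rightarrow> (expo \<Rightarrow>\<^sub>0 'k::field) \<Rightarrow> (expo \<Rightarrow>\<^sub>0 'k)" where
  "part dg p f = Poly_Mapping.Abs_poly_mapping (\<lambda>a. if dg a = p then Poly_Mapping.lookup f a else 0)"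

lemma lookup_part: "Poly_Mapping.lookup (part dg p f) a = (if dg a = p then Poly_Mapping.lookup f a else 0)"
proof -
  have "finite {a. (if dg a = p then Poly_Mapping.lookup f a else 0) \<noteq> 0}"
    by (rule finite_subset[OF _ finite_keys[of f]]) (auto simp: in_keys_iff split: if_splits)
  then show ?thesis unfolding part_def by simp
qed

lemma keys_part: "Poly_Mapping.keys (part dg p f) = {a \<in> Poly_Mapping.keys f. dg a = p}"
  by (auto simp: in_keys_iff lookup_part split: if_splits)

lemma part_eq_iff: "part dg p f = f \<longleftrightarrow> (\<forall>a\<in>Poly_Mapping.keys f. dg a = p)"
proof
  show "part dg p f = f \<Longrightarrow> \<forall>a\<in>Poly_Mapping.keys f. dg a = p" using keys_part[of dg p f] by auto
  show "part dg p f = f" if "\<forall>a\<in>Poly_Mapping.keys f. dg a = p"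
    by (rule poly_mapping_eqI) (use that in \<open>auto simp: lookup_part in_keys_iff\<close>)
qed

lemma part_eq_0: "(\<And>a. a \<in> Poly_Mapping.keys f \<Longrightarrow> dg a \<noteq> p) \<Longrightarrow> part dg p f = 0"
  by (rule poly_mapping_eqI) (auto simp: lookup_part in_keys_iff)

lemma part_add: "part dg p (f + g) = part dg p f + part dg p g"
  by (rule poly_mapping_eqI) (auto simp: lookup_part lookup_add)

lemma keys_mult_deg:
  assumes "graded_semigroup S dg" "f \<in> sring S" "g \<in> sring S" "a \<in> Poly_Mapping.keys (f * g)"
  shows "\<exists>b\<in>Poly_Mapping.keys f. \<exists>c\<in>Poly_Mapping.keys g. a = b + c \<and> dg a = dg b + dg c"
proof -
  obtain b c where "a = b + c" "b \<in> Poly_Mapping.keys f" "c \<in> Poly_Mapping.keys g"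
    using keys_mult[of f g] assms(4) by blast
  moreover from this have "dg a = dg b + dg c"
    using assms(2,3) graded_semigroup.deg_add[OF assms(1), of b c] by (auto simp: sring_iff)
  ultimately show ?thesis by blast
qed

lemma carrier_semigroup_ring [simp]: "carrier (semigroup_ring S) = sring S"
  and mult_semigroup_ring [simp]: "f \<otimes>\<^bsub>semigroup_ring S\<^esub> g = f * g"
  and add_semigroup_ring [simp]: "f \<oplus>\<^bsub>semigroup_ring S\<^esub> g = f + g"
  and zero_semigroup_ring [simp]: "\<zero>\<^bsub>semigroup_ring S\<^esub> = 0"
  and one_semigroup_ring [simp]: "\<one>\<^bsub>semigroup_ring S\<^esub> = 1"
  by (simp_all add: semigroup_ring_def sring_def)

text \<open>
  The type token fixes the coefficient field, which occurs in no other parameter.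
\<close>

locale homogeneous_semigroup_ring = graded_semigroup S dg
  for S dg +
  fixes k_type :: "'k::field itself"
  assumes noetherian_ring: "noetherian_ring (semigroup_ring S :: (expo \<Rightarrow>\<^sub>0 'k) ring)"
begin

abbreviation R :: "(expo \<Rightarrow>\<^sub>0 'k) set" where "R \<equiv> sring S"
abbreviation RR :: "(expo \<Rightarrow>\<^sub>0 'k) ring" where "RR \<equiv> semigroup_ring S"
abbreviation pr :: "nat \<Rightarrow> (expo \<Rightarrow>\<^sub>0 'k) \<Rightarrow> (expo \<Rightarrow>\<^sub>0 'k)" where "pr \<equiv> part dg"

lemma cring_RR: "cring RR"
  by (rule semigroup_ring_cring[OF monoid])

lemma a_inv_RR: "f \<in> R \<Longrightarrow> \<ominus>\<^bsub>RR\<^esub> f = - f"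
  using abelian_group.minus_equality[OF ring.is_abelian_group[OF cring.axioms(1)[OF cring_RR]], of "- f" f]
  by (simp add: sring_iff)

lemma ideal_iff: "ideal I RR \<longleftrightarrow> ideal_of R I"
proof
  assume I: "ideal I RR"
  then interpret ideal I RR .
  have "I \<subseteq> R" using a_subset by simp
  moreover have "0 \<in> I" using additive_subgroup.zero_closed[OF is_additive_subgroup] by simp
  moreover have "a + b \<in> I" if "a \<in> I" "b \<in> I" for a b
    using additive_subgroup.a_closed[OF is_additive_subgroup that] by simp
  moreover have "r * a \<in> I" if "r \<in> R" "a \<in> I" for a r
    using I_l_closed[of a r] that by simp
  ultimately show "ideal_of R I" by (simp add: ideal_of_def)
next
  assume I: "ideal_of R I"
  have m1: "- 1 \<in> R" by (simp add: sring_iff zero_in)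
  have neg: "- a \<in> I" if "a \<in> I" for a
    using I that m1 unfolding ideal_of_def by (metis mult_minus1)
  show "ideal I RR"
  proof (rule idealI)
    show "ring RR" using cring_RR by (simp add: cring_def)
    show "subgroup I (add_monoid RR)"
    proof
      show "inv\<^bsub>add_monoid RR\<^esub> a \<in> I" if "a \<in> I" for a
        using a_inv_RR[of a] neg[OF that] that I by (auto simp: a_inv_def ideal_of_def)
    qed (use I in \<open>auto simp: ideal_of_def\<close>)
    fix a x assume "a \<in> I" "x \<in> carrier RR"
    then have "x * a \<in> I" using I by (simp add: ideal_of_def)
    then show "x \<otimes>\<^bsub>RR\<^esub> a \<in> I" "a \<otimes>\<^bsub>RR\<^esub> x \<in> I" by (simp_all add: mult.commute)
  qed
qed

lemma primeideal_iff: "primeideal P RR \<longleftrightarrow> prime_of R P"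
proof
  assume P: "primeideal P RR"
  then interpret primeideal P RR .
  have id: "ideal_of R P" using ideal_iff is_ideal by simp
  have "1 \<notin> P"
  proof
    assume "1 \<in> P"
    then have "R \<subseteq> P" using id unfolding ideal_of_def by (metis mult.right_neutral subsetI)
    then show False using I_notcarr id by (auto simp: ideal_of_def)
  qed
  then show "prime_of R P" using id I_prime by (auto simp: prime_of_def)
next
  assume P: "prime_of R P"
  have "1 \<in> R" by (simp add: sring_iff zero_in)
  then show "primeideal P RR"
    using P cring_RR by (intro primeidealI) (auto simp: prime_of_def ideal_iff)
qed

sublocale graded_domain R pr
proof
  show "1 \<in> R" by (simp add: sring_iff zero_in)
  show "- f \<in> R" if "f \<in> R" for f :: "expo \<Rightarrow>\<^sub>0 'k" using that by (simp add: sring_iff)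
  show "f + g \<in> R" if "f \<in> R" "g \<in> R" for f g :: "expo \<Rightarrow>\<^sub>0 'k"
    using that keys_add[of f g] by (auto simp: sring_iff)
  show mult: "f * g \<in> R" if "f \<in> R" "g \<in> R" for f g :: "expo \<Rightarrow>\<^sub>0 'k"
    using that keys_mult[of f g] add_in by (fastforce simp: sring_iff)
  show "pr p f \<in> R" if "f \<in> R" for f p
    using that by (auto simp: sring_iff keys_part)
  show "pr p (f + g) = pr p f + pr p g" for p f g by (rule part_add)
  show "pr p (pr q f) = (if p = q then pr q f else 0)" for p q f
    by (rule poly_mapping_eqI) (auto simp: lookup_part)
  show "\<exists>n. f = (\<Sum>p<n. pr p f)" for f :: "expo \<Rightarrow>\<^sub>0 'k"
  proof -
    obtain n where n: "\<forall>d\<in>dg ` Poly_Mapping.keys f. d < n"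
      using finite_nat_set_iff_bounded[of "dg ` Poly_Mapping.keys f"] by auto
    have "f = (\<Sum>p<n. pr p f)"
      by (rule poly_mapping_eqI) (use n in \<open>auto simp: lookup_sum lookup_part in_keys_iff\<close>)
    then show ?thesis by blast
  qed
  show "pr (p + q) (f * g) = f * pr q g" if f: "f \<in> R" "pr p f = f" and g: "g \<in> R" for f g p q
  proof -
    have gs: "pr q g \<in> R" "g - pr q g \<in> R"
      using g keys_part[of dg q g] keys_diff[of g "pr q g"] by (auto simp: sring_iff)
    have 1: "pr (p + q) (f * pr q g) = f * pr q g"
      unfolding part_eq_iff
    proof
      fix a assume "a \<in> Poly_Mapping.keys (f * pr q g)"
      then show "dg a = p + q"
        using keys_mult_deg[OF graded_semigroup_axioms f(1) gs(1)] f(2)[unfolded part_eq_iff] keys_part[of dg q g]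
        by fastforce
    qed
    have kd: "dg c \<noteq> q" if "c \<in> Poly_Mapping.keys (g - pr q g)" for c
      using that by (auto simp: in_keys_iff lookup_minus lookup_part)
    have 2: "pr (p + q) (f * (g - pr q g)) = 0"
    proof (rule part_eq_0)
      fix a assume "a \<in> Poly_Mapping.keys (f * (g - pr q g))"
      then show "dg a \<noteq> p + q"
        using keys_mult_deg[OF graded_semigroup_axioms f(1) gs(2)] f(2)[unfolded part_eq_iff] kd
        by fastforce
    qed
    have "f * g = f * pr q g + f * (g - pr q g)" by (simp add: algebra_simps)
    then show ?thesis using 1 2 by (metis part_add add.right_neutral)
  qed
  show "pr q (f * g) = 0" if f: "f \<in> R" "pr p f = f" and g: "g \<in> R" and "q < p" for f g p q
  proof (rule part_eq_0)
    fix a assume "a \<in> Poly_Mapping.keys (f * g)"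
    then show "dg a \<noteq> q"
      using keys_mult_deg[OF graded_semigroup_axioms f(1) g] f(2)[unfolded part_eq_iff] \<open>q < p\<close>
      by fastforce
  qed
  show "pr 0 1 = 1" by (simp add: part_eq_iff deg_zero)
  show "\<exists>g\<in>R. f * g = 1" if f: "f \<in> R" "pr 0 f = f" "f \<noteq> 0" for f
  proof -
    have "Poly_Mapping.keys f \<subseteq> {0}"
      using f deg_eq_0 unfolding part_eq_iff by (auto simp: sring_iff)
    then have f0: "f = Poly_Mapping.single 0 (Poly_Mapping.lookup f 0)"
      by (intro poly_mapping_eqI) (auto simp: lookup_single in_keys_iff when_def)
    define c where "c = Poly_Mapping.lookup f 0"
    have c: "f = Poly_Mapping.single 0 c" using f0 by (simp add: c_def)
    then have "c \<noteq> 0" using f by auto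
    then have "f * Poly_Mapping.single 0 (inverse c) = 1"
      unfolding c by (simp add: mult_single)
    moreover have "Poly_Mapping.single 0 (inverse c) \<in> R" by (simp add: sring_iff zero_in)
    ultimately show ?thesis by blast
  qed
  show "\<exists>I\<in>F. \<forall>J\<in>F. I \<subseteq> J \<longrightarrow> J = I" if F: "F \<noteq> {}" "\<And>I. I \<in> F \<Longrightarrow> ideal_of R I" for F :: "(expo \<Rightarrow>\<^sub>0 'k) set set"
  proof -
    have "\<exists>I\<in>F. \<forall>J\<in>F. I \<subseteq> J \<longrightarrow> J = I"
    proof (rule subset_Zorn_nonempty[OF F(1)])
      fix C assume C: "C \<noteq> {}" "subset.chain F C"
      have "subset.chain {I. ideal I RR} C"
        using C(2) F(2) by (auto simp: subset.chain_def ideal_iff)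
      then have "\<Union>C \<in> C" using noetherian_ring.ideal_chain_is_trivial[OF noetherian_ring C(1)] by blast
      then show "\<Union>C \<in> F" using C(2) by (auto simp: subset.chain_def)
    qed
    then show ?thesis by blast
  qed
qed

lemma homog_iff: "homog f p \<longleftrightarrow> Poly_Mapping.keys f \<subseteq> S \<and> (\<forall>a\<in>Poly_Mapping.keys f. dg a = p)"
  unfolding homog_def part_eq_iff by (simp add: sring_iff)

lemma std_grading_iff: "f \<in> std_grading S (int p) \<longleftrightarrow> homog f p"
  by (auto simp: std_grading_eq homog_iff)

lemma homog_single: "a \<in> S \<Longrightarrow> homog (Poly_Mapping.single a c) (dg a)"
  by (auto simp: homog_iff split: if_splits)

lemma irrelevant_iff: "f \<in> irrelevant \<longleftrightarrow> f \<in> R \<and> Poly_Mapping.lookup f 0 = 0"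
proof -
  have "pr 0 f = 0 \<longleftrightarrow> Poly_Mapping.lookup f 0 = 0" if f: "f \<in> R"
  proof
    show "pr 0 f = 0 \<Longrightarrow> Poly_Mapping.lookup f 0 = 0"
      using lookup_part[of dg 0 f 0] by (simp add: deg_zero)
    show "pr 0 f = 0" if "Poly_Mapping.lookup f 0 = 0"
    proof (rule part_eq_0)
      fix a assume a: "a \<in> Poly_Mapping.keys f"
      then have "a \<in> S" "a \<noteq> 0" using f that by (auto simp: sring_iff in_keys_iff)
      then show "dg a \<noteq> 0" using deg_eq_0 by blast
    qed
  qed
  then show ?thesis by (auto simp: irrelevant_def)
qed

lemma sum_singles:
  fixes f :: "expo \<Rightarrow>\<^sub>0 'k"
  shows "f = (\<Sum>a\<in>Poly_Mapping.keys f. Poly_Mapping.single a (Poly_Mapping.lookup f a))"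
  by (rule poly_mapping_eqI) (simp add: lookup_sum lookup_single when_def in_keys_iff)

lemma irrelevant_generated:
  assumes J: "ideal_of R J" and x: "\<And>x. x \<in> min_gens S \<Longrightarrow> Poly_Mapping.single x 1 \<in> J"
  shows "irrelevant \<subseteq> J"
proof
  fix f assume f: "f \<in> irrelevant"
  have "Poly_Mapping.single a (Poly_Mapping.lookup f a) \<in> J" if a: "a \<in> Poly_Mapping.keys f" for a
  proof -
    have "a \<in> S" "a \<noteq> 0" using f a by (auto simp: irrelevant_iff sring_iff in_keys_iff)
    then obtain x b where xb: "x \<in> min_gens S" "b \<in> S" "a = b + x" using split_min_gen by blast
    have "Poly_Mapping.single b (Poly_Mapping.lookup f a) * Poly_Mapping.single x 1 \<in> J"
      using J x[OF xb(1)] xb(2) by (auto simp: ideal_of_def sring_iff)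
    then show ?thesis using xb by (simp add: mult_single)
  qed
  then have "(\<Sum>a\<in>Poly_Mapping.keys f. Poly_Mapping.single a (Poly_Mapping.lookup f a)) \<in> J"
    by (intro ideal_sum[OF J])
  then show "f \<in> J" using sum_singles[of f] by simp
qed

lemma graded_max_ideal_eq: "graded_max_ideal RR (std_grading S) = irrelevant"
proof -
  interpret ring RR using cring_RR by (simp add: cring_def)
  let ?G = "\<Union>p\<in>{0<..}. std_grading S p :: (expo \<Rightarrow>\<^sub>0 'k) set"
  have G: "?G \<subseteq> irrelevant"
  proof safe
    fix f :: "expo \<Rightarrow>\<^sub>0 'k" and p :: int assume p: "p > 0" "f \<in> std_grading S p"
    then have "0 \<notin> Poly_Mapping.keys f" using deg_zero by (auto simp: std_grading_eq)
    then show "f \<in> irrelevant" using p by (simp add: irrelevant_iff std_grading_eq sring_iff in_keys_iff)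
  qed
  have GR: "?G \<subseteq> carrier RR" using G by (auto simp: irrelevant_def)
  have id: "ideal_of R (Idl\<^bsub>RR\<^esub> ?G)" using genideal_ideal[OF GR] ideal_iff by blast
  have "Idl\<^bsub>RR\<^esub> ?G \<subseteq> irrelevant"
    using genideal_minimal[of irrelevant ?G] G ideal_iff ideal_of_irrelevant by blast
  moreover have "irrelevant \<subseteq> Idl\<^bsub>RR\<^esub> ?G"
  proof (rule irrelevant_generated[OF id])
    fix x assume x: "x \<in> min_gens S"
    then have "Poly_Mapping.single x (1 :: 'k) \<in> std_grading S (int 1)"
      using homog_single[OF min_gens_in[OF x], of 1] deg_min_gens[OF x] std_grading_iff[of _ 1] by simp
    then have "Poly_Mapping.single x 1 \<in> ?G" by (intro UN_I[of "int 1"]) auto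
    then show "Poly_Mapping.single x 1 \<in> Idl\<^bsub>RR\<^esub> ?G" using genideal_self[OF GR] by blast
  qed
  ultimately show ?thesis unfolding graded_max_ideal_def by blast
qed

lemma prime_chain_height:
  assumes "\<forall>i\<le>d. prime_of R (p i)" "\<forall>i<d. p i \<subset> p (Suc i)"
  shows "enat d \<le> prime_height RR (p d)"
  unfolding prime_height_def
  by (rule SUP_upper) (use assms in \<open>auto simp: primeideal_iff\<close>)

lemma maximalideal_irrelevant: "maximalideal irrelevant RR"
proof (rule maximalidealI)
  show "ideal irrelevant RR" using ideal_iff ideal_of_irrelevant by blast
  show "carrier RR \<noteq> irrelevant" using prime_of_irrelevant one by (auto simp: prime_of_def)
  fix J assume J: "ideal J RR" "irrelevant \<subseteq> J" "J \<subseteq> carrier RR"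
  have id: "ideal_of R J" using J ideal_iff by blast
  show "J = irrelevant \<or> J = carrier RR"
  proof (rule disjCI)
    assume "J \<noteq> carrier RR"
    have "J \<subseteq> irrelevant"
    proof
      fix f assume f: "f \<in> J"
      then have fR: "f \<in> R" using J by auto
      show "f \<in> irrelevant"
      proof (rule ccontr)
        assume "f \<notin> irrelevant"
        then have nz: "pr 0 f \<noteq> 0" using fR by (simp add: irrelevant_def)
        then obtain u where u: "u \<in> R" "pr 0 f * u = 1"
          using degree_0_unit[of "pr 0 f"] fR by (auto simp: pr_closed pr_pr)
        have "pr 0 f - f \<in> irrelevant" using fR by (simp add: irrelevant_def diff pr_closed pr_diff pr_pr)
        then have "pr 0 f - f \<in> J" using J by blast
        then have "(pr 0 f - f) + f \<in> J" using id f unfolding ideal_of_def by blast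
        then have "u * pr 0 f \<in> J" using id u by (simp add: ideal_of_def)
        then have one: "1 \<in> J" using u by (simp add: mult.commute)
        have "r \<in> J" if "r \<in> R" for r using id one that unfolding ideal_of_def by (metis mult.right_neutral)
        then show False using \<open>J \<noteq> carrier RR\<close> J by auto
      qed
    qed
    then show "J = irrelevant" using J by blast
  qed
qed

end

section \<open>Depth of the semigroup ring\<close>

context homogeneous_semigroup_ring
begin

abbreviation var :: "expo \<Rightarrow> (expo \<Rightarrow>\<^sub>0 'k)" where "var a \<equiv> Poly_Mapping.single a 1"

lemma var_power: "\<exists>b. var a ^ n = var b"
proof (induction n)
  case 0
  show ?case by (intro exI[of _ 0]) simp
next
  case (Suc n)
  then obtain b where "var a ^ n = var b" by blast
  then show ?case by (intro exI[of _ "a + b"]) (simp add: mult_single)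
qed

text \<open>
  The value of a polynomial at the point with all coordinates equal to \<open>1\<close>.
\<close>

definition coeff_sum :: "(expo \<Rightarrow>\<^sub>0 'k) \<Rightarrow> 'k" where
  "coeff_sum f = (\<Sum>a\<in>Poly_Mapping.keys f. Poly_Mapping.lookup f a)"

lemma coeff_sum_superset:
  "finite K \<Longrightarrow> Poly_Mapping.keys f \<subseteq> K \<Longrightarrow> coeff_sum f = (\<Sum>a\<in>K. Poly_Mapping.lookup f a)"
  unfolding coeff_sum_def by (rule sum.mono_neutral_left) (auto simp: in_keys_iff)

lemma coeff_sum_add: "coeff_sum (f + g) = coeff_sum f + coeff_sum g"
proof -
  let ?K = "Poly_Mapping.keys f \<union> Poly_Mapping.keys g"
  have "coeff_sum (f + g) = (\<Sum>a\<in>?K. Poly_Mapping.lookup (f + g) a)"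
    using keys_add[of f g] by (intro coeff_sum_superset) auto
  also have "\<dots> = coeff_sum f + coeff_sum g"
    by (simp add: coeff_sum_superset[of ?K] lookup_add sum.distrib)
  finally show ?thesis .
qed

lemma coeff_sum_single: "coeff_sum (Poly_Mapping.single a c) = c"
  by (simp add: coeff_sum_superset[of "{a}"])

lemma coeff_sum_0: "coeff_sum 0 = 0"
  by (simp add: coeff_sum_def)

lemma coeff_sum_sum: "coeff_sum (sum f A) = (\<Sum>i\<in>A. coeff_sum (f i))"
  by (induction A rule: infinite_finite_induct) (auto simp: coeff_sum_0 coeff_sum_add)

lemma coeff_sum_mult_var: "coeff_sum (f * var a) = coeff_sum f"
proof -
  have "f * var a = (\<Sum>b\<in>Poly_Mapping.keys f. Poly_Mapping.single b (Poly_Mapping.lookup f b)) * var a"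
    using sum_singles[of f] by simp
  also have "\<dots> = (\<Sum>b\<in>Poly_Mapping.keys f. Poly_Mapping.single (b + a) (Poly_Mapping.lookup f b))"
    by (simp add: sum_distrib_right mult_single)
  also have "coeff_sum \<dots> = coeff_sum f"
    by (simp add: coeff_sum_sum coeff_sum_single) (simp add: coeff_sum_def)
  finally show ?thesis .
qed

lemma coeff_sum_diff: "coeff_sum (f - g) = coeff_sum f - coeff_sum g"
  using coeff_sum_add[of "f - g" g] by simp

lemma coeff_sum_mult_var_power: "coeff_sum (f * var a ^ n) = coeff_sum f"
  using var_power[of a n] coeff_sum_mult_var by auto

lemma pr_0_eq_single: "f \<in> R \<Longrightarrow> pr 0 f = Poly_Mapping.single 0 (Poly_Mapping.lookup f 0)"
  using deg_eq_0 deg_zero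
  by (intro poly_mapping_eqI) (auto simp: lookup_part lookup_single sring_iff in_keys_iff when_def)

text \<open>
  Between \<open>0\<close> and \<open>m\<close> there is a prime over the principal ideal of \<open>x\<^sup>a - x\<^sup>b\<close> that does not contain
  \<open>x\<^sup>a\<close>.  It exists because no \<open>s x\<^sup>c\<^sup>a\<close>, with \<open>s\<close> outside \<open>m\<close>, is a multiple of \<open>x\<^sup>a - x\<^sup>b\<close>: in the component of
  degree \<open>c\<close> the sum of the coefficients is the nonzero constant term of \<open>s\<close> on one side and \<open>0\<close> on the
  other.
\<close>

lemma height_ge_2:
  assumes ab: "a \<in> min_gens S" "b \<in> min_gens S" "a \<noteq> b"
  shows "enat 2 \<le> prime_height RR irrelevant"
proof -
  have xR: "homog (var a) 1" "homog (var b) 1"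
    using homog_single[OF min_gens_in] ab deg_min_gens by (metis One_nat_def)+
  define f where "f = var a - var b"
  have f: "homog f 1"
    using xR by (simp add: f_def homog_def diff pr_diff)
  have fR: "f \<in> R" using f by (simp add: homogD)
  define I where "I = {r * f |r. r \<in> R}"
  have "\<exists>Q. prime_of R Q \<and> I \<subseteq> Q \<and> Q \<subseteq> irrelevant \<and> var a \<notin> Q"
  proof (rule exists_prime_avoiding)
    show "ideal_of R I" unfolding I_def by (rule ideal_of_principal[OF fR])
    show "prime_of R irrelevant" by (rule prime_of_irrelevant)
    show "var a \<in> R" using xR by (simp add: homogD)
    fix s c assume s: "s \<in> R - irrelevant"
    show "s * var a ^ c \<notin> I"
    proof
      assume "s * var a ^ c \<in> I"
      then obtain h where h: "h \<in> R" "s * var a ^ c = h * f" by (auto simp: I_def)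
      have hc: "homog (var a ^ c) c" using homog_power[OF xR(1), of c] by simp
      have "pr c (var a ^ c * s) = var a ^ c * pr 0 s"
        using pr_mult[of "var a ^ c" s c 0] hc s by (simp add: homogD)
      then have 1: "coeff_sum (pr c (h * f)) = coeff_sum (pr 0 s)"
        using h(2) coeff_sum_mult_var_power[of "pr 0 s" a c] by (simp add: mult.commute)
      have "coeff_sum (pr c (f * h)) = 0"
      proof (cases c)
        case 0
        then show ?thesis using pr_mult_less[of f h 1 0] f h by (simp add: homogD coeff_sum_0)
      next
        case (Suc c')
        then have "pr c (f * h) = f * pr c' h"
          using pr_mult[of f h 1 c'] f h by (simp add: homogD)
        also have "\<dots> = pr c' h * var a - pr c' h * var b"
          by (simp add: f_def algebra_simps)
        finally show ?thesis by (simp add: coeff_sum_diff coeff_sum_mult_var)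
      qed
      then have "coeff_sum (pr 0 s) = 0" using 1 by (simp add: mult.commute)
      then have "Poly_Mapping.lookup s 0 = 0" using s by (simp add: pr_0_eq_single coeff_sum_single)
      then show False using s by (simp add: irrelevant_iff)
    qed
  qed
  then obtain Q where Q: "prime_of R Q" "I \<subseteq> Q" "Q \<subseteq> irrelevant" "var a \<notin> Q" by blast
  have "f = 1 * f" by simp
  then have "f \<in> Q" using Q(2) one unfolding I_def by blast
  moreover have "Poly_Mapping.lookup f a \<noteq> 0" using ab by (simp add: f_def lookup_minus lookup_single)
  then have "f \<noteq> 0" by auto
  moreover have "0 \<in> Q" using Q by (auto simp: prime_of_def ideal_of_def)
  ultimately have 0: "{0} \<subset> Q" by blast
  have "var a \<in> irrelevant" using homog_irrelevant[OF xR(1)] by simp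
  then have 1: "Q \<subset> irrelevant" using Q by blast
  \<comment> \<open>The chain \<open>0 \<subset> Q \<subset> m\<close>.\<close>
  define p where "p = (\<lambda>i::nat. if i = 0 then {0} else if i = 1 then Q else irrelevant)"
  have "enat 2 \<le> prime_height RR (p 2)"
  proof (rule prime_chain_height)
    show "\<forall>i\<le>2. prime_of R (p i)" using Q prime_of_0 prime_of_irrelevant by (simp add: p_def)
    show "\<forall>i<2. p i \<subset> p (Suc i)" using 0 1 by (auto simp: p_def less_2_cases_iff)
  qed
  then show ?thesis by (simp add: p_def)
qed

lemma Idl_single: "u \<in> R \<Longrightarrow> Idl\<^bsub>RR\<^esub> {u} = {r * u |r. r \<in> R}"
  using cring.cgenideal_eq_genideal[OF cring_RR, of u] by (auto simp: cgenideal_def)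

text \<open>
  Let \<open>u\<close>, \<open>v\<close> begin the regular sequence.  From \<open>r u = s g\<close> and \<open>r v = s h\<close> it follows that \<open>v g = u h\<close>,
  so \<open>g\<close> is a multiple of \<open>u\<close>, and cancelling \<open>u\<close> shows that \<open>r\<close> is a multiple of \<open>s\<close>.
\<close>

lemma depth_of_regular_seq:
  assumes xs: "regular_seq RR xs" "set xs \<subseteq> irrelevant" "length xs \<ge> 2"
    and r: "r \<in> R" "s \<in> R" "s \<noteq> 0" "\<And>f. homog f 1 \<Longrightarrow> \<exists>g\<in>R. r * f = s * g"
  shows "\<exists>c\<in>R. r = s * c"
proof -
  interpret RR: ring RR using cring_RR by (simp add: cring_def)
  define J where "J = {f \<in> R. \<exists>g\<in>R. r * f = s * g}"
  have "ideal_of R J"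
    unfolding ideal_of_def
  proof (intro conjI ballI)
    show "J \<subseteq> R" by (auto simp: J_def)
    show "0 \<in> J" using zero by (auto simp: J_def)
    show "f + f' \<in> J" if ff: "f \<in> J" "f' \<in> J" for f f'
    proof -
      obtain g g' where "f \<in> R" "f' \<in> R" "g \<in> R" "g' \<in> R" "r * f = s * g" "r * f' = s * g'"
        using ff unfolding J_def by blast
      then have "f + f' \<in> R" "g + g' \<in> R" "r * (f + f') = s * (g + g')"
        by (simp_all add: add distrib_left)
      then show ?thesis unfolding J_def by blast
    qed
    show "a * f \<in> J" if af: "a \<in> R" "f \<in> J" for a f
    proof -
      obtain g where g: "f \<in> R" "g \<in> R" "r * f = s * g"
        using af unfolding J_def by blast
      have "r * (a * f) = a * (r * f)" by (simp add: mult.left_commute)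
      also have "\<dots> = s * (a * g)" unfolding g by (simp add: mult.left_commute)
      finally have "a * f \<in> R" "a * g \<in> R" "r * (a * f) = s * (a * g)"
        using g af by (simp_all add: mult)
      then show ?thesis unfolding J_def by blast
    qed
  qed
  moreover have "var a \<in> J" if "a \<in> min_gens S" for a
    using homog_single[OF min_gens_in[OF that], of 1] deg_min_gens[OF that] r(4)[of "var a"]
    by (simp add: J_def homogD)
  ultimately have J: "irrelevant \<subseteq> J" by (rule irrelevant_generated)
  define u v where "u = xs ! 0" and "v = xs ! 1"
  have "u \<in> set xs" unfolding u_def by (rule nth_mem) (use xs(3) in linarith)
  moreover have "v \<in> set xs" unfolding v_def by (rule nth_mem) (use xs(3) in linarith)
  ultimately have uv: "u \<in> irrelevant" "v \<in> irrelevant" using xs(2) by blast+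
  then have uvR: "u \<in> R" "v \<in> R" by (auto simp: irrelevant_def)
  have reg: "(xs ! i) \<otimes>\<^bsub>RR\<^esub> a \<in> Idl\<^bsub>RR\<^esub> (set (take i xs)) \<Longrightarrow> a \<in> Idl\<^bsub>RR\<^esub> (set (take i xs))"
    if "i < length xs" "a \<in> R" for i a
    using xs(1) that by (simp add: regular_seq_def)
  have "Idl\<^bsub>RR\<^esub> {} = {0}"
  proof -
    have "ideal {0} RR" using RR.zeroideal by simp
    then have "Idl\<^bsub>RR\<^esub> {} \<subseteq> {0}" by (intro RR.genideal_minimal) auto
    moreover have "ideal (Idl\<^bsub>RR\<^esub> {}) RR" by (rule RR.genideal_ideal) auto
    then have "0 \<in> Idl\<^bsub>RR\<^esub> {}" using ideal_iff by (auto simp: ideal_of_def)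
    ultimately show ?thesis by blast
  qed
  then have u0: "u \<noteq> 0" using reg[of 0 1] xs(3) one by (cases xs) (auto simp: u_def)
  have reg1: "g \<in> {r * u |r. r \<in> R}" if "g \<in> R" "v * g \<in> {r * u |r. r \<in> R}" for g
  proof -
    have "take 1 xs = [u]" using xs(3) by (cases xs) (auto simp: u_def)
    then show ?thesis using reg[of 1 g] xs(3) that Idl_single[OF uvR(1)] by (simp add: v_def)
  qed
  obtain g h where g: "g \<in> R" "r * u = s * g" and h: "h \<in> R" "r * v = s * h"
    using J uv unfolding J_def by blast
  have "s * (g * v) = (r * u) * v" unfolding g(2) by (simp only: mult.assoc)
  also have "\<dots> = (r * v) * u" by (simp only: mult_ac)
  also have "\<dots> = s * (h * u)" unfolding h(2) by (simp only: mult.assoc)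
  finally have "g * v = h * u" using r(3) by simp
  then have "v * g = h * u" by (simp only: mult.commute)
  then have "g \<in> {r * u |r. r \<in> R}" using reg1[OF g(1)] h(1) by blast
  then obtain c where c: "c \<in> R" "g = c * u" by blast
  have "r * u = (s * c) * u" unfolding g(2) c(2) by (simp only: mult.assoc)
  then show ?thesis using u0 c(1) by auto
qed

text \<open>
  Here every component of \<open>R\<close> is spanned by at most one monomial, so a nonzero homogeneous element
  divides any other one of at least the same degree.
\<close>

lemma depth_one_generator:
  assumes one: "\<And>a b. a \<in> min_gens S \<Longrightarrow> b \<in> min_gens S \<Longrightarrow> a = b"
    and r: "homog r (e + \<delta>)" and s: "homog s e" "s \<noteq> 0"
  shows "\<exists>c\<in>R. r = s * c"
proof (cases "r = 0")
  case True
  then show ?thesis using zero by (intro bexI[of _ 0]) auto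
next
  case False
  have inj: "a = b" if ab: "a \<in> S" "b \<in> S" "dg a = dg b" for a b
  proof -
    obtain A where A: "set_mset A \<subseteq> min_gens S" "a = sum_mset A" using sum_min_gens[OF ab(1)] by blast
    obtain B where B: "set_mset B \<subseteq> min_gens S" "b = sum_mset B" using sum_min_gens[OF ab(2)] by blast
    have size: "size A = size B" using ab(3) deg_sum_mset[OF A(1)] deg_sum_mset[OF B(1)] A(2) B(2) by simp
    have "A = B"
    proof (cases "A = {#}")
      case True
      then show ?thesis using size by simp
    next
      case False
      then obtain y where "y \<in># A" by (rule multiset_nonemptyE)
      then have y: "y \<in> min_gens S" using A(1) by auto
      have "set_mset A \<subseteq> {y}" using A(1) one[OF _ y] by auto
      then have rA: "A = replicate_mset (size A) y" by (rule set_mset_subset_singletonD)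
      have "set_mset B \<subseteq> {y}" using B(1) one[OF _ y] by auto
      then have rB: "B = replicate_mset (size B) y" by (rule set_mset_subset_singletonD)
      show ?thesis by (rule trans[OF rA trans[OF _ rB[symmetric]]]) (simp only: size)
    qed
    then show ?thesis using A(2) B(2) by simp
  qed
  have single: "\<exists>a\<in>S. \<exists>c. c \<noteq> 0 \<and> f = Poly_Mapping.single a c \<and> dg a = p" if f: "homog f p" "f \<noteq> 0" for f p
  proof -
    obtain a where a: "a \<in> Poly_Mapping.keys f" using f(2) by (metis ex_in_conv keys_eq_empty)
    have "b = a" if b: "b \<in> Poly_Mapping.keys f" for b
      using f(1) a b by (intro inj) (auto simp: homog_iff)
    then have fa: "f = Poly_Mapping.single a (Poly_Mapping.lookup f a)"
      by (intro poly_mapping_eqI) (auto simp: lookup_single in_keys_iff when_def)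
    have aS: "a \<in> S" "dg a = p" using a f(1) by (auto simp: homog_iff)
    have "Poly_Mapping.lookup f a \<noteq> 0" using a by (simp add: in_keys_iff)
    then show ?thesis
      by (intro bexI[OF _ aS(1)] exI[of _ "Poly_Mapping.lookup f a"] conjI fa aS(2))
  qed
  obtain a c where a: "a \<in> S" "r = Poly_Mapping.single a c" "dg a = e + \<delta>"
    using single[OF r False] by blast
  obtain b d where b: "b \<in> S" "d \<noteq> 0" "s = Poly_Mapping.single b d" "dg b = e"
    using single[OF s] by blast
  obtain A where A: "set_mset A \<subseteq> min_gens S" "a = sum_mset A" using sum_min_gens[OF a(1)] by blast
  have "size A = e + \<delta>" using deg_sum_mset[OF A(1)] A(2) a(3) by simp
  obtain ys where ys: "A = mset ys" using ex_mset by metis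
  define B where "B = mset (take \<delta> ys)"
  have Bg: "set_mset B \<subseteq> min_gens S" using A set_take_subset[of \<delta> ys] by (auto simp: B_def ys)
  have B: "size B = \<delta>" using \<open>size A = e + \<delta>\<close> by (simp add: B_def ys)
  define k where "k = sum_mset B"
  have "set_mset B \<subseteq> S" using Bg min_gens_in by auto
  then have k: "k \<in> S" "dg k = \<delta>"
    using B deg_sum_mset[OF Bg] sum_mset_in[of B] by (simp_all add: k_def)
  have "b + k = a" using a(1,3) b(1,4) k by (intro inj) (simp_all add: add_in deg_add)
  then have "r = s * Poly_Mapping.single k (c / d)" using b(2) unfolding a(2) b(3) by (simp add: mult_single)
  then show ?thesis using k by (intro bexI[of _ "Poly_Mapping.single k (c / d)"]) (simp_all add: sring_iff)
qed

theorem depth_condition: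
  assumes CM: "Cohen_Macaulay_ring RR"
    and r: "homog r (e + \<delta>)" and s: "homog s e" "s \<noteq> 0"
    and rs: "\<And>f. homog f 1 \<Longrightarrow> \<exists>g\<in>R. r * f = s * g"
  shows "\<exists>c\<in>R. r = s * c"
proof (cases "\<exists>a\<in>min_gens S. \<exists>b\<in>min_gens S. a \<noteq> b")
  case False
  then show ?thesis using depth_one_generator[OF _ r s] by blast
next
  case True
  then have "enat 2 \<le> prime_height RR irrelevant" using height_ge_2 by blast
  also have "\<dots> = ideal_grade RR irrelevant"
    using CM maximalideal_irrelevant by (simp add: Cohen_Macaulay_ring_def)
  finally have grade: "enat 2 \<le> ideal_grade RR irrelevant" .
  have "\<exists>xs. regular_seq RR xs \<and> set xs \<subseteq> irrelevant \<and> length xs \<ge> 2"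
  proof (rule ccontr)
    assume "\<not> ?thesis"
    then have "ideal_grade RR irrelevant \<le> enat 1"
      unfolding ideal_grade_def by (intro SUP_least) (auto simp: not_le)
    with grade have "enat 2 \<le> enat 1" by (rule order_trans)
    then show False by simp
  qed
  then show ?thesis using depth_of_regular_seq rs homogD(1)[OF r] homogD(1)[OF s(1)] s(2) by blast
qed

end

section \<open>Quotient modules\<close>

locale quotient_of_module = module R M
  for R :: "('a, 'b) ring_scheme" (structure) and M :: "('a, 'c) module" (structure) +
  fixes N :: "'c set"
  assumes submodule: "submodule N R M"
begin

abbreviation Q where "Q \<equiv> quot_module M N"

lemma abelian_subgroup: "abelian_subgroup N M"
proof (rule abelian_subgroupI3)
  show "additive_subgroup N M"
    using submodule by (intro additive_subgroupI) (simp add: submodule_def)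
  show "abelian_group M" by (rule M.abelian_group_axioms)
qed

lemma in_carrier: "x \<in> N \<Longrightarrow> x \<in> carrier M"
  using submoduleE(1)[OF submodule] by blast

lemma carrier_Q: "carrier Q = {N +>\<^bsub>M\<^esub> x |x. x \<in> carrier M}"
  by (auto simp: quot_module_def A_RCOSETS_def' )

lemma zero_Q: "\<zero>\<^bsub>Q\<^esub> = N"
  by (simp add: quot_module_def)

lemma coset_eq_iff:
  assumes "x \<in> carrier M" "y \<in> carrier M"
  shows "N +>\<^bsub>M\<^esub> x = N +>\<^bsub>M\<^esub> y \<longleftrightarrow> x \<ominus>\<^bsub>M\<^esub> y \<in> N"
proof -
  interpret S: abelian_subgroup N M by (rule abelian_subgroup)
  show ?thesis
  proof
    assume "N +>\<^bsub>M\<^esub> x = N +>\<^bsub>M\<^esub> y"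
    then have "x \<in> N +>\<^bsub>M\<^esub> y" using S.a_rcos_self[OF assms(1)] by simp
    then show "x \<ominus>\<^bsub>M\<^esub> y \<in> N" using S.a_rcos_module[OF assms(2,1)] by (simp add: M.minus_eq)
  next
    assume "x \<ominus>\<^bsub>M\<^esub> y \<in> N"
    then have "x \<in> N +>\<^bsub>M\<^esub> y" using S.a_rcos_module[OF assms(2,1)] by (simp add: M.minus_eq)
    then show "N +>\<^bsub>M\<^esub> x = N +>\<^bsub>M\<^esub> y" using S.a_repr_independence'[OF _ assms(2)] by simp
  qed
qed

lemma coset_eq_zero_iff: "x \<in> carrier M \<Longrightarrow> N +>\<^bsub>M\<^esub> x = N \<longleftrightarrow> x \<in> N"
proof -
  interpret S: abelian_subgroup N M by (rule abelian_subgroup)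
  assume "x \<in> carrier M"
  then show ?thesis using S.a_rcos_const[of x] S.a_rcos_self[of x] by auto
qed

lemma add_Q: "x \<in> carrier M \<Longrightarrow> y \<in> carrier M \<Longrightarrow>
    (N +>\<^bsub>M\<^esub> x) \<oplus>\<^bsub>Q\<^esub> (N +>\<^bsub>M\<^esub> y) = N +>\<^bsub>M\<^esub> (x \<oplus>\<^bsub>M\<^esub> y)"
  using abelian_subgroup.a_rcos_sum[OF abelian_subgroup, of x y] by (simp add: quot_module_def)

lemma smult_Q:
  assumes r: "r \<in> carrier R" and x: "x \<in> carrier M"
  shows "r \<odot>\<^bsub>Q\<^esub> (N +>\<^bsub>M\<^esub> x) = N +>\<^bsub>M\<^esub> (r \<odot>\<^bsub>M\<^esub> x)"
proof -
  interpret S: abelian_subgroup N M by (rule abelian_subgroup)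
  have sub: "N +>\<^bsub>M\<^esub> x \<subseteq> carrier M"
    using x submoduleE(1)[OF submodule] by (rule M.a_r_coset_subset_G[rotated])
  have "N +>\<^bsub>M\<^esub> (r \<odot>\<^bsub>M\<^esub> y) = N +>\<^bsub>M\<^esub> (r \<odot>\<^bsub>M\<^esub> x)" if y: "y \<in> N +>\<^bsub>M\<^esub> x" for y
  proof -
    obtain h where h: "h \<in> N" "y = h \<oplus>\<^bsub>M\<^esub> x" using y by (auto simp: a_r_coset_def')
    have hM: "h \<in> carrier M" using h in_carrier by blast
    have rh: "r \<odot>\<^bsub>M\<^esub> h \<in> N" using submoduleE(4)[OF submodule r h(1)] .
    have "r \<odot>\<^bsub>M\<^esub> y \<ominus>\<^bsub>M\<^esub> r \<odot>\<^bsub>M\<^esub> x = r \<odot>\<^bsub>M\<^esub> h"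
      using r x hM unfolding h(2) by (simp add: smult_r_distr M.minus_eq M.a_assoc M.r_neg)
    moreover have "y \<in> carrier M" using y sub by blast
    ultimately show ?thesis
      using coset_eq_iff[of "r \<odot>\<^bsub>M\<^esub> y" "r \<odot>\<^bsub>M\<^esub> x"] rh r x by simp
  qed
  moreover have "x \<in> N +>\<^bsub>M\<^esub> x" using S.a_rcos_self x by blast
  ultimately have "(\<Union>y\<in>N +>\<^bsub>M\<^esub> x. N +>\<^bsub>M\<^esub> (r \<odot>\<^bsub>M\<^esub> y)) = N +>\<^bsub>M\<^esub> (r \<odot>\<^bsub>M\<^esub> x)" by blast
  then show ?thesis by (simp add: quot_module_def)
qed

lemma abelian_monoid_Q: "abelian_monoid Q"
proof (rule abelian_monoidI)
  fix X Y Z assume "X \<in> carrier Q" "Y \<in> carrier Q" "Z \<in> carrier Q"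
  then obtain x y z where x: "x \<in> carrier M" "X = N +>\<^bsub>M\<^esub> x" and y: "y \<in> carrier M" "Y = N +>\<^bsub>M\<^esub> y"
      and z: "z \<in> carrier M" "Z = N +>\<^bsub>M\<^esub> z"
    unfolding carrier_Q by blast
  show "(X \<oplus>\<^bsub>Q\<^esub> Y) \<oplus>\<^bsub>Q\<^esub> Z = X \<oplus>\<^bsub>Q\<^esub> (Y \<oplus>\<^bsub>Q\<^esub> Z)"
    using x(1) y(1) z(1) unfolding x(2) y(2) z(2) by (simp add: add_Q M.a_assoc)
next
  fix X Y assume "X \<in> carrier Q" "Y \<in> carrier Q"
  then obtain x y where x: "x \<in> carrier M" "X = N +>\<^bsub>M\<^esub> x" and y: "y \<in> carrier M" "Y = N +>\<^bsub>M\<^esub> y"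
    unfolding carrier_Q by blast
  have XY: "X \<oplus>\<^bsub>Q\<^esub> Y = N +>\<^bsub>M\<^esub> (x \<oplus>\<^bsub>M\<^esub> y)" "Y \<oplus>\<^bsub>Q\<^esub> X = N +>\<^bsub>M\<^esub> (y \<oplus>\<^bsub>M\<^esub> x)"
    using x(1) y(1) unfolding x(2) y(2) by (simp_all add: add_Q)
  then show "X \<oplus>\<^bsub>Q\<^esub> Y = Y \<oplus>\<^bsub>Q\<^esub> X" using M.a_comm[OF x(1) y(1)] by simp
  show "X \<oplus>\<^bsub>Q\<^esub> Y \<in> carrier Q" unfolding XY(1) carrier_Q using x(1) y(1) by blast
next
  have N: "N +>\<^bsub>M\<^esub> \<zero>\<^bsub>M\<^esub> = N"
    using coset_eq_zero_iff[of "\<zero>\<^bsub>M\<^esub>"] additive_subgroup.zero_closed[OF abelian_subgroup.axioms(1)[OF abelian_subgroup]]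
    by simp
  then show "\<zero>\<^bsub>Q\<^esub> \<in> carrier Q" unfolding zero_Q carrier_Q by blast
  fix X assume "X \<in> carrier Q"
  then obtain x where x: "x \<in> carrier M" "X = N +>\<^bsub>M\<^esub> x" unfolding carrier_Q by blast
  show "\<zero>\<^bsub>Q\<^esub> \<oplus>\<^bsub>Q\<^esub> X = X"
    using add_Q[of "\<zero>\<^bsub>M\<^esub>" x] N x by (simp add: zero_Q)
qed

end

lemma (in module) submodule_by_add_smult:
  assumes "H \<subseteq> carrier M" "\<zero>\<^bsub>M\<^esub> \<in> H" "\<And>a b. a \<in> H \<Longrightarrow> b \<in> H \<Longrightarrow> a \<oplus>\<^bsub>M\<^esub> b \<in> H"
    "\<And>a x. a \<in> carrier R \<Longrightarrow> x \<in> H \<Longrightarrow> a \<odot>\<^bsub>M\<^esub> x \<in> H"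
  shows "submodule H R M"
proof (rule submoduleI)
  fix a assume a: "a \<in> H"
  then have "(\<ominus>\<^bsub>R\<^esub> \<one>\<^bsub>R\<^esub>) \<odot>\<^bsub>M\<^esub> a \<in> H" using assms by simp
  moreover have "(\<ominus>\<^bsub>R\<^esub> \<one>\<^bsub>R\<^esub>) \<odot>\<^bsub>M\<^esub> a = \<ominus>\<^bsub>M\<^esub> a" using a assms(1) by (subst smult_l_minus) auto
  ultimately show "\<ominus>\<^bsub>M\<^esub> a \<in> H" by simp
qed (use assms in auto)

section \<open>Powers of a module and cochains\<close>

text \<open>
  Power modules and quotient modules are formed only for module records without additional
  fields.
\<close>

locale plain_module = module R M
  for R :: "('a, 'b) ring_scheme" (structure) and M :: "('a, 'c) module" (structure)
begin

lemma power_module_simps [simp]: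
  "v \<oplus>\<^bsub>power_module M q\<^esub> w = (\<lambda>j\<in>{..<q}. v j \<oplus>\<^bsub>M\<^esub> w j)"
  "r \<odot>\<^bsub>power_module M q\<^esub> v = (\<lambda>j\<in>{..<q}. r \<odot>\<^bsub>M\<^esub> v j)"
  "\<zero>\<^bsub>power_module M q\<^esub> = (\<lambda>j\<in>{..<q}. \<zero>\<^bsub>M\<^esub>)"
  "carrier (power_module M q) = {..<q} \<rightarrow>\<^sub>E carrier M"
  by (simp_all add: power_module_def)

lemma module_power: "module R (power_module M q)"
proof -
  let ?P = "power_module M q"
  have mem: "v j \<in> carrier M" if "v \<in> carrier ?P" "j < q" for v j
    using that by auto
  have closed: "(\<lambda>j\<in>{..<q}. f j) \<in> carrier ?P" if "\<And>j. j < q \<Longrightarrow> f j \<in> carrier M" for f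
    using that by auto
  have eqI: "(\<lambda>j\<in>{..<q}. f j) = (\<lambda>j\<in>{..<q}. g j)" if "\<And>j. j < q \<Longrightarrow> f j = g j" for f g :: "nat \<Rightarrow> 'c"
    using that by (intro restrict_ext) simp
  have idI: "(\<lambda>j\<in>{..<q}. f j) = v" if "v \<in> carrier ?P" "\<And>j. j < q \<Longrightarrow> f j = v j" for f v
    using that by (intro PiE_ext[of _ "{..<q}" "\<lambda>_. carrier M"]) auto
  have "abelian_group ?P"
  proof (rule abelian_groupI)
    show "v \<oplus>\<^bsub>?P\<^esub> w \<in> carrier ?P" if "v \<in> carrier ?P" "w \<in> carrier ?P" for v w
      unfolding power_module_simps(1) using mem that by (intro closed) simp
    show "\<zero>\<^bsub>?P\<^esub> \<in> carrier ?P" unfolding power_module_simps(3) by (intro closed) simp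
    show "(u \<oplus>\<^bsub>?P\<^esub> v) \<oplus>\<^bsub>?P\<^esub> w = u \<oplus>\<^bsub>?P\<^esub> (v \<oplus>\<^bsub>?P\<^esub> w)"
      if "u \<in> carrier ?P" "v \<in> carrier ?P" "w \<in> carrier ?P" for u v w
      unfolding power_module_simps(1) using mem[OF that(1)] mem[OF that(2)] mem[OF that(3)]
      by (intro eqI) (simp add: M.a_assoc)
    show "v \<oplus>\<^bsub>?P\<^esub> w = w \<oplus>\<^bsub>?P\<^esub> v" if "v \<in> carrier ?P" "w \<in> carrier ?P" for v w
      unfolding power_module_simps(1) using mem[OF that(1)] mem[OF that(2)]
      by (intro eqI) (simp add: M.a_comm)
    show "\<zero>\<^bsub>?P\<^esub> \<oplus>\<^bsub>?P\<^esub> v = v" if "v \<in> carrier ?P" for v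
      unfolding power_module_simps(1,3) using mem[OF that] by (intro idI[OF that]) simp
    show "\<exists>w\<in>carrier ?P. w \<oplus>\<^bsub>?P\<^esub> v = \<zero>\<^bsub>?P\<^esub>" if "v \<in> carrier ?P" for v
    proof (rule bexI[of _ "\<lambda>j\<in>{..<q}. \<ominus>\<^bsub>M\<^esub> v j"])
      show "(\<lambda>j\<in>{..<q}. \<ominus>\<^bsub>M\<^esub> v j) \<oplus>\<^bsub>?P\<^esub> v = \<zero>\<^bsub>?P\<^esub>"
        unfolding power_module_simps(1,3) using mem[OF that] by (intro eqI) (simp add: M.l_neg)
      show "(\<lambda>j\<in>{..<q}. \<ominus>\<^bsub>M\<^esub> v j) \<in> carrier ?P" using mem[OF that] by (intro closed) simp
    qed
  qed
  then show ?thesis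
  proof (rule moduleI[OF R.cring_axioms])
    show "r \<odot>\<^bsub>?P\<^esub> v \<in> carrier ?P" if r: "r \<in> carrier R" and v: "v \<in> carrier ?P" for r v
      unfolding power_module_simps(2) using mem[OF v] r by (intro closed) simp
    show "(r \<oplus>\<^bsub>R\<^esub> s) \<odot>\<^bsub>?P\<^esub> v = r \<odot>\<^bsub>?P\<^esub> v \<oplus>\<^bsub>?P\<^esub> s \<odot>\<^bsub>?P\<^esub> v" if r: "r \<in> carrier R" and s: "s \<in> carrier R" and v: "v \<in> carrier ?P" for r s v
      unfolding power_module_simps(1,2) using mem[OF v] r s by (intro eqI) (simp add: smult_l_distr)
    show "r \<odot>\<^bsub>?P\<^esub> (v \<oplus>\<^bsub>?P\<^esub> w) = r \<odot>\<^bsub>?P\<^esub> v \<oplus>\<^bsub>?P\<^esub> r \<odot>\<^bsub>?P\<^esub> w" if r: "r \<in> carrier R" and v: "v \<in> carrier ?P" and w: "w \<in> carrier ?P" for r v w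
      unfolding power_module_simps(1,2) using mem[OF v] mem[OF w] r by (intro eqI) (simp add: smult_r_distr)
    show "(r \<otimes>\<^bsub>R\<^esub> s) \<odot>\<^bsub>?P\<^esub> v = r \<odot>\<^bsub>?P\<^esub> (s \<odot>\<^bsub>?P\<^esub> v)" if r: "r \<in> carrier R" and s: "s \<in> carrier R" and v: "v \<in> carrier ?P" for r s v
      unfolding power_module_simps(2) using mem[OF v] r s by (intro eqI) (simp add: smult_assoc1)
    show "\<one>\<^bsub>R\<^esub> \<odot>\<^bsub>?P\<^esub> v = v" if v: "v \<in> carrier ?P" for v
      unfolding power_module_simps(2) using mem[OF v] by (intro idI[OF v]) simp
  qed
qed

lemma mat_map_add:
  assumes "\<And>l j. l < q \<Longrightarrow> j < p \<Longrightarrow> A l j \<in> carrier R"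
    and "\<And>j. j < p \<Longrightarrow> v j \<in> carrier M" "\<And>j. j < p \<Longrightarrow> w j \<in> carrier M"
  shows "mat_map M p q A (\<lambda>j\<in>{..<p}. v j \<oplus>\<^bsub>M\<^esub> w j) = (\<lambda>l\<in>{..<q}. mat_map M p q A v l \<oplus>\<^bsub>M\<^esub> mat_map M p q A w l)"
proof
  fix l
  have "(\<Oplus>\<^bsub>M\<^esub>j\<in>{..<p}. A l j \<odot>\<^bsub>M\<^esub> (\<lambda>j\<in>{..<p}. v j \<oplus>\<^bsub>M\<^esub> w j) j) =
     (\<Oplus>\<^bsub>M\<^esub>j\<in>{..<p}. A l j \<odot>\<^bsub>M\<^esub> v j \<oplus>\<^bsub>M\<^esub> A l j \<odot>\<^bsub>M\<^esub> w j)" if "l < q"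
    by (rule M.finsum_cong') (use assms that in \<open>auto simp: smult_r_distr\<close>)
  then show "mat_map M p q A (\<lambda>j\<in>{..<p}. v j \<oplus>\<^bsub>M\<^esub> w j) l = (\<lambda>l\<in>{..<q}. mat_map M p q A v l \<oplus>\<^bsub>M\<^esub> mat_map M p q A w l) l"
    using assms by (auto simp: mat_map_def Pi_def intro!: M.finsum_addf)
qed

lemma mat_map_smult:
  assumes "\<And>l j. l < q \<Longrightarrow> j < p \<Longrightarrow> A l j \<in> carrier R"
    and "\<And>j. j < p \<Longrightarrow> v j \<in> carrier M" "r \<in> carrier R"
  shows "mat_map M p q A (\<lambda>j\<in>{..<p}. r \<odot>\<^bsub>M\<^esub> v j) = (\<lambda>l\<in>{..<q}. r \<odot>\<^bsub>M\<^esub> mat_map M p q A v l)"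
proof
  fix l
  have "(\<Oplus>\<^bsub>M\<^esub>j\<in>{..<p}. A l j \<odot>\<^bsub>M\<^esub> (\<lambda>j\<in>{..<p}. r \<odot>\<^bsub>M\<^esub> v j) j) =
     (\<Oplus>\<^bsub>M\<^esub>j\<in>{..<p}. r \<odot>\<^bsub>M\<^esub> (A l j \<odot>\<^bsub>M\<^esub> v j))" if "l < q"
    by (rule M.finsum_cong') (use assms that in \<open>auto simp: smult_assoc1[symmetric] R.m_comm\<close>)
  then show "mat_map M p q A (\<lambda>j\<in>{..<p}. r \<odot>\<^bsub>M\<^esub> v j) l = (\<lambda>l\<in>{..<q}. r \<odot>\<^bsub>M\<^esub> mat_map M p q A v l) l"
    using assms by (auto simp: mat_map_def Pi_def finsum_smult_ldistr)
qed

lemma cocyclesD: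
  assumes "v \<in> cocycles b D M i"
  shows "j < b i \<Longrightarrow> v j \<in> carrier M"
    and "l < b (Suc i) \<Longrightarrow> mat_map M (b i) (b (Suc i)) (\<lambda>l j. D i j l) v l = \<zero>\<^bsub>M\<^esub>"
proof -
  show "j < b i \<Longrightarrow> v j \<in> carrier M" using assms by (auto simp: cocycles_def)
  have "mat_map M (b i) (b (Suc i)) (\<lambda>l j. D i j l) v = (\<lambda>l\<in>{..<b (Suc i)}. \<zero>\<^bsub>M\<^esub>)"
    using assms by (simp add: cocycles_def coboundary_def)
  then show "l < b (Suc i) \<Longrightarrow> mat_map M (b i) (b (Suc i)) (\<lambda>l j. D i j l) v l = \<zero>\<^bsub>M\<^esub>" by simp
qed

lemma cocyclesI:
  assumes "\<And>j. j < b i \<Longrightarrow> f j \<in> carrier M"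
    and "mat_map M (b i) (b (Suc i)) (\<lambda>l j. D i j l) (\<lambda>j\<in>{..<b i}. f j) = (\<lambda>l\<in>{..<b (Suc i)}. \<zero>\<^bsub>M\<^esub>)"
  shows "(\<lambda>j\<in>{..<b i}. f j) \<in> cocycles b D M i"
proof -
  have "(\<lambda>j\<in>{..<b i}. f j) \<in> {..<b i} \<rightarrow>\<^sub>E carrier M" using assms(1) by auto
  then show ?thesis using assms(2) unfolding cocycles_def coboundary_def by blast
qed

lemma submodule_cocycles:
  assumes D: "\<And>j l. j < b i \<Longrightarrow> l < b (Suc i) \<Longrightarrow> D i j l \<in> carrier R"
  shows "submodule (cocycles b D M i) R (power_module M (b i))"
proof -
  interpret P: module R "power_module M (b i)" by (rule module_power)
  let ?\<delta> = "mat_map M (b i) (b (Suc i)) (\<lambda>l j. D i j l)"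
  have zero: "?\<delta> (\<lambda>j\<in>{..<b i}. \<zero>\<^bsub>M\<^esub>) = (\<lambda>l\<in>{..<b (Suc i)}. \<zero>\<^bsub>M\<^esub>)"
  proof
    fix l
    have "(\<Oplus>\<^bsub>M\<^esub>j\<in>{..<b i}. D i j l \<odot>\<^bsub>M\<^esub> (\<lambda>j\<in>{..<b i}. \<zero>\<^bsub>M\<^esub>) j) = (\<Oplus>\<^bsub>M\<^esub>j\<in>{..<b i}. \<zero>\<^bsub>M\<^esub>)" if "l < b (Suc i)"
      by (rule M.finsum_cong') (use D that in auto)
    then show "?\<delta> (\<lambda>j\<in>{..<b i}. \<zero>\<^bsub>M\<^esub>) l = (\<lambda>l\<in>{..<b (Suc i)}. \<zero>\<^bsub>M\<^esub>) l"
      by (auto simp: mat_map_def)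
  qed
  show ?thesis
  proof (rule P.submodule_by_add_smult)
    show "cocycles b D M i \<subseteq> carrier (power_module M (b i))"
      by (auto simp: cocycles_def power_module_def)
    show "\<zero>\<^bsub>power_module M (b i)\<^esub> \<in> cocycles b D M i"
      unfolding power_module_simps by (rule cocyclesI) (simp_all add: zero)
    show "v \<oplus>\<^bsub>power_module M (b i)\<^esub> w \<in> cocycles b D M i" if v: "v \<in> cocycles b D M i" and w: "w \<in> cocycles b D M i" for v w
    proof -
      have "?\<delta> (\<lambda>j\<in>{..<b i}. v j \<oplus>\<^bsub>M\<^esub> w j) = (\<lambda>l\<in>{..<b (Suc i)}. ?\<delta> v l \<oplus>\<^bsub>M\<^esub> ?\<delta> w l)"
        using D cocyclesD(1)[OF v] cocyclesD(1)[OF w] by (intro mat_map_add) simp_all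
      also have "\<dots> = (\<lambda>l\<in>{..<b (Suc i)}. \<zero>\<^bsub>M\<^esub>)"
        using cocyclesD(2)[OF v] cocyclesD(2)[OF w] by (intro restrict_ext) simp
      finally show ?thesis
        unfolding power_module_simps using cocyclesD(1)[OF v] cocyclesD(1)[OF w] by (intro cocyclesI) simp_all
    qed
    show "r \<odot>\<^bsub>power_module M (b i)\<^esub> v \<in> cocycles b D M i" if r: "r \<in> carrier R" and v: "v \<in> cocycles b D M i" for r v
    proof -
      have "?\<delta> (\<lambda>j\<in>{..<b i}. r \<odot>\<^bsub>M\<^esub> v j) = (\<lambda>l\<in>{..<b (Suc i)}. r \<odot>\<^bsub>M\<^esub> ?\<delta> v l)"
        using D cocyclesD(1)[OF v] r by (intro mat_map_smult) simp_all
      also have "\<dots> = (\<lambda>l\<in>{..<b (Suc i)}. \<zero>\<^bsub>M\<^esub>)"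
        using cocyclesD(2)[OF v] r by (intro restrict_ext) simp
      finally show ?thesis
        unfolding power_module_simps using cocyclesD(1)[OF v] r by (intro cocyclesI) simp_all
    qed
  qed
qed

lemma module_cocycles:
  assumes "\<And>j l. j < b i \<Longrightarrow> l < b (Suc i) \<Longrightarrow> D i j l \<in> carrier R"
  shows "module R (cocycle_module b D M i)"
  unfolding cocycle_module_def
  by (rule submodule.submodule_is_module[OF submodule_cocycles module_power]) (rule assms)

lemma cocycle_module_simps:
  "v \<oplus>\<^bsub>cocycle_module b D M i\<^esub> w = (\<lambda>j\<in>{..<b i}. v j \<oplus>\<^bsub>M\<^esub> w j)"
  "r \<odot>\<^bsub>cocycle_module b D M i\<^esub> v = (\<lambda>j\<in>{..<b i}. r \<odot>\<^bsub>M\<^esub> v j)"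
  "\<zero>\<^bsub>cocycle_module b D M i\<^esub> = (\<lambda>j\<in>{..<b i}. \<zero>\<^bsub>M\<^esub>)"
  "carrier (cocycle_module b D M i) = cocycles b D M i"
  by (simp_all add: cocycle_module_def power_module_def)

lemma coboundaries_simps:
  "coboundaries b D M 0 = {\<lambda>j\<in>{..<b 0}. \<zero>\<^bsub>M\<^esub>}"
  "coboundaries b D M (Suc k) = coboundary b D M k ` ({..<b k} \<rightarrow>\<^sub>E carrier M)"
  by (simp_all add: coboundaries_def)

lemma submodule_coboundaries:
  assumes D: "\<And>i j l. j < b i \<Longrightarrow> l < b (Suc i) \<Longrightarrow> D i j l \<in> carrier R"
    and sub: "coboundaries b D M i \<subseteq> cocycles b D M i"
  shows "submodule (coboundaries b D M i) R (cocycle_module b D M i)"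
proof -
  interpret Z: module R "cocycle_module b D M i" by (rule module_cocycles) (rule D)
  show ?thesis
  proof (rule Z.submodule_by_add_smult)
    show "coboundaries b D M i \<subseteq> carrier (cocycle_module b D M i)"
      using sub by (simp add: cocycle_module_simps)
    show "\<zero>\<^bsub>cocycle_module b D M i\<^esub> \<in> coboundaries b D M i"
    proof (cases i)
      case 0
      then show ?thesis by (simp add: cocycle_module_simps coboundaries_simps)
    next
      case (Suc k)
      have "mat_map M (b k) (b i) (\<lambda>l j. D k j l) (\<lambda>j\<in>{..<b k}. \<zero>\<^bsub>M\<^esub>) = (\<lambda>l\<in>{..<b i}. \<zero>\<^bsub>M\<^esub>)"
      proof
        fix l
        have "(\<Oplus>\<^bsub>M\<^esub>j\<in>{..<b k}. D k j l \<odot>\<^bsub>M\<^esub> (\<lambda>j\<in>{..<b k}. \<zero>\<^bsub>M\<^esub>) j) = (\<Oplus>\<^bsub>M\<^esub>j\<in>{..<b k}. \<zero>\<^bsub>M\<^esub>)" if "l < b i"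
          by (rule M.finsum_cong') (use D[of _ k] that Suc in auto)
        then show "mat_map M (b k) (b i) (\<lambda>l j. D k j l) (\<lambda>j\<in>{..<b k}. \<zero>\<^bsub>M\<^esub>) l = (\<lambda>l\<in>{..<b i}. \<zero>\<^bsub>M\<^esub>) l"
          by (auto simp: mat_map_def)
      qed
      moreover have "(\<lambda>j\<in>{..<b k}. \<zero>\<^bsub>M\<^esub>) \<in> {..<b k} \<rightarrow>\<^sub>E carrier M" by auto
      ultimately have "(\<lambda>l\<in>{..<b i}. \<zero>\<^bsub>M\<^esub>) \<in> coboundary b D M k ` ({..<b k} \<rightarrow>\<^sub>E carrier M)"
        unfolding coboundary_def Suc by (rule image_eqI[OF sym])
      then show ?thesis by (simp add: Suc cocycle_module_simps coboundaries_simps)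
    qed
    show "v \<oplus>\<^bsub>cocycle_module b D M i\<^esub> w \<in> coboundaries b D M i"
      if v: "v \<in> coboundaries b D M i" and w: "w \<in> coboundaries b D M i" for v w
    proof (cases i)
      case 0
      then have "v = (\<lambda>j\<in>{..<b 0}. \<zero>\<^bsub>M\<^esub>)" "w = (\<lambda>j\<in>{..<b 0}. \<zero>\<^bsub>M\<^esub>)"
        using v w by (simp_all add: coboundaries_simps)
      then show ?thesis unfolding 0 cocycle_module_simps coboundaries_simps by (auto intro!: restrict_ext)
    next
      case (Suc k)
      then obtain v' w' where v': "v = coboundary b D M k v'" "v' \<in> {..<b k} \<rightarrow>\<^sub>E carrier M"
          and w': "w = coboundary b D M k w'" "w' \<in> {..<b k} \<rightarrow>\<^sub>E carrier M"
        using v w by (auto simp: coboundaries_simps)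
      have "coboundary b D M k (\<lambda>j\<in>{..<b k}. v' j \<oplus>\<^bsub>M\<^esub> w' j) = (\<lambda>l\<in>{..<b (Suc k)}. v l \<oplus>\<^bsub>M\<^esub> w l)"
        unfolding coboundary_def v'(1) w'(1)
        by (intro mat_map_add) (use D v' w' in auto)
      moreover have "(\<lambda>j\<in>{..<b k}. v' j \<oplus>\<^bsub>M\<^esub> w' j) \<in> {..<b k} \<rightarrow>\<^sub>E carrier M" using v' w' by auto
      ultimately have "(\<lambda>l\<in>{..<b (Suc k)}. v l \<oplus>\<^bsub>M\<^esub> w l) \<in> coboundary b D M k ` ({..<b k} \<rightarrow>\<^sub>E carrier M)"
        by (rule image_eqI[OF sym])
      then show ?thesis by (simp add: Suc cocycle_module_simps coboundaries_simps)
    qed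
    show "r \<odot>\<^bsub>cocycle_module b D M i\<^esub> v \<in> coboundaries b D M i"
      if r: "r \<in> carrier R" and v: "v \<in> coboundaries b D M i" for r v
    proof (cases i)
      case 0
      then have "v = (\<lambda>j\<in>{..<b 0}. \<zero>\<^bsub>M\<^esub>)" using v by (simp add: coboundaries_simps)
      then show ?thesis
        unfolding 0 cocycle_module_simps coboundaries_simps using r by (auto intro!: restrict_ext)
    next
      case (Suc k)
      then obtain v' where v': "v = coboundary b D M k v'" "v' \<in> {..<b k} \<rightarrow>\<^sub>E carrier M"
        using v by (auto simp: coboundaries_simps)
      have "coboundary b D M k (\<lambda>j\<in>{..<b k}. r \<odot>\<^bsub>M\<^esub> v' j) = (\<lambda>l\<in>{..<b (Suc k)}. r \<odot>\<^bsub>M\<^esub> v l)"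
        unfolding coboundary_def v'(1)
        by (intro mat_map_smult) (use D v' r in auto)
      moreover have "(\<lambda>j\<in>{..<b k}. r \<odot>\<^bsub>M\<^esub> v' j) \<in> {..<b k} \<rightarrow>\<^sub>E carrier M" using v' r by auto
      ultimately have "(\<lambda>l\<in>{..<b (Suc k)}. r \<odot>\<^bsub>M\<^esub> v l) \<in> coboundary b D M k ` ({..<b k} \<rightarrow>\<^sub>E carrier M)"
        by (rule image_eqI[OF sym])
      then show ?thesis by (simp add: Suc cocycle_module_simps coboundaries_simps)
    qed
  qed
qed

end

section \<open>Homogeneous components in a graded module\<close>

locale graded_module_over_ring = homogeneous_semigroup_ring S dg k_type
  for S dg and k_type :: "'k::field itself" +
  fixes W :: "(expo \<Rightarrow>\<^sub>0 'k, 'c) module" and gW :: "int \<Rightarrow> 'c set"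
  assumes graded_W: "graded_module RR (std_grading S) W gW"
begin

sublocale W: plain_module RR W
  using graded_W by (simp add: graded_module_def plain_module_def)

lemma gW_subgroup: "additive_subgroup (gW p) W"
  using graded_W by (simp add: graded_module_def)

lemma gW_closed: "w \<in> gW p \<Longrightarrow> w \<in> carrier W"
  using additive_subgroup.a_subset[OF gW_subgroup[of p]] by blast

lemma gW_zero: "\<zero>\<^bsub>W\<^esub> \<in> gW p"
  by (rule additive_subgroup.zero_closed[OF gW_subgroup])

lemma gW_add: "v \<in> gW p \<Longrightarrow> w \<in> gW p \<Longrightarrow> v \<oplus>\<^bsub>W\<^esub> w \<in> gW p"
  by (rule additive_subgroup.a_closed[OF gW_subgroup])

lemma gW_smult: "homog r p \<Longrightarrow> w \<in> gW q \<Longrightarrow> r \<odot>\<^bsub>W\<^esub> w \<in> gW (int p + q)"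
  using graded_W std_grading_iff[of r p] unfolding graded_module_def by blast

lemma smult_closed: "r \<in> R \<Longrightarrow> w \<in> carrier W \<Longrightarrow> r \<odot>\<^bsub>W\<^esub> w \<in> carrier W"
  using W.smult_closed[of r w] by simp

lemma smult_add_left: "r \<in> R \<Longrightarrow> s \<in> R \<Longrightarrow> w \<in> carrier W \<Longrightarrow> (r + s) \<odot>\<^bsub>W\<^esub> w = r \<odot>\<^bsub>W\<^esub> w \<oplus>\<^bsub>W\<^esub> s \<odot>\<^bsub>W\<^esub> w"
  using W.smult_l_distr[of r s w] by simp

lemma smult_assoc: "r \<in> R \<Longrightarrow> s \<in> R \<Longrightarrow> w \<in> carrier W \<Longrightarrow> (r * s) \<odot>\<^bsub>W\<^esub> w = r \<odot>\<^bsub>W\<^esub> (s \<odot>\<^bsub>W\<^esub> w)"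
  using W.smult_assoc1[of r s w] by simp

lemma smult_one: "w \<in> carrier W \<Longrightarrow> 1 \<odot>\<^bsub>W\<^esub> w = w"
  using W.smult_one[of w] by simp

lemma smult_zero: "w \<in> carrier W \<Longrightarrow> 0 \<odot>\<^bsub>W\<^esub> w = \<zero>\<^bsub>W\<^esub>"
  using W.smult_l_null[of w] by simp

definition decomposition :: "(int \<Rightarrow> 'c) \<Rightarrow> 'c \<Rightarrow> bool" where
  "decomposition c w \<longleftrightarrow>
     (\<forall>p. c p \<in> gW p) \<and> finite {p. c p \<noteq> \<zero>\<^bsub>W\<^esub>} \<and> w = finsum W c {p. c p \<noteq> \<zero>\<^bsub>W\<^esub>}"

text \<open>
  The homogeneous components of \<open>w\<close>, well defined because the decomposition is unique.
\<close>

definition comp :: "'c \<Rightarrow> int \<Rightarrow> 'c" where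
  "comp w = (THE c. decomposition c w)"

lemma decomposition_ex1: "w \<in> carrier W \<Longrightarrow> \<exists>!c. decomposition c w"
  using graded_W unfolding graded_module_def decomposition_def by blast

lemma decomposition_comp: "w \<in> carrier W \<Longrightarrow> decomposition (comp w) w"
  unfolding comp_def by (rule theI'[OF decomposition_ex1])

lemma comp_closed: "w \<in> carrier W \<Longrightarrow> comp w p \<in> gW p"
  using decomposition_comp by (simp add: decomposition_def)

lemma comp_carrier: "w \<in> carrier W \<Longrightarrow> comp w p \<in> carrier W"
  by (rule gW_closed[OF comp_closed])

lemma finsum_support:
  assumes "finite A" "\<And>p. p \<notin> A \<Longrightarrow> c p = \<zero>\<^bsub>W\<^esub>" "\<And>p. c p \<in> carrier W"
  shows "finsum W c A = finsum W c {p. c p \<noteq> \<zero>\<^bsub>W\<^esub>}"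
  by (rule W.add.finprod_mono_neutral_cong_right) (use assms in auto)

lemma comp_eqI:
  assumes w: "w \<in> carrier W" and c: "\<And>p. c p \<in> gW p"
    and A: "finite A" "\<And>p. p \<notin> A \<Longrightarrow> c p = \<zero>\<^bsub>W\<^esub>" and sum: "w = finsum W c A"
  shows "comp w = c"
proof -
  have "{p. c p \<noteq> \<zero>\<^bsub>W\<^esub>} \<subseteq> A" using A(2) by blast
  then have "finite {p. c p \<noteq> \<zero>\<^bsub>W\<^esub>}" using A(1) finite_subset by blast
  then have "decomposition c w"
    using finsum_support[OF A gW_closed[OF c]] c sum unfolding decomposition_def by simp
  then show ?thesis unfolding comp_def by (rule the1_equality[OF decomposition_ex1[OF w]])
qed

lemma comp_support:
  assumes w: "w \<in> carrier W"
  shows "\<exists>A. finite A \<and> (\<forall>p. p \<notin> A \<longrightarrow> comp w p = \<zero>\<^bsub>W\<^esub>) \<and> w = finsum W (comp w) A"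
  using decomposition_comp[OF w] unfolding decomposition_def by blast

lemma finsum_comp:
  assumes w: "w \<in> carrier W" and A: "finite A" "\<And>p. p \<notin> A \<Longrightarrow> comp w p = \<zero>\<^bsub>W\<^esub>"
  shows "finsum W (comp w) A = w"
  using finsum_support[OF A comp_carrier[OF w]] decomposition_comp[OF w] unfolding decomposition_def by simp

lemma comp_add:
  assumes v: "v \<in> carrier W" and w: "w \<in> carrier W"
  shows "comp (v \<oplus>\<^bsub>W\<^esub> w) p = comp v p \<oplus>\<^bsub>W\<^esub> comp w p"
proof -
  obtain A B where A: "finite A" "\<And>p. p \<notin> A \<Longrightarrow> comp v p = \<zero>\<^bsub>W\<^esub>"
      and B: "finite B" "\<And>p. p \<notin> B \<Longrightarrow> comp w p = \<zero>\<^bsub>W\<^esub>"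
    using comp_support[OF v] comp_support[OF w] by metis
  have "comp (v \<oplus>\<^bsub>W\<^esub> w) = (\<lambda>p. comp v p \<oplus>\<^bsub>W\<^esub> comp w p)"
  proof (rule comp_eqI[where A = "A \<union> B"])
    show "v \<oplus>\<^bsub>W\<^esub> w \<in> carrier W" using v w by simp
    show "comp v p \<oplus>\<^bsub>W\<^esub> comp w p \<in> gW p" for p by (intro gW_add comp_closed v w)
    show "finite (A \<union> B)" using A B by simp
    show "comp v p \<oplus>\<^bsub>W\<^esub> comp w p = \<zero>\<^bsub>W\<^esub>" if "p \<notin> A \<union> B" for p using A(2) B(2) that by simp
    have "finsum W (\<lambda>p. comp v p \<oplus>\<^bsub>W\<^esub> comp w p) (A \<union> B) = finsum W (comp v) (A \<union> B) \<oplus>\<^bsub>W\<^esub> finsum W (comp w) (A \<union> B)"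
      using comp_carrier[OF v] comp_carrier[OF w] by (intro W.finsum_addf) auto
    also have "finsum W (comp v) (A \<union> B) = v" using A B by (intro finsum_comp[OF v]) auto
    also have "finsum W (comp w) (A \<union> B) = w" using A B by (intro finsum_comp[OF w]) auto
    finally show "v \<oplus>\<^bsub>W\<^esub> w = finsum W (\<lambda>p. comp v p \<oplus>\<^bsub>W\<^esub> comp w p) (A \<union> B)" by simp
  qed
  then show ?thesis by simp
qed

lemma comp_zero: "comp \<zero>\<^bsub>W\<^esub> p = \<zero>\<^bsub>W\<^esub>"
proof -
  have "comp \<zero>\<^bsub>W\<^esub> = (\<lambda>_. \<zero>\<^bsub>W\<^esub>)"
    by (rule comp_eqI[where A = "{}"]) (simp_all add: gW_zero)
  then show ?thesis by simp
qed

lemma comp_smult: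
  assumes r: "homog r e" and w: "w \<in> carrier W"
  shows "comp (r \<odot>\<^bsub>W\<^esub> w) p = r \<odot>\<^bsub>W\<^esub> comp w (p - int e)"
proof -
  have rR: "r \<in> R" using r by (rule homogD)
  obtain A where A: "finite A" "\<And>p. p \<notin> A \<Longrightarrow> comp w p = \<zero>\<^bsub>W\<^esub>" "w = finsum W (comp w) A"
    using comp_support[OF w] by metis
  let ?f = "\<lambda>s. s + int e"
  have inj: "inj_on ?f A" by (auto simp: inj_on_def)
  have "comp (r \<odot>\<^bsub>W\<^esub> w) = (\<lambda>p. r \<odot>\<^bsub>W\<^esub> comp w (p - int e))"
  proof (rule comp_eqI[where A = "?f ` A"])
    show "r \<odot>\<^bsub>W\<^esub> w \<in> carrier W" by (rule smult_closed[OF rR w])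
    show "r \<odot>\<^bsub>W\<^esub> comp w (p - int e) \<in> gW p" for p
      using gW_smult[OF r comp_closed[OF w, of "p - int e"]] by simp
    show "finite (?f ` A)" using A by simp
    show "r \<odot>\<^bsub>W\<^esub> comp w (p - int e) = \<zero>\<^bsub>W\<^esub>" if "p \<notin> ?f ` A" for p
    proof -
      have "p - int e \<notin> A" using that by (metis diff_add_cancel image_eqI)
      then show ?thesis using A(2) W.smult_r_null[of r] rR by simp
    qed
    have "finsum W (\<lambda>p. r \<odot>\<^bsub>W\<^esub> comp w (p - int e)) (?f ` A) = finsum W (\<lambda>p. r \<odot>\<^bsub>W\<^esub> comp w (p + int e - int e)) A"
      by (rule W.finsum_reindex[OF _ inj]) (use smult_closed[OF rR] comp_carrier[OF w] in auto)
    also have "\<dots> = finsum W (\<lambda>p. r \<odot>\<^bsub>W\<^esub> comp w p) A" by simp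
    also have "\<dots> = r \<odot>\<^bsub>W\<^esub> finsum W (comp w) A"
      using A(1) rR comp_carrier[OF w] by (intro W.finsum_smult_ldistr[symmetric]) auto
    finally show "r \<odot>\<^bsub>W\<^esub> w = finsum W (\<lambda>p. r \<odot>\<^bsub>W\<^esub> comp w (p - int e)) (?f ` A)" using A(3) by simp
  qed
  then show ?thesis by simp
qed

lemma smult_sum:
  fixes n :: nat
  assumes "\<And>i. i < n \<Longrightarrow> f i \<in> R" "y \<in> carrier W"
  shows "(\<Sum>i<n. f i) \<odot>\<^bsub>W\<^esub> y = finsum W (\<lambda>i. f i \<odot>\<^bsub>W\<^esub> y) {..<n}"
  using assms(1)
proof (induction n)
  case 0
  then show ?case using smult_zero[OF assms(2)] by simp
next
  case (Suc n)
  have f: "f i \<in> R" if "i < Suc n" for i using Suc.prems that by blast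
  have s: "sum f {..<n} \<in> R" using f by (intro sum) simp
  have "(\<Sum>i<Suc n. f i) \<odot>\<^bsub>W\<^esub> y = f n \<odot>\<^bsub>W\<^esub> y \<oplus>\<^bsub>W\<^esub> (\<Sum>i<n. f i) \<odot>\<^bsub>W\<^esub> y"
    using smult_add_left[OF f[of n] s assms(2)] by (simp add: add.commute)
  also have "(\<Sum>i<n. f i) \<odot>\<^bsub>W\<^esub> y = finsum W (\<lambda>i. f i \<odot>\<^bsub>W\<^esub> y) {..<n}"
    using Suc.IH f by simp
  also have "f n \<odot>\<^bsub>W\<^esub> y \<oplus>\<^bsub>W\<^esub> finsum W (\<lambda>i. f i \<odot>\<^bsub>W\<^esub> y) {..<n} = finsum W (\<lambda>i. f i \<odot>\<^bsub>W\<^esub> y) (insert n {..<n})"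
    using f smult_closed[OF _ assms(2)] by (intro W.finsum_insert[symmetric]) auto
  also have "insert n {..<n} = {..<Suc n}" by (rule lessThan_Suc[symmetric])
  finally show ?case .
qed

lemma comp_smult_homog:
  assumes y: "y \<in> gW q" and a: "a \<in> R"
  shows "comp (a \<odot>\<^bsub>W\<^esub> y) p = (if p < q then \<zero>\<^bsub>W\<^esub> else pr (nat (p - q)) a \<odot>\<^bsub>W\<^esub> y)"
proof -
  have yW: "y \<in> carrier W" using y by (rule gW_closed)
  obtain n where n: "a = (\<Sum>p<n. pr p a)" using pr_sum[OF a] by blast
  let ?c = "\<lambda>p. if p < q then \<zero>\<^bsub>W\<^esub> else pr (nat (p - q)) a \<odot>\<^bsub>W\<^esub> y"
  let ?f = "\<lambda>i::nat. q + int i"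
  have cl: "pr i a \<odot>\<^bsub>W\<^esub> y \<in> carrier W" for i by (rule smult_closed[OF pr_closed[OF a] yW])
  have "comp (a \<odot>\<^bsub>W\<^esub> y) = ?c"
  proof (rule comp_eqI[where A = "?f ` {..<n}"])
    show "a \<odot>\<^bsub>W\<^esub> y \<in> carrier W" by (rule smult_closed[OF a yW])
    show "?c p \<in> gW p" for p
      using gW_smult[OF homog_pr[OF a, of "nat (p - q)"] y] gW_zero by auto
    show "finite (?f ` {..<n})" by simp
    show "?c p = \<zero>\<^bsub>W\<^esub>" if p: "p \<notin> ?f ` {..<n}" for p
    proof (cases "p < q")
      case False
      then have "p = ?f (nat (p - q))" by simp
      then have "\<not> nat (p - q) < n" using p by blast
      then have "pr (nat (p - q)) a = 0" using pr_vanish[OF a n] by simp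
      then show ?thesis using smult_zero[OF yW] by simp
    qed simp
    have "finsum W ?c (?f ` {..<n}) = finsum W (\<lambda>i. ?c (?f i)) {..<n}"
      by (rule W.finsum_reindex) (use cl in \<open>auto simp: inj_on_def\<close>)
    also have "\<dots> = finsum W (\<lambda>i. pr i a \<odot>\<^bsub>W\<^esub> y) {..<n}" by simp
    also have "\<dots> = (\<Sum>i<n. pr i a) \<odot>\<^bsub>W\<^esub> y"
      using pr_closed[OF a] yW by (intro smult_sum[symmetric]) auto
    finally show "a \<odot>\<^bsub>W\<^esub> y = finsum W ?c (?f ` {..<n})" using n by simp
  qed
  then show ?thesis by simp
qed

lemma comp_homog: "y \<in> gW q \<Longrightarrow> comp y p = (if p = q then y else \<zero>\<^bsub>W\<^esub>)"
proof -
  assume y: "y \<in> gW q"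
  have yW: "y \<in> carrier W" using y by (rule gW_closed)
  have "pr i 1 = (if i = 0 then 1 else 0)" for i using pr_homog[OF homog_one, of i] by simp
  then have "comp (1 \<odot>\<^bsub>W\<^esub> y) p = (if p = q then y else \<zero>\<^bsub>W\<^esub>)"
    unfolding comp_smult_homog[OF y one] using smult_one[OF yW] smult_zero[OF yW] by auto
  then show ?thesis using smult_one[OF yW] by simp
qed

section \<open>Minimal homogeneous generators\<close>

lemma smult_comp_mem:
  assumes U: "submodule U RR W" and a: "a \<in> R" and w: "w \<in> carrier W" "\<And>p. comp w p \<in> U"
  shows "comp (a \<odot>\<^bsub>W\<^esub> w) p \<in> U"
proof -
  obtain n where n: "a = (\<Sum>p<n. pr p a)" using pr_sum[OF a] by blast
  have "comp ((\<Sum>i<m. pr i a) \<odot>\<^bsub>W\<^esub> w) p \<in> U" for m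
  proof (induction m)
    case 0
    have "\<zero>\<^bsub>W\<^esub> \<in> U" using W.submoduleE(4)[OF U, of 0] w comp_carrier[OF w(1)] smult_zero zero by (metis carrier_semigroup_ring)
    then show ?case using smult_zero[OF w(1)] comp_zero by simp
  next
    case (Suc m)
    have s: "(\<Sum>i<m. pr i a) \<in> R" using pr_closed[OF a] by (intro sum)
    have "(\<Sum>i<Suc m. pr i a) \<odot>\<^bsub>W\<^esub> w = (\<Sum>i<m. pr i a) \<odot>\<^bsub>W\<^esub> w \<oplus>\<^bsub>W\<^esub> pr m a \<odot>\<^bsub>W\<^esub> w"
      using smult_add_left[OF s pr_closed[OF a] w(1)] by simp
    then have "comp ((\<Sum>i<Suc m. pr i a) \<odot>\<^bsub>W\<^esub> w) p =
        comp ((\<Sum>i<m. pr i a) \<odot>\<^bsub>W\<^esub> w) p \<oplus>\<^bsub>W\<^esub> pr m a \<odot>\<^bsub>W\<^esub> comp w (p - int m)"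
      using comp_add[OF smult_closed[OF s w(1)] smult_closed[OF pr_closed[OF a, of m] w(1)]]
        comp_smult[OF homog_pr[OF a, of m] w(1)] by simp
    moreover have "pr m a \<odot>\<^bsub>W\<^esub> comp w (p - int m) \<in> U"
      using W.submoduleE(4)[OF U] pr_closed[OF a] w(2) by simp
    ultimately show ?case using W.submoduleE(5)[OF U Suc.IH] by simp
  qed
  then show ?thesis using n by metis
qed

text \<open>
  The elements of \<open>U\<close> all of whose components lie in \<open>U\<close> form a submodule, and it contains \<open>G\<close>.
\<close>

lemma generated_by_homogeneous_graded:
  assumes G: "\<And>g. g \<in> G \<Longrightarrow> \<exists>p. g \<in> gW p"
    and U: "submodule U RR W" "G \<subseteq> U" "\<And>N. submodule N RR W \<Longrightarrow> G \<subseteq> N \<Longrightarrow> U \<subseteq> N"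
    and w: "w \<in> U"
  shows "comp w p \<in> U"
proof -
  have UW: "U \<subseteq> carrier W" by (rule W.submoduleE(1)[OF U(1)])
  have zeroU: "\<zero>\<^bsub>W\<^esub> \<in> U" using W.submoduleE(4)[OF U(1), of 0 w] w UW smult_zero zero by auto
  let ?V = "{w \<in> carrier W. \<forall>p. comp w p \<in> U}"
  have "submodule ?V RR W"
  proof (rule W.submodule_by_add_smult)
    show "?V \<subseteq> carrier W" by blast
    show "\<zero>\<^bsub>W\<^esub> \<in> ?V" using zeroU by (simp add: comp_zero)
    show "v \<oplus>\<^bsub>W\<^esub> w \<in> ?V" if "v \<in> ?V" "w \<in> ?V" for v w
      using that W.submoduleE(5)[OF U(1)] by (simp add: comp_add)
    show "a \<odot>\<^bsub>W\<^esub> w \<in> ?V" if "a \<in> carrier RR" "w \<in> ?V" for a w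
      using that smult_comp_mem[OF U(1), of a w] smult_closed[of a w] by simp
  qed
  moreover have "G \<subseteq> ?V"
  proof
    fix g assume g: "g \<in> G"
    then obtain q where "g \<in> gW q" using G by blast
    then show "g \<in> ?V" using g U(2) zeroU comp_homog[of g q] gW_closed by auto
  qed
  ultimately show ?thesis using U(3) w by blast
qed

lemma span_exists:
  assumes G: "G \<subseteq> carrier W"
  obtains U where "submodule U RR W" "G \<subseteq> U" "\<And>N. submodule N RR W \<Longrightarrow> G \<subseteq> N \<Longrightarrow> U \<subseteq> N"
proof -
  let ?U = "\<Inter>{N. submodule N RR W \<and> G \<subseteq> N}"
  have car: "submodule (carrier W) RR W" by (rule W.carrier_is_submodule)
  have z: "\<zero>\<^bsub>W\<^esub> \<in> N" if N: "submodule N RR W" for N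
  proof -
    obtain w where "w \<in> N" using W.submoduleE(2)[OF N] by blast
    then show ?thesis using W.submoduleE(4)[OF N, of 0 w] W.submoduleE(1)[OF N] smult_zero[of w] zero by auto
  qed
  have "submodule ?U RR W"
  proof (rule W.submodule_by_add_smult)
    show "?U \<subseteq> carrier W" using car G by blast
    show "\<zero>\<^bsub>W\<^esub> \<in> ?U" using z by blast
    show "v \<oplus>\<^bsub>W\<^esub> w \<in> ?U" if "v \<in> ?U" "w \<in> ?U" for v w
      using that W.submoduleE(5) by blast
    show "a \<odot>\<^bsub>W\<^esub> w \<in> ?U" if "a \<in> carrier RR" "w \<in> ?U" for a w
      using that W.submoduleE(4) by blast
  qed
  then show ?thesis using that by blast
qed

lemma submodule_add_cyclic:
  assumes U: "submodule U RR W" and y: "y \<in> carrier W"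
  shows "submodule {u \<oplus>\<^bsub>W\<^esub> a \<odot>\<^bsub>W\<^esub> y |u a. u \<in> U \<and> a \<in> R} RR W" (is "submodule ?V _ _")
proof (rule W.submodule_by_add_smult)
  have UW: "u \<in> carrier W" if "u \<in> U" for u using that W.submoduleE(1)[OF U] by blast
  obtain u0 where u0: "u0 \<in> U" using W.submoduleE(2)[OF U] by blast
  then have zU: "\<zero>\<^bsub>W\<^esub> \<in> U" using W.submoduleE(4)[OF U, of 0 u0] smult_zero[OF UW[OF u0]] zero by simp
  show "?V \<subseteq> carrier W" using UW smult_closed[OF _ y] by auto
  have "\<zero>\<^bsub>W\<^esub> = \<zero>\<^bsub>W\<^esub> \<oplus>\<^bsub>W\<^esub> 0 \<odot>\<^bsub>W\<^esub> y" using smult_zero[OF y] by simp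
  then show "\<zero>\<^bsub>W\<^esub> \<in> ?V" using zU zero by blast
  show "v \<oplus>\<^bsub>W\<^esub> w \<in> ?V" if vw: "v \<in> ?V" "w \<in> ?V" for v w
  proof -
    obtain u a u' a' where v: "v = u \<oplus>\<^bsub>W\<^esub> a \<odot>\<^bsub>W\<^esub> y" "u \<in> U" "a \<in> R" and w: "w = u' \<oplus>\<^bsub>W\<^esub> a' \<odot>\<^bsub>W\<^esub> y" "u' \<in> U" "a' \<in> R"
      using vw by blast
    have "v \<oplus>\<^bsub>W\<^esub> w = (u \<oplus>\<^bsub>W\<^esub> u') \<oplus>\<^bsub>W\<^esub> (a + a') \<odot>\<^bsub>W\<^esub> y"
      unfolding v(1) w(1) smult_add_left[OF v(3) w(3) y]
      using UW[OF v(2)] UW[OF w(2)] smult_closed[OF v(3) y] smult_closed[OF w(3) y]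
      by (simp add: W.M.a_ac)
    moreover have "u \<oplus>\<^bsub>W\<^esub> u' \<in> U" "a + a' \<in> R" using W.submoduleE(5)[OF U v(2) w(2)] add[OF v(3) w(3)] by auto
    ultimately show ?thesis by blast
  qed
  show "r \<odot>\<^bsub>W\<^esub> w \<in> ?V" if r: "r \<in> carrier RR" and w: "w \<in> ?V" for r w
  proof -
    obtain u a where w: "w = u \<oplus>\<^bsub>W\<^esub> a \<odot>\<^bsub>W\<^esub> y" "u \<in> U" "a \<in> R" using w by blast
    have "r \<odot>\<^bsub>W\<^esub> w = r \<odot>\<^bsub>W\<^esub> u \<oplus>\<^bsub>W\<^esub> (r * a) \<odot>\<^bsub>W\<^esub> y"
      using r w UW[OF w(2)] smult_closed[OF w(3) y] smult_assoc[of r a y] y by (simp add: W.smult_r_distr)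
    moreover have "r \<odot>\<^bsub>W\<^esub> u \<in> U" "r * a \<in> R" using W.submoduleE(4)[OF U r w(2)] mult[of r a] r w by auto
    ultimately show ?thesis by blast
  qed
qed

lemma generates_add_cyclic:
  assumes G: "generates RR W G" and y: "y \<in> carrier W" and U: "submodule U RR W" "G - {y} \<subseteq> U"
    and w: "w \<in> carrier W"
  shows "\<exists>u\<in>U. \<exists>a\<in>R. w = u \<oplus>\<^bsub>W\<^esub> a \<odot>\<^bsub>W\<^esub> y"
proof -
  let ?V = "{u \<oplus>\<^bsub>W\<^esub> a \<odot>\<^bsub>W\<^esub> y |u a. u \<in> U \<and> a \<in> R}"
  have UW: "u \<in> carrier W" if "u \<in> U" for u using that W.submoduleE(1)[OF U(1)] by blast
  obtain u0 where u0: "u0 \<in> U" using W.submoduleE(2)[OF U(1)] by blast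
  then have zU: "\<zero>\<^bsub>W\<^esub> \<in> U" using W.submoduleE(4)[OF U(1), of 0 u0] smult_zero[OF UW[OF u0]] zero by simp
  have "u \<in> ?V" if u: "u \<in> U" for u
  proof -
    have "u = u \<oplus>\<^bsub>W\<^esub> 0 \<odot>\<^bsub>W\<^esub> y" using smult_zero[OF y] UW[OF u] by simp
    then show ?thesis using u zero by blast
  qed
  moreover have "y \<in> ?V"
  proof -
    have "y = \<zero>\<^bsub>W\<^esub> \<oplus>\<^bsub>W\<^esub> 1 \<odot>\<^bsub>W\<^esub> y" using smult_one[OF y] y by simp
    then show ?thesis using zU one by blast
  qed
  ultimately have "G \<subseteq> ?V" using U(2) by blast
  then have "?V = carrier W" using G submodule_add_cyclic[OF U(1) y] unfolding generates_def by blast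
  then show ?thesis using w by blast
qed

lemma generates_two:
  assumes G: "generates RR W {y1, y2}" and w: "w \<in> carrier W"
  shows "\<exists>a\<in>R. \<exists>b\<in>R. w = a \<odot>\<^bsub>W\<^esub> y1 \<oplus>\<^bsub>W\<^esub> b \<odot>\<^bsub>W\<^esub> y2"
proof -
  have y: "y1 \<in> carrier W" "y2 \<in> carrier W" using G by (auto simp: generates_def)
  have z: "submodule {\<zero>\<^bsub>W\<^esub>} RR W" by (rule W.submodule_by_add_smult) auto
  let ?U = "{u \<oplus>\<^bsub>W\<^esub> a \<odot>\<^bsub>W\<^esub> y1 |u a. u \<in> {\<zero>\<^bsub>W\<^esub>} \<and> a \<in> R}"
  have "y1 = \<zero>\<^bsub>W\<^esub> \<oplus>\<^bsub>W\<^esub> 1 \<odot>\<^bsub>W\<^esub> y1" using smult_one[OF y(1)] y by simp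
  then have "y1 \<in> ?U" using one by blast
  then have "{y1, y2} - {y2} \<subseteq> ?U" by blast
  then obtain u b where u: "u \<in> ?U" "b \<in> R" "w = u \<oplus>\<^bsub>W\<^esub> b \<odot>\<^bsub>W\<^esub> y2"
    using generates_add_cyclic[OF G y(2) submodule_add_cyclic[OF z y(1)] _ w] by blast
  then obtain a where "a \<in> R" "u = \<zero>\<^bsub>W\<^esub> \<oplus>\<^bsub>W\<^esub> a \<odot>\<^bsub>W\<^esub> y1" by blast
  then show ?thesis using u smult_closed[OF _ y(1)] by auto
qed

end

text \<open>
  The coefficients are the entries of the cross product of the two vectors, unless it vanishes; then
  the vectors are proportional.
\<close>

lemma three_vectors_dependent:
  fixes a1 a2 a3 b1 b2 b3 :: "'k::field"
  shows "\<exists>m1 m2 m3. (m1 \<noteq> 0 \<or> m2 \<noteq> 0 \<or> m3 \<noteq> 0) \<and>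
    m1 * a1 + m2 * a2 + m3 * a3 = 0 \<and> m1 * b1 + m2 * b2 + m3 * b3 = 0"
proof -
  define c1 where "c1 = a2 * b3 - a3 * b2"
  define c2 where "c2 = a3 * b1 - a1 * b3"
  define c3 where "c3 = a1 * b2 - a2 * b1"
  show ?thesis
  proof (cases "c1 = 0 \<and> c2 = 0 \<and> c3 = 0")
    case False
    have "c1 * a1 + c2 * a2 + c3 * a3 = 0" "c1 * b1 + c2 * b2 + c3 * b3 = 0"
      by (simp_all add: c1_def c2_def c3_def algebra_simps)
    then show ?thesis using False by blast
  next
    case True
    then have eq: "a3 * b1 = a1 * b3" "a1 * b2 = a2 * b1" by (simp_all add: c2_def c3_def)
    consider "a1 \<noteq> 0 \<or> a2 \<noteq> 0" | "a1 = 0" "a2 = 0" "a3 \<noteq> 0" | "a1 = 0" "a2 = 0" "a3 = 0" by blast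
    then show ?thesis
    proof cases
      case 1
      then show ?thesis using eq by (intro exI[of _ "- a2"] exI[of _ a1] exI[of _ 0]) (auto simp: mult.commute)
    next
      case 2
      then show ?thesis using eq by (intro exI[of _ 1] exI[of _ 0] exI[of _ 0]) auto
    next
      case 3
      show ?thesis
      proof (cases "b1 = 0 \<and> b2 = 0")
        case True
        then show ?thesis using 3 by (intro exI[of _ 1] exI[of _ 0] exI[of _ 0]) auto
      next
        case False
        then show ?thesis using 3 by (intro exI[of _ "- b2"] exI[of _ b1] exI[of _ 0]) (auto simp: mult.commute)
      qed
    qed
  qed
qed

context graded_module_over_ring
begin

text \<open>
  If a multiple of \<open>g\<close> by an element with nonzero constant term is generated by the other
  generators, so is \<open>g\<close> itself: take the component in the degree of \<open>g\<close>.
\<close>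

lemma redundant_generator:
  assumes G: "G \<subseteq> (\<Union>p. gW p)" "generates RR W G" and g: "g \<in> G"
    and U: "submodule U RR W" "G - {g} \<subseteq> U" "\<And>N. submodule N RR W \<Longrightarrow> G - {g} \<subseteq> N \<Longrightarrow> U \<subseteq> N"
    and f: "f \<in> R" "f \<odot>\<^bsub>W\<^esub> g \<in> U" "pr 0 f \<noteq> 0"
  shows "generates RR W (G - {g})"
proof -
  obtain p where p: "g \<in> gW p" using G g by blast
  have gW: "g \<in> carrier W" using p by (rule gW_closed)
  have "comp (f \<odot>\<^bsub>W\<^esub> g) p \<in> U"
    by (rule generated_by_homogeneous_graded[where G = "G - {g}"]) (use G U f in blast)+
  then have "pr 0 f \<odot>\<^bsub>W\<^esub> g \<in> U" using comp_smult_homog[OF p f(1), of p] by simp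
  moreover obtain u where u: "u \<in> R" "pr 0 f * u = 1"
    using degree_0_unit[of "pr 0 f"] f by (auto simp: pr_closed pr_pr)
  ultimately have "u \<odot>\<^bsub>W\<^esub> (pr 0 f \<odot>\<^bsub>W\<^esub> g) \<in> U" using W.submoduleE(4)[OF U(1)] by simp
  then have gU: "g \<in> U"
    using smult_assoc[OF u(1) pr_closed[OF f(1)] gW, of 0] u(2) smult_one[OF gW] by (simp add: mult.commute)
  show ?thesis
    unfolding generates_def
  proof (intro conjI allI impI)
    show "G - {g} \<subseteq> carrier W" using G(2) by (auto simp: generates_def)
    fix N assume N: "submodule N RR W \<and> G - {g} \<subseteq> N"
    then have "G \<subseteq> N" using U(3)[of N] gU by blast
    then show "N = carrier W" using N G(2) unfolding generates_def by blast
  qed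
qed

lemma lookup_0_mult:
  assumes "f \<in> R" "g \<in> R"
  shows "Poly_Mapping.lookup (f * g) 0 = Poly_Mapping.lookup f 0 * Poly_Mapping.lookup g 0"
proof -
  have "Poly_Mapping.single (0::expo) (Poly_Mapping.lookup (f * g) 0) =
      Poly_Mapping.single (0::expo) (Poly_Mapping.lookup f 0) * Poly_Mapping.single (0::expo) (Poly_Mapping.lookup g 0)"
    using pr_0_mult[OF assms] pr_0_eq_single[OF mult[OF assms]] pr_0_eq_single[OF assms(1)] pr_0_eq_single[OF assms(2)]
    by simp
  then have "Poly_Mapping.lookup (Poly_Mapping.single (0::expo) (Poly_Mapping.lookup (f * g) 0)) 0 =
      Poly_Mapping.lookup (Poly_Mapping.single (0::expo) (Poly_Mapping.lookup f 0 * Poly_Mapping.lookup g 0)) 0"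
    by (simp only: mult_single add_0)
  then show ?thesis by simp
qed

text \<open>
  A case of graded Nakayama.  If a combination of three generators, with unit coefficient at
  \<open>g1\<close>, vanishes in \<open>W/m W\<close>, express the elements \<open>w1\<close> and \<open>w2\<close> in the equation that witnesses this by \<open>g1\<close> and the
  remaining generators.  Solving for \<open>g1\<close>, whose coefficient \<open>m1 - h\<close> still has a nonzero constant term,
  shows that \<open>g1\<close> is superfluous.
\<close>

lemma dependent_generator:
  assumes min: "min_homogeneous_gens RR W gW G" and w: "generates RR W {w1, w2}"
    and g: "g1 \<in> G" "g2 \<in> G" "g3 \<in> G" "g1 \<noteq> g2" "g1 \<noteq> g3"
    and a: "a1 \<in> R" "b1 \<in> R" "g1 = a1 \<odot>\<^bsub>W\<^esub> w1 \<oplus>\<^bsub>W\<^esub> b1 \<odot>\<^bsub>W\<^esub> w2"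
      "a2 \<in> R" "b2 \<in> R" "g2 = a2 \<odot>\<^bsub>W\<^esub> w1 \<oplus>\<^bsub>W\<^esub> b2 \<odot>\<^bsub>W\<^esub> w2"
      "a3 \<in> R" "b3 \<in> R" "g3 = a3 \<odot>\<^bsub>W\<^esub> w1 \<oplus>\<^bsub>W\<^esub> b3 \<odot>\<^bsub>W\<^esub> w2"
    and m: "m1 \<in> R" "m2 \<in> R" "m3 \<in> R" "pr 0 m1 \<noteq> 0"
      "m1 * a1 + m2 * a2 + m3 * a3 \<in> irrelevant" "m1 * b1 + m2 * b2 + m3 * b3 \<in> irrelevant"
  shows False
proof -
  have G: "G \<subseteq> (\<Union>p. gW p)" "generates RR W G" and minimal: "\<And>H. H \<subset> G \<Longrightarrow> \<not> generates RR W H"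
    using min by (auto simp: min_homogeneous_gens_def)
  have GW: "G \<subseteq> carrier W" using G(2) by (simp add: generates_def)
  have wW: "w1 \<in> carrier W" "w2 \<in> carrier W" using w by (auto simp: generates_def)
  have gW: "g1 \<in> carrier W" "g2 \<in> carrier W" "g3 \<in> carrier W" using g GW by blast+
  obtain U where U: "submodule U RR W" "G - {g1} \<subseteq> U" "\<And>N. submodule N RR W \<Longrightarrow> G - {g1} \<subseteq> N \<Longrightarrow> U \<subseteq> N"
    using span_exists[of "G - {g1}"] GW by blast
  have UW: "u \<in> carrier W" if "u \<in> U" for u using that W.submoduleE(1)[OF U(1)] by blast
  obtain u1 f1 where u1: "u1 \<in> U" "f1 \<in> R" "w1 = u1 \<oplus>\<^bsub>W\<^esub> f1 \<odot>\<^bsub>W\<^esub> g1"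
    using generates_add_cyclic[OF G(2) gW(1) U(1,2) wW(1)] by blast
  obtain u2 f2 where u2: "u2 \<in> U" "f2 \<in> R" "w2 = u2 \<oplus>\<^bsub>W\<^esub> f2 \<odot>\<^bsub>W\<^esub> g1"
    using generates_add_cyclic[OF G(2) gW(1) U(1,2) wW(2)] by blast
  define A where "A = m1 * a1 + m2 * a2 + m3 * a3"
  define B where "B = m1 * b1 + m2 * b2 + m3 * b3"
  have AB: "A \<in> irrelevant" "B \<in> irrelevant" using m by (simp_all add: A_def B_def)
  then have ABR: "A \<in> R" "B \<in> R" by (auto simp: irrelevant_def)
  have part: "m \<odot>\<^bsub>W\<^esub> (a \<odot>\<^bsub>W\<^esub> w1 \<oplus>\<^bsub>W\<^esub> b \<odot>\<^bsub>W\<^esub> w2) = (m * a) \<odot>\<^bsub>W\<^esub> w1 \<oplus>\<^bsub>W\<^esub> (m * b) \<odot>\<^bsub>W\<^esub> w2"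
    if "m \<in> R" "a \<in> R" "b \<in> R" for m a b
    using that wW smult_closed[OF _ wW(1)] smult_closed[OF _ wW(2)]
    by (simp add: W.smult_r_distr smult_assoc)
  define Y where "Y = m2 \<odot>\<^bsub>W\<^esub> g2 \<oplus>\<^bsub>W\<^esub> m3 \<odot>\<^bsub>W\<^esub> g3"
  define Z where "Z = A \<odot>\<^bsub>W\<^esub> u1 \<oplus>\<^bsub>W\<^esub> B \<odot>\<^bsub>W\<^esub> u2"
  define h where "h = A * f1 + B * f2"
  have hR: "h \<in> R" using ABR u1 u2 by (simp add: h_def add mult)
  have X: "m1 \<odot>\<^bsub>W\<^esub> g1 \<in> carrier W" "h \<odot>\<^bsub>W\<^esub> g1 \<in> carrier W" using smult_closed m hR gW by auto
  have "g2 \<in> U" "g3 \<in> U" using U(2) g by auto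
  then have YU: "Y \<in> U" unfolding Y_def using m by (intro W.submoduleE(5)[OF U(1)] W.submoduleE(4)[OF U(1)]) auto
  have ZU: "Z \<in> U" unfolding Z_def using ABR u1 u2 by (intro W.submoduleE(5)[OF U(1)] W.submoduleE(4)[OF U(1)]) auto
  have YZW: "Y \<in> carrier W" "Z \<in> carrier W" using UW YU ZU by auto
  have 1: "m1 \<odot>\<^bsub>W\<^esub> g1 \<oplus>\<^bsub>W\<^esub> Y = A \<odot>\<^bsub>W\<^esub> w1 \<oplus>\<^bsub>W\<^esub> B \<odot>\<^bsub>W\<^esub> w2"
  proof -
    let ?c = "\<lambda>r w. r \<odot>\<^bsub>W\<^esub> w"
    have cl: "?c (m * a) w1 \<in> carrier W" "?c (m * a) w2 \<in> carrier W" if "m \<in> R" "a \<in> R" for m a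
      using smult_closed[OF mult[OF that] wW(1)] smult_closed[OF mult[OF that] wW(2)] .
    have "m1 \<odot>\<^bsub>W\<^esub> g1 \<oplus>\<^bsub>W\<^esub> Y =
      (?c (m1 * a1) w1 \<oplus>\<^bsub>W\<^esub> ?c (m1 * b1) w2) \<oplus>\<^bsub>W\<^esub> ((?c (m2 * a2) w1 \<oplus>\<^bsub>W\<^esub> ?c (m2 * b2) w2) \<oplus>\<^bsub>W\<^esub> (?c (m3 * a3) w1 \<oplus>\<^bsub>W\<^esub> ?c (m3 * b3) w2))"
      unfolding Y_def a(3) a(6) a(9) part[OF m(1) a(1,2)] part[OF m(2) a(4,5)] part[OF m(3) a(7,8)] ..
    also have "\<dots> = ((?c (m1 * a1) w1 \<oplus>\<^bsub>W\<^esub> ?c (m2 * a2) w1) \<oplus>\<^bsub>W\<^esub> ?c (m3 * a3) w1) \<oplus>\<^bsub>W\<^esub>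
       ((?c (m1 * b1) w2 \<oplus>\<^bsub>W\<^esub> ?c (m2 * b2) w2) \<oplus>\<^bsub>W\<^esub> ?c (m3 * b3) w2)"
      using cl m a by (simp add: W.M.a_ac)
    also have "\<dots> = A \<odot>\<^bsub>W\<^esub> w1 \<oplus>\<^bsub>W\<^esub> B \<odot>\<^bsub>W\<^esub> w2"
      using m a wW by (simp add: A_def B_def smult_add_left mult add)
    finally show ?thesis .
  qed
  have 2: "A \<odot>\<^bsub>W\<^esub> w1 \<oplus>\<^bsub>W\<^esub> B \<odot>\<^bsub>W\<^esub> w2 = Z \<oplus>\<^bsub>W\<^esub> h \<odot>\<^bsub>W\<^esub> g1"
  proof -
    have cl: "A \<odot>\<^bsub>W\<^esub> u1 \<in> carrier W" "B \<odot>\<^bsub>W\<^esub> u2 \<in> carrier W" "(A * f1) \<odot>\<^bsub>W\<^esub> g1 \<in> carrier W" "(B * f2) \<odot>\<^bsub>W\<^esub> g1 \<in> carrier W"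
      using smult_closed ABR u1 u2 gW UW mult by auto
    have "A \<odot>\<^bsub>W\<^esub> w1 = A \<odot>\<^bsub>W\<^esub> u1 \<oplus>\<^bsub>W\<^esub> (A * f1) \<odot>\<^bsub>W\<^esub> g1"
      unfolding u1(3) smult_assoc[OF ABR(1) u1(2) gW(1)]
      using ABR u1 UW smult_closed[OF u1(2) gW(1)] by (intro W.smult_r_distr) auto
    moreover have "B \<odot>\<^bsub>W\<^esub> w2 = B \<odot>\<^bsub>W\<^esub> u2 \<oplus>\<^bsub>W\<^esub> (B * f2) \<odot>\<^bsub>W\<^esub> g1"
      unfolding u2(3) smult_assoc[OF ABR(2) u2(2) gW(1)]
      using ABR u2 UW smult_closed[OF u2(2) gW(1)] by (intro W.smult_r_distr) auto
    moreover have "h \<odot>\<^bsub>W\<^esub> g1 = (A * f1) \<odot>\<^bsub>W\<^esub> g1 \<oplus>\<^bsub>W\<^esub> (B * f2) \<odot>\<^bsub>W\<^esub> g1"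
      unfolding h_def using ABR u1 u2 gW by (intro smult_add_left mult) auto
    ultimately show ?thesis unfolding Z_def using cl by (simp add: W.M.a_ac)
  qed
  have "(m1 - h) \<odot>\<^bsub>W\<^esub> g1 \<oplus>\<^bsub>W\<^esub> h \<odot>\<^bsub>W\<^esub> g1 = m1 \<odot>\<^bsub>W\<^esub> g1"
    using smult_add_left[OF diff[OF m(1) hR] hR gW(1)] by simp
  moreover have cD: "(m1 - h) \<odot>\<^bsub>W\<^esub> g1 \<in> carrier W" by (rule smult_closed[OF diff[OF m(1) hR] gW(1)])
  ultimately have "((m1 - h) \<odot>\<^bsub>W\<^esub> g1 \<oplus>\<^bsub>W\<^esub> Y) \<oplus>\<^bsub>W\<^esub> h \<odot>\<^bsub>W\<^esub> g1 = Z \<oplus>\<^bsub>W\<^esub> h \<odot>\<^bsub>W\<^esub> g1"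
    using 1 2 YZW X by (metis W.M.a_assoc W.M.a_comm)
  then have "(m1 - h) \<odot>\<^bsub>W\<^esub> g1 \<oplus>\<^bsub>W\<^esub> Y = Z"
    using W.M.add.r_cancel[of "h \<odot>\<^bsub>W\<^esub> g1"] cD YZW X by simp
  then have "(m1 - h) \<odot>\<^bsub>W\<^esub> g1 = Z \<oplus>\<^bsub>W\<^esub> (\<ominus>\<^bsub>W\<^esub> Y)"
    using cD YZW by (metis W.M.a_assoc W.M.r_neg W.M.r_zero W.M.a_inv_closed)
  then have "(m1 - h) \<odot>\<^bsub>W\<^esub> g1 \<in> U"
    using W.submoduleE(5)[OF U(1) ZU W.submoduleE(3)[OF U(1) YU]] by simp
  moreover have "pr 0 (m1 - h) = pr 0 m1"
    using AB u1 u2 m hR ABR by (simp add: pr_diff h_def pr_add mult pr_0_mult irrelevant_def)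
  ultimately have "generates RR W (G - {g1})"
    using redundant_generator[OF G g(1) U diff[OF m(1) hR]] m(4) by simp
  then show False using minimal[of "G - {g1}"] g(1) by blast
qed

text \<open>
  Since \<open>W/m W\<close> has dimension at most two, three generators are dependent there.
\<close>

lemma at_most_two_generators:
  assumes min: "min_homogeneous_gens RR W gW G" and w: "generates RR W {w1, w2}"
    and g: "g1 \<in> G" "g2 \<in> G" "g3 \<in> G" "g1 \<noteq> g2" "g1 \<noteq> g3" "g2 \<noteq> g3"
  shows False
proof -
  have "G \<subseteq> carrier W" using min by (simp add: min_homogeneous_gens_def generates_def)
  then have gW: "g1 \<in> carrier W" "g2 \<in> carrier W" "g3 \<in> carrier W" using g by blast+
  obtain a1 b1 where a1: "a1 \<in> R" "b1 \<in> R" "g1 = a1 \<odot>\<^bsub>W\<^esub> w1 \<oplus>\<^bsub>W\<^esub> b1 \<odot>\<^bsub>W\<^esub> w2"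
    using generates_two[OF w gW(1)] by blast
  obtain a2 b2 where a2: "a2 \<in> R" "b2 \<in> R" "g2 = a2 \<odot>\<^bsub>W\<^esub> w1 \<oplus>\<^bsub>W\<^esub> b2 \<odot>\<^bsub>W\<^esub> w2"
    using generates_two[OF w gW(2)] by blast
  obtain a3 b3 where a3: "a3 \<in> R" "b3 \<in> R" "g3 = a3 \<odot>\<^bsub>W\<^esub> w1 \<oplus>\<^bsub>W\<^esub> b3 \<odot>\<^bsub>W\<^esub> w2"
    using generates_two[OF w gW(3)] by blast
  let ?l = "\<lambda>f. Poly_Mapping.lookup f (0::expo)"
  obtain m1 m2 m3 where m: "m1 \<noteq> 0 \<or> m2 \<noteq> 0 \<or> m3 \<noteq> 0"
      "m1 * ?l a1 + m2 * ?l a2 + m3 * ?l a3 = 0" "m1 * ?l b1 + m2 * ?l b2 + m3 * ?l b3 = 0"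
    using three_vectors_dependent[of "?l a1" "?l a2" "?l a3" "?l b1" "?l b2" "?l b3"] by blast
  let ?s = "\<lambda>c::'k. Poly_Mapping.single (0::expo) c"
  have sR: "?s c \<in> R" for c by (simp add: sring_iff zero_in)
  have s0: "pr 0 (?s c) \<noteq> 0" if "c \<noteq> 0" for c
    using that pr_0_eq_single[OF sR[of c]] by (metis lookup_single_eq lookup_zero)
  have irr: "?s c1 * e1 + ?s c2 * e2 + ?s c3 * e3 \<in> irrelevant"
    if "e1 \<in> R" "e2 \<in> R" "e3 \<in> R" "c1 * ?l e1 + c2 * ?l e2 + c3 * ?l e3 = 0" for c1 c2 c3 e1 e2 e3
    unfolding irrelevant_iff using that sR by (simp add: lookup_add lookup_0_mult add mult)
  note dep = dependent_generator[OF min w]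
  consider "m1 \<noteq> 0" | "m2 \<noteq> 0" | "m3 \<noteq> 0" using m by blast
  then show False
  proof cases
    case 1
    show ?thesis
      by (rule dep[OF g(1,2,3,4,5) a1 a2 a3 sR sR sR s0[OF 1] irr[OF a1(1) a2(1) a3(1) m(2)] irr[OF a1(2) a2(2) a3(2) m(3)]])
  next
    case 2
    have m': "m2 * ?l a2 + m1 * ?l a1 + m3 * ?l a3 = 0" "m2 * ?l b2 + m1 * ?l b1 + m3 * ?l b3 = 0"
      using m by (simp_all add: add_ac)
    show ?thesis
      by (rule dep[OF g(2,1,3) g(4)[symmetric] g(6) a2 a1 a3 sR sR sR s0[OF 2] irr[OF a2(1) a1(1) a3(1) m'(1)] irr[OF a2(2) a1(2) a3(2) m'(2)]])
  next
    case 3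
    have m': "m3 * ?l a3 + m1 * ?l a1 + m2 * ?l a2 = 0" "m3 * ?l b3 + m1 * ?l b1 + m2 * ?l b2 = 0"
      using m by (simp_all add: add_ac)
    show ?thesis
      by (rule dep[OF g(3,1,2) g(5)[symmetric] g(6)[symmetric] a3 a1 a2 sR sR sR s0[OF 3] irr[OF a3(1) a1(1) a2(1) m'(1)] irr[OF a3(2) a1(2) a2(2) m'(2)]])
  qed
qed

lemma CM_type_2_generators:
  assumes fg: "fin_gen_module RR W" and type: "CM_type RR W = 2"
  shows "\<exists>w1 w2. generates RR W {w1, w2}"
proof -
  obtain G where "finite G" "generates RR W G" using fg by (auto simp: fin_gen_module_def)
  then have "\<exists>k. \<exists>G. finite G \<and> card G = k \<and> generates RR W G" by blast
  then have "\<exists>G. finite G \<and> card G = min_num_gens RR W \<and> generates RR W G"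
    unfolding min_num_gens_def by (rule LeastI_ex)
  then obtain G where G: "card G = 2" "generates RR W G" using type by (auto simp: CM_type_def)
  then obtain w1 w2 where "G = {w1, w2}" by (auto simp: card_2_iff)
  then show ?thesis using G by blast
qed

lemma not_level_generators:
  assumes fg: "fin_gen_module RR W" and type: "CM_type RR W = 2" and not_level: "\<not> level RR W gW"
  shows "\<exists>y1 y2 d \<delta>. \<delta> > 0 \<and> y1 \<in> gW d \<and> y2 \<in> gW (d + int \<delta>) \<and> generates RR W {y1, y2} \<and>
    \<not> generates RR W {y1} \<and> \<not> generates RR W {y2}"
proof -
  obtain w1 w2 where w: "generates RR W {w1, w2}" using CM_type_2_generators[OF fg type] by blast
  obtain G where min: "min_homogeneous_gens RR W gW G" and G: "\<And>p. \<not> G \<subseteq> gW p"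
    using not_level by (auto simp: level_def)
  have hom: "G \<subseteq> (\<Union>p. gW p)" and gen: "generates RR W G" and minimal: "\<And>H. H \<subset> G \<Longrightarrow> \<not> generates RR W H"
    using min by (auto simp: min_homogeneous_gens_def)
  obtain g where g: "g \<in> G" using G by blast
  obtain p where p: "g \<in> gW p" using hom g by blast
  obtain h where h: "h \<in> G" "h \<notin> gW p" using G by blast
  obtain q where q: "h \<in> gW q" using hom h by blast
  have gh: "g \<noteq> h" using p h by blast
  have Gs: "G = {g, h}"
    using at_most_two_generators[OF min w g h(1) _ gh] g h by blast
  have pq: "p \<noteq> q" using h q by blast
  have ng: "\<not> generates RR W {g}" "\<not> generates RR W {h}" using minimal[of "{g}"] minimal[of "{h}"] Gs gh by auto
  show ?thesis
  proof (cases "p < q")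
    case True
    then show ?thesis
      using p q gen Gs ng by (intro exI[of _ g] exI[of _ h] exI[of _ p] exI[of _ "nat (q - p)"]) simp
  next
    case False
    then show ?thesis
      using p q gen Gs ng pq
      by (intro exI[of _ h] exI[of _ g] exI[of _ q] exI[of _ "nat (p - q)"]) (simp add: insert_commute)
  qed
qed

end

section \<open>Presentation of a graded module with two generators\<close>

text \<open>
  \<open>proj\<close> is the presentation \<open>R\<^sup>2 \<rightarrow> W\<close> that belongs to the generators, and \<open>K\<close> its kernel.
\<close>

locale two_generated_module = graded_module_over_ring S dg k_type W gW
  for S dg and k_type :: "'k::field itself"
    and W :: "(expo \<Rightarrow>\<^sub>0 'k, 'c) module" and gW :: "int \<Rightarrow> 'c set" +
  fixes y1 y2 :: 'c and d1 :: int and \<delta> :: nat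
  assumes y1: "y1 \<in> gW d1" and y2: "y2 \<in> gW (d1 + int \<delta>)"
    and gen: "generates RR W {y1, y2}"
begin

sublocale P: graded_module_over R pr "R \<times> R" pair_scale "pair_pr \<delta>"
  by (rule pairs)

lemma yW: "y1 \<in> carrier W" "y2 \<in> carrier W"
  using y1 y2 gW_closed by auto

definition proj :: "(expo \<Rightarrow>\<^sub>0 'k) \<times> (expo \<Rightarrow>\<^sub>0 'k) \<Rightarrow> 'c" where
  "proj x = fst x \<odot>\<^bsub>W\<^esub> y1 \<oplus>\<^bsub>W\<^esub> snd x \<odot>\<^bsub>W\<^esub> y2"

lemma proj_closed: "x \<in> R \<times> R \<Longrightarrow> proj x \<in> carrier W"
  unfolding proj_def using smult_closed yW by (intro W.M.a_closed) auto

lemma proj_add: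
  assumes "x \<in> R \<times> R" "y \<in> R \<times> R"
  shows "proj (x + y) = proj x \<oplus>\<^bsub>W\<^esub> proj y"
proof -
  have xy: "fst x \<in> R" "snd x \<in> R" "fst y \<in> R" "snd y \<in> R" using assms by auto
  have cl: "r \<odot>\<^bsub>W\<^esub> y1 \<in> carrier W" "r \<odot>\<^bsub>W\<^esub> y2 \<in> carrier W" if "r \<in> R" for r
    using smult_closed[OF that] yW by auto
  show ?thesis
    unfolding proj_def fst_add snd_add smult_add_left[OF xy(1,3) yW(1)] smult_add_left[OF xy(2,4) yW(2)]
    using cl[OF xy(1)] cl[OF xy(2)] cl[OF xy(3)] cl[OF xy(4)] by (simp add: W.M.a_ac)
qed

lemma proj_scale:
  assumes "r \<in> R" "x \<in> R \<times> R"
  shows "proj (pair_scale r x) = r \<odot>\<^bsub>W\<^esub> proj x"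
proof -
  have x: "fst x \<in> R" "snd x \<in> R" using assms by auto
  have "r \<odot>\<^bsub>W\<^esub> proj x = r \<odot>\<^bsub>W\<^esub> (fst x \<odot>\<^bsub>W\<^esub> y1) \<oplus>\<^bsub>W\<^esub> r \<odot>\<^bsub>W\<^esub> (snd x \<odot>\<^bsub>W\<^esub> y2)"
    unfolding proj_def using assms(1) smult_closed[OF x(1) yW(1)] smult_closed[OF x(2) yW(2)]
    by (intro W.smult_r_distr) auto
  then show ?thesis
    unfolding proj_def pair_scale_def fst_conv snd_conv
      smult_assoc[OF assms(1) x(1) yW(1)] smult_assoc[OF assms(1) x(2) yW(2)] by simp
qed

lemma proj_zero: "proj 0 = \<zero>\<^bsub>W\<^esub>"
  using smult_zero yW by (simp add: proj_def)

lemma proj_sum: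
  fixes n :: nat
  assumes "\<And>i. i < n \<Longrightarrow> f i \<in> R \<times> R"
  shows "proj (\<Sum>i<n. f i) = finsum W (\<lambda>i. proj (f i)) {..<n}"
  using assms
proof (induction n)
  case 0
  then show ?case by (simp add: proj_zero)
next
  case (Suc n)
  have f: "f i \<in> R \<times> R" if "i < Suc n" for i using Suc.prems that by blast
  have "sum f {..<n} \<in> R \<times> R" using f by (intro P.sumM) simp
  then have "proj (\<Sum>i<Suc n. f i) = proj (f n) \<oplus>\<^bsub>W\<^esub> proj (\<Sum>i<n. f i)"
    using proj_add[OF f[of n], of "sum f {..<n}"] by (simp add: add.commute)
  also have "proj (\<Sum>i<n. f i) = finsum W (\<lambda>i. proj (f i)) {..<n}" using Suc.IH f by simp
  also have "proj (f n) \<oplus>\<^bsub>W\<^esub> finsum W (\<lambda>i. proj (f i)) {..<n} = finsum W (\<lambda>i. proj (f i)) (insert n {..<n})"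
    using proj_closed[OF f] by (intro W.finsum_insert[symmetric]) auto
  also have "insert n {..<n} = {..<Suc n}" by (rule lessThan_Suc[symmetric])
  finally show ?case .
qed

lemma proj_surj: "w \<in> carrier W \<Longrightarrow> \<exists>x\<in>R \<times> R. w = proj x"
  using generates_two[OF gen] unfolding proj_def by fastforce

definition K :: "((expo \<Rightarrow>\<^sub>0 'k) \<times> (expo \<Rightarrow>\<^sub>0 'k)) set" where
  "K = {x \<in> R \<times> R. proj x = \<zero>\<^bsub>W\<^esub>}"

lemma submod_K: "P.submod K"
  unfolding submodule_of_def
proof (intro conjI ballI)
  show "K \<subseteq> R \<times> R" by (auto simp: K_def)
  show "0 \<in> K" using P.zeroM by (simp add: K_def proj_zero)
  show "x + y \<in> K" if "x \<in> K" "y \<in> K" for x y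
    using that P.addM[of x y] proj_add[of x y] unfolding K_def by simp
  show "pair_scale r x \<in> K" if "r \<in> R" "x \<in> K" for r x
    using that P.scaleM[of r x] proj_scale[of r x] W.smult_r_null[of r] unfolding K_def by simp
qed

lemma proj_diff_in_K:
  assumes "x \<in> R \<times> R" "y \<in> R \<times> R"
  shows "x - y \<in> K \<longleftrightarrow> proj x = proj y"
proof -
  have d: "x - y \<in> R \<times> R" using assms by (rule P.diffM)
  have "proj x = proj (x - y) \<oplus>\<^bsub>W\<^esub> proj y" using proj_add[OF d assms(2)] by simp
  then show ?thesis
    using proj_closed[OF d] proj_closed[OF assms(2)] W.M.add.r_cancel_one'[of "proj y" "proj (x - y)"] d
    unfolding K_def by auto
qed

lemma comp_proj:
  assumes "x \<in> R \<times> R"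
  shows "comp (proj x) (d1 + int p) = proj (pair_pr \<delta> p x)"
proof -
  have x: "fst x \<in> R" "snd x \<in> R" using assms by auto
  have "comp (proj x) (d1 + int p) =
      comp (fst x \<odot>\<^bsub>W\<^esub> y1) (d1 + int p) \<oplus>\<^bsub>W\<^esub> comp (snd x \<odot>\<^bsub>W\<^esub> y2) (d1 + int p)"
    unfolding proj_def by (rule comp_add[OF smult_closed[OF x(1) yW(1)] smult_closed[OF x(2) yW(2)]])
  also have "comp (fst x \<odot>\<^bsub>W\<^esub> y1) (d1 + int p) = pr p (fst x) \<odot>\<^bsub>W\<^esub> y1"
    using comp_smult_homog[OF y1 x(1), of "d1 + int p"] by simp
  also have "comp (snd x \<odot>\<^bsub>W\<^esub> y2) (d1 + int p) = (if p < \<delta> then 0 else pr (p - \<delta>) (snd x)) \<odot>\<^bsub>W\<^esub> y2"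
  proof -
    have "nat (int p - int \<delta>) = p - \<delta>" by simp
    then show ?thesis using comp_smult_homog[OF y2 x(2), of "d1 + int p"] smult_zero[OF yW(2)] by simp
  qed
  finally show ?thesis by (simp add: proj_def pair_pr_def)
qed

lemma graded_K: "P.graded_submod K"
  unfolding P.graded_submod_def
proof (intro conjI ballI allI)
  show "P.submod K" by (rule submod_K)
  fix x p assume "x \<in> K"
  then have x: "x \<in> R \<times> R" "proj x = \<zero>\<^bsub>W\<^esub>" by (auto simp: K_def)
  then show "pair_pr \<delta> p x \<in> K"
    using comp_proj[OF x(1), of p] P.prM_closed[OF x(1), of p] comp_zero unfolding K_def by simp
qed

lemma one_zero_notin_K:
  assumes "\<not> generates RR W {y2}"
  shows "(1, 0) \<notin> K"
proof
  assume "(1, 0) \<in> K"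
  then have "y1 = \<zero>\<^bsub>W\<^esub>" unfolding K_def proj_def using smult_one[OF yW(1)] smult_zero[OF yW(2)] yW by simp
  have "generates RR W {y2}"
    unfolding generates_def
  proof (intro conjI allI impI)
    show "{y2} \<subseteq> carrier W" using yW by simp
    fix N assume N: "submodule N RR W \<and> {y2} \<subseteq> N"
    then have sub: "submodule N RR W" "y2 \<in> N" by auto
    have "0 \<odot>\<^bsub>W\<^esub> y2 \<in> N" by (rule W.submoduleE(4)[OF sub(1) _ sub(2)]) (simp add: zero)
    then have "y1 \<in> N" using smult_zero[OF yW(2)] \<open>y1 = \<zero>\<^bsub>W\<^esub>\<close> by simp
    then have "{y1, y2} \<subseteq> N" using sub by blast
    then show "N = carrier W" using N gen unfolding generates_def by blast
  qed
  then show False using assms by blast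
qed

lemma minus_one_notin_K:
  assumes "\<not> generates RR W {y1}" and c: "c \<in> R"
  shows "(c, - 1) \<notin> K"
proof
  assume "(c, - 1) \<in> K"
  then have "(c, 0) - (0, 1) \<in> K" by (simp only: diff_Pair diff_0 diff_zero)
  moreover have "(c, 0) \<in> R \<times> R" "(0, 1) \<in> R \<times> R" using c zero one by (simp_all only: mem_Times_iff fst_conv snd_conv)
  ultimately have "proj (c, 0) = proj (0, 1)" using proj_diff_in_K[of "(c, 0)" "(0, 1)"] by blast
  moreover have "proj (c, 0) = c \<odot>\<^bsub>W\<^esub> y1"
    unfolding proj_def fst_conv snd_conv smult_zero[OF yW(2)] by (rule W.M.r_zero[OF smult_closed[OF c yW(1)]])
  moreover have "proj (0, 1) = y2"
    unfolding proj_def fst_conv snd_conv smult_zero[OF yW(1)] smult_one[OF yW(2)] by (rule W.M.l_zero[OF yW(2)])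
  ultimately have y2c: "c \<odot>\<^bsub>W\<^esub> y1 = y2" by simp
  have "generates RR W {y1}"
    unfolding generates_def
  proof (intro conjI allI impI)
    show "{y1} \<subseteq> carrier W" using yW by simp
    fix N assume N: "submodule N RR W \<and> {y1} \<subseteq> N"
    then have sub: "submodule N RR W" "y1 \<in> N" by auto
    have "c \<odot>\<^bsub>W\<^esub> y1 \<in> N" by (rule W.submoduleE(4)[OF sub(1) _ sub(2)]) (simp add: c)
    then have "{y1, y2} \<subseteq> N" using sub y2c by blast
    then show "N = carrier W" using N gen unfolding generates_def by blast
  qed
  then show False using assms by blast
qed

text \<open>
  The values of a homomorphism on the two generators form a pair that annihilates \<open>K\<close>, and they
  generate its image.
\<close>

lemma trace_subset_ideal:
  assumes NG: "nearly_Gorenstein RR (std_grading S) W" and J: "ideal_of R J"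
    and pairs: "\<And>f g. f \<in> R \<Longrightarrow> g \<in> R \<Longrightarrow> (\<And>a b. (a, b) \<in> K \<Longrightarrow> a * f + b * g = 0) \<Longrightarrow> f \<in> J \<and> g \<in> J"
  shows "irrelevant \<subseteq> J"
proof -
  have "h w \<in> J" if h: "h \<in> module_Hom RR W (self_module RR)" and w: "w \<in> carrier W" for h w
  proof -
    have hR: "h v \<in> R" if "v \<in> carrier W" for v
      using h that by (auto simp: module_Hom_def self_module_def)
    have hadd: "h (u \<oplus>\<^bsub>W\<^esub> v) = h u + h v" if "u \<in> carrier W" "v \<in> carrier W" for u v
      using h that by (simp add: module_Hom_def self_module_def)
    have hsmult: "h (r \<odot>\<^bsub>W\<^esub> v) = r * h v" if "r \<in> R" "v \<in> carrier W" for r v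
      using h that by (simp add: module_Hom_def self_module_def)
    have hproj: "h (proj x) = fst x * h y1 + snd x * h y2" if x: "x \<in> R \<times> R" for x
    proof -
      have "fst x \<in> R" "snd x \<in> R" using x by auto
      then show ?thesis
        unfolding proj_def using hadd hsmult yW smult_closed by simp
    qed
    have h0: "h \<zero>\<^bsub>W\<^esub> = 0" using hsmult[OF zero yW(1)] smult_zero[OF yW(1)] by simp
    have hJ: "h y1 \<in> J \<and> h y2 \<in> J"
    proof (rule pairs)
      show "h y1 \<in> R" "h y2 \<in> R" using hR yW by auto
      fix a b assume "(a, b) \<in> K"
      then have "(a, b) \<in> R \<times> R" "proj (a, b) = \<zero>\<^bsub>W\<^esub>" by (auto simp: K_def)
      then show "a * h y1 + b * h y2 = 0" using hproj[of "(a, b)"] h0 by simp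
    qed
    obtain x where x: "x \<in> R \<times> R" "w = proj x" using proj_surj[OF w] by blast
    have "fst x \<in> R" "snd x \<in> R" using x(1) by auto
    then have "fst x * h y1 + snd x * h y2 \<in> J"
      using J hJ by (simp add: ideal_of_def)
    then show ?thesis unfolding x(2) hproj[OF x(1)] .
  qed
  then have "(\<Union>h\<in>module_Hom RR W (self_module RR). h ` carrier W) \<subseteq> J" by blast
  then have "trace_ideal RR W \<subseteq> J"
    unfolding trace_ideal_def using J ideal_iff by (intro ring.genideal_minimal[OF cring.axioms(1)[OF cring_RR]]) simp_all
  then show ?thesis using NG unfolding nearly_Gorenstein_def graded_max_ideal_eq by blast
qed

section \<open>The resolution of the residue field\<close>

lemma finsum_self_module:
  fixes n :: nat
  assumes "\<And>i. i < n \<Longrightarrow> f i \<in> R"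
  shows "finsum (self_module RR) f {..<n} = (\<Sum>i<n. f i)"
proof -
  have "abelian_monoid (self_module RR)"
    by (rule abelian_monoidI)
      (simp_all add: self_module_def add zero add.assoc add.commute)
  then interpret A: abelian_monoid "self_module RR" .
  show ?thesis
    using assms
  proof (induction n)
    case 0
    then show ?case using A.finsum_empty by (simp add: self_module_def)
  next
    case (Suc n)
    have "finsum (self_module RR) f {..<Suc n} = f n \<oplus>\<^bsub>self_module RR\<^esub> finsum (self_module RR) f {..<n}"
      unfolding lessThan_Suc using Suc.prems by (intro A.finsum_insert) (auto simp: self_module_def)
    then show ?case using Suc by (simp add: self_module_def add.commute)
  qed
qed

lemma module_self: "module RR (self_module RR)"
proof (rule moduleI[OF cring_RR])
  show "abelian_group (self_module RR)"
  proof (rule abelian_groupI)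
    fix f assume "f \<in> carrier (self_module RR)"
    then show "\<exists>g\<in>carrier (self_module RR). g \<oplus>\<^bsub>self_module RR\<^esub> f = \<zero>\<^bsub>self_module RR\<^esub>"
      by (intro bexI[of _ "- f"]) (auto simp: self_module_def uminus)
  qed (simp_all add: self_module_def add zero add.assoc add.commute)
qed (simp_all add: self_module_def mult algebra_simps)

lemma quotient_residue: "quotient_of_module RR (self_module RR) irrelevant"
proof -
  interpret M: module RR "self_module RR" by (rule module_self)
  have "submodule irrelevant RR (self_module RR)"
    by (rule M.submodule_by_add_smult)
      (use ideal_of_irrelevant in \<open>auto simp: self_module_def ideal_of_def\<close>)
  then show ?thesis by (simp add: quotient_of_module_def quotient_of_module_axioms_def module_self)
qed

abbreviation coset :: "(expo \<Rightarrow>\<^sub>0 'k) \<Rightarrow> (expo \<Rightarrow>\<^sub>0 'k) set" where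
  "coset f \<equiv> irrelevant +>\<^bsub>self_module RR\<^esub> f"

lemma residue_module_eq: "residue_module RR (std_grading S) = quot_module (self_module RR) irrelevant"
  by (simp add: residue_module_def graded_max_ideal_eq)

lemma coset_eq_iff: "f \<in> R \<Longrightarrow> g \<in> R \<Longrightarrow> coset f = coset g \<longleftrightarrow> f - g \<in> irrelevant"
proof -
  assume fg: "f \<in> R" "g \<in> R"
  interpret Q: quotient_of_module RR "self_module RR" irrelevant by (rule quotient_residue)
  have "\<ominus>\<^bsub>self_module RR\<^esub> g = - g"
    by (rule Q.M.minus_equality) (use fg in \<open>simp_all add: self_module_def uminus\<close>)
  then have "f \<ominus>\<^bsub>self_module RR\<^esub> g = f - g"
    unfolding a_minus_def by (simp add: self_module_def)
  then show ?thesis using Q.coset_eq_iff[of f g] fg by (simp add: self_module_def)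
qed

lemma coset_zero: "f \<in> R \<Longrightarrow> coset f = irrelevant \<longleftrightarrow> f \<in> irrelevant"
proof -
  assume f: "f \<in> R"
  interpret Q: quotient_of_module RR "self_module RR" irrelevant by (rule quotient_residue)
  show ?thesis using Q.coset_eq_zero_iff[of f] f by (simp add: self_module_def)
qed

text \<open>
  The augmentation of a resolution sends \<open>v\<close> to the residue class of the combination of the
  representatives \<open>eps j\<close> with the coefficients \<open>v j\<close>.
\<close>

lemma finsum_coset:
  fixes n :: nat
  assumes "\<And>j. j < n \<Longrightarrow> v j \<in> R" "\<And>j. j < n \<Longrightarrow> eps j \<in> R" "\<And>j. j < n \<Longrightarrow> e j = coset (eps j)"
  shows "finsum (quot_module (self_module RR) irrelevant)
      (\<lambda>j. v j \<odot>\<^bsub>quot_module (self_module RR) irrelevant\<^esub> e j) {..<n} = coset (\<Sum>j<n. v j * eps j)"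
proof -
  interpret Q: quotient_of_module RR "self_module RR" irrelevant by (rule quotient_residue)
  interpret A: abelian_monoid Q.Q by (rule Q.abelian_monoid_Q)
  show ?thesis
    using assms
  proof (induction n)
    case 0
    have "coset 0 = irrelevant" using coset_zero[OF zero] ideal_of_irrelevant by (simp add: ideal_of_def)
    then show ?case using Q.zero_Q by simp
  next
    case (Suc n)
    have t: "v j \<odot>\<^bsub>Q.Q\<^esub> e j = coset (v j * eps j)" if "j < Suc n" for j
      using Q.smult_Q[of "v j" "eps j"] Suc.prems that by (simp add: self_module_def)
    have c: "v j \<odot>\<^bsub>Q.Q\<^esub> e j \<in> carrier Q.Q" if "j < Suc n" for j
    proof -
      have "v j * eps j \<in> carrier (self_module RR)" using Suc.prems that by (simp add: self_module_def mult)
      then show ?thesis unfolding t[OF that] Q.carrier_Q by blast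
    qed
    have s: "(\<Sum>j<n. v j * eps j) \<in> R" using Suc.prems by (intro sum mult) auto
    have "finsum Q.Q (\<lambda>j. v j \<odot>\<^bsub>Q.Q\<^esub> e j) {..<Suc n} =
        v n \<odot>\<^bsub>Q.Q\<^esub> e n \<oplus>\<^bsub>Q.Q\<^esub> finsum Q.Q (\<lambda>j. v j \<odot>\<^bsub>Q.Q\<^esub> e j) {..<n}"
      unfolding lessThan_Suc using c by (intro A.finsum_insert) auto
    also have "finsum Q.Q (\<lambda>j. v j \<odot>\<^bsub>Q.Q\<^esub> e j) {..<n} = coset (\<Sum>j<n. v j * eps j)"
      using Suc.IH Suc.prems by simp
    also have "v n \<odot>\<^bsub>Q.Q\<^esub> e n \<oplus>\<^bsub>Q.Q\<^esub> coset (\<Sum>j<n. v j * eps j) = coset (v n * eps n + (\<Sum>j<n. v j * eps j))"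
      unfolding t[OF lessI] using Q.add_Q[of "v n * eps n" "\<Sum>j<n. v j * eps j"] s Suc.prems
      by (simp add: self_module_def mult)
    finally show ?case by (simp add: add.commute)
  qed
qed

end

locale resolved_module = two_generated_module S dg k_type W gW y1 y2 d1 \<delta>
  for S dg and k_type :: "'k::field itself"
    and W :: "(expo \<Rightarrow>\<^sub>0 'k, 'c) module" and gW y1 y2 d1 \<delta> +
  fixes b :: "nat \<Rightarrow> nat" and s :: "nat \<Rightarrow> nat \<Rightarrow> int"
    and D :: "nat \<Rightarrow> nat \<Rightarrow> nat \<Rightarrow> (expo \<Rightarrow>\<^sub>0 'k)" and e :: "nat \<Rightarrow> (expo \<Rightarrow>\<^sub>0 'k) set"
  assumes resolution: "graded_free_resolution RR (std_grading S)
    (residue_module RR (std_grading S)) (residue_grading RR (std_grading S)) b s D e"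
begin

abbreviation F where "F i \<equiv> {..<b i} \<rightarrow>\<^sub>E R"
abbreviation d where "d i \<equiv> mat_map (self_module RR) (b (Suc i)) (b i) (D i)"
abbreviation kk where "kk \<equiv> quot_module (self_module RR) irrelevant"
abbreviation aug where "aug v \<equiv> finsum kk (\<lambda>j. v j \<odot>\<^bsub>kk\<^esub> e j) {..<b 0}"

lemma resolution_facts:
  shows "\<And>j. j < b 0 \<Longrightarrow> e j \<in> residue_grading RR (std_grading S) (s 0 j)"
    and "\<And>i j l. j < b i \<Longrightarrow> l < b (Suc i) \<Longrightarrow> D i j l \<in> std_grading S (s (Suc i) l - s i j)"
    and "aug ` F 0 = carrier kk"
    and "{v \<in> F 0. aug v = \<zero>\<^bsub>kk\<^esub>} = d 0 ` F 1"
    and "\<And>i. {v \<in> F (Suc i). d i v = (\<lambda>j\<in>{..<b i}. 0)} = d (Suc i) ` F (Suc (Suc i))"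
  using resolution unfolding graded_free_resolution_def Let_def residue_module_eq
  by simp_all

lemma D_in_R: "j < b i \<Longrightarrow> l < b (Suc i) \<Longrightarrow> D i j l \<in> R"
  using resolution_facts(2)[of j i l] by (simp add: std_grading_eq sring_iff)

definition eps :: "nat \<Rightarrow> (expo \<Rightarrow>\<^sub>0 'k)" where
  "eps j = (SOME f. f \<in> R \<and> e j = coset f)"

lemma eps: "j < b 0 \<Longrightarrow> eps j \<in> R \<and> e j = coset (eps j)"
proof -
  assume "j < b 0"
  then obtain f where "f \<in> std_grading S (s 0 j)" "e j = coset f"
    using resolution_facts(1)[of j]
    unfolding residue_grading_def quot_grading_def graded_max_ideal_eq by blast
  then have "\<exists>f. f \<in> R \<and> e j = coset f" by (auto simp: std_grading_eq sring_iff)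
  then show ?thesis unfolding eps_def by (rule someI_ex)
qed

lemma aug_eq: "(\<And>j. j < b 0 \<Longrightarrow> v j \<in> R) \<Longrightarrow> aug v = coset (\<Sum>j<b 0. v j * eps j)"
  using eps by (intro finsum_coset) auto

lemma d_eq:
  assumes "\<And>l. l < b (Suc i) \<Longrightarrow> v l \<in> R" "j < b i"
  shows "d i v j = (\<Sum>l<b (Suc i). D i j l * v l)"
proof -
  have "d i v j = finsum (self_module RR) (\<lambda>l. D i j l * v l) {..<b (Suc i)}"
    using assms(2) by (simp add: mat_map_def self_module_def)
  also have "\<dots> = (\<Sum>l<b (Suc i). D i j l * v l)"
    using D_in_R[OF assms(2)] assms(1) by (intro finsum_self_module mult) auto
  finally show ?thesis .
qed

definition unit_vec :: "nat \<Rightarrow> nat \<Rightarrow> nat \<Rightarrow> (expo \<Rightarrow>\<^sub>0 'k)" where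
  "unit_vec i q = (\<lambda>j\<in>{..<b i}. if j = q then 1 else 0)"

lemma unit_vec_F: "unit_vec i q \<in> F i"
  unfolding unit_vec_def using zero one by auto

lemma d_unit_vec:
  assumes "j < b i" "q < b (Suc i)"
  shows "d i (unit_vec (Suc i) q) j = D i j q"
proof -
  have "d i (unit_vec (Suc i) q) j = (\<Sum>l<b (Suc i). D i j l * unit_vec (Suc i) q l)"
    using unit_vec_F[of "Suc i" q] assms by (intro d_eq) auto
  also have "\<dots> = (\<Sum>l<b (Suc i). if l = q then D i j l else 0)"
    by (intro sum.cong) (auto simp: unit_vec_def)
  finally show ?thesis using assms by simp
qed

sublocale C: free_complex R pr "R \<times> R" pair_scale "pair_pr \<delta>" b D eps
proof
  show "D i j l \<in> R" if "j < b i" "l < b (Suc i)" for i j l using D_in_R that .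
  show "(\<Sum>l<b (Suc i). D i j l * D (Suc i) l q) = 0" if j: "j < b i" and q: "q < b (Suc (Suc i))" for i j q
  proof -
    let ?x = "d (Suc i) (unit_vec (Suc (Suc i)) q)"
    have "?x \<in> d (Suc i) ` F (Suc (Suc i))" using unit_vec_F by blast
    then have "?x \<in> {v \<in> F (Suc i). d i v = (\<lambda>j\<in>{..<b i}. 0)}" unfolding resolution_facts(5) .
    then have x: "?x \<in> F (Suc i)" "d i ?x = (\<lambda>j\<in>{..<b i}. 0)" by blast+
    have "d i ?x j = (\<Sum>l<b (Suc i). D i j l * ?x l)" using x(1) j by (intro d_eq) auto
    also have "\<dots> = (\<Sum>l<b (Suc i). D i j l * D (Suc i) l q)"
      using d_unit_vec[OF _ q] by (intro sum.cong) auto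
    finally show ?thesis using x(2) j by simp
  qed
  show "eps j \<in> R" if "j < b 0" for j using eps that by blast
  show "(\<Sum>j<b 0. D 0 j l * eps j) \<in> irrelevant" if l: "l < b (Suc 0)" for l
  proof -
    let ?x = "d 0 (unit_vec 1 l)"
    have "?x \<in> d 0 ` F 1" using unit_vec_F by blast
    then have "?x \<in> {v \<in> F 0. aug v = \<zero>\<^bsub>kk\<^esub>}" unfolding resolution_facts(4) .
    then have x: "?x \<in> F 0" "aug ?x = \<zero>\<^bsub>kk\<^esub>" by blast+
    have xR: "?x j \<in> R" if "j < b 0" for j using x(1) that by auto
    have sR: "(\<Sum>j<b 0. ?x j * eps j) \<in> R" using xR eps by (intro sum mult) auto
    have "coset (\<Sum>j<b 0. ?x j * eps j) = irrelevant"
      using aug_eq[of ?x] xR x(2) by (simp add: quot_module_def)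
    then have "(\<Sum>j<b 0. ?x j * eps j) \<in> irrelevant" using coset_zero[OF sR] by blast
    moreover have "(\<Sum>j<b 0. ?x j * eps j) = (\<Sum>j<b 0. D 0 j l * eps j)"
      using d_unit_vec[of _ 0 l] l by (intro sum.cong) auto
    ultimately show ?thesis by simp
  qed
  show "\<exists>r. (\<forall>j<b 0. r j \<in> R) \<and> 1 - (\<Sum>j<b 0. r j * eps j) \<in> irrelevant"
  proof -
    interpret Q: quotient_of_module RR "self_module RR" irrelevant by (rule quotient_residue)
    have "1 \<in> carrier (self_module RR)" using one by (simp add: self_module_def)
    then have "coset 1 \<in> carrier kk" unfolding Q.carrier_Q by blast
    then have "coset 1 \<in> aug ` F 0" unfolding resolution_facts(3) .
    then obtain v where v: "v \<in> F 0" "coset 1 = aug v" by blast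
    have vR: "v j \<in> R" if "j < b 0" for j using v(1) that by auto
    have sR: "(\<Sum>j<b 0. v j * eps j) \<in> R" using vR eps by (intro sum mult) auto
    have "coset 1 = coset (\<Sum>j<b 0. v j * eps j)" using aug_eq[of v] vR v(2) by simp
    then have "1 - (\<Sum>j<b 0. v j * eps j) \<in> irrelevant" using coset_eq_iff[OF one sR] by blast
    then show ?thesis using vR by blast
  qed
qed

section \<open>Ext of the residue field with values in the module\<close>

text \<open>
  Cochains with values in \<open>W\<close> are images of cochains with values in \<open>R\<^sup>2\<close>, and \<open>proj\<close> commutes with
  the coboundary maps.  So the vanishing of Ext can be transferred to \<open>R\<^sup>2/K\<close>.
\<close>

lemma coboundary_proj:
  assumes v: "\<And>j. j < b i \<Longrightarrow> v j \<in> R \<times> R" and l: "l < b (Suc i)"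
  shows "coboundary b D W i (\<lambda>j\<in>{..<b i}. proj (v j)) l = proj (C.delta i v l)"
proof -
  have "coboundary b D W i (\<lambda>j\<in>{..<b i}. proj (v j)) l =
      finsum W (\<lambda>j. D i j l \<odot>\<^bsub>W\<^esub> (\<lambda>j\<in>{..<b i}. proj (v j)) j) {..<b i}"
    using l by (simp add: coboundary_def mat_map_def)
  also have "\<dots> = finsum W (\<lambda>j. proj (pair_scale (D i j l) (v j))) {..<b i}"
  proof (rule W.finsum_cong'[OF refl])
    show "(\<lambda>j. proj (pair_scale (D i j l) (v j))) \<in> {..<b i} \<rightarrow> carrier W"
      using proj_closed[OF P.scaleM[OF D_in_R[OF _ l] v]] by simp
    show "D i j l \<odot>\<^bsub>W\<^esub> (\<lambda>j\<in>{..<b i}. proj (v j)) j = proj (pair_scale (D i j l) (v j))"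
      if "j \<in> {..<b i}" for j
      using proj_scale[OF D_in_R[OF _ l] v, of j j] that by simp
  qed
  also have "\<dots> = proj (C.delta i v l)"
    unfolding C.delta_def by (rule proj_sum[symmetric]) (rule P.scaleM[OF D_in_R[OF _ l] v])
  finally show ?thesis .
qed

lemma coboundary_outside: "\<not> l < b (Suc i) \<Longrightarrow> coboundary b D W i w l = undefined"
  by (simp add: coboundary_def mat_map_def)

lemma cocycle_proj:
  assumes v: "\<And>j. j < b i \<Longrightarrow> v j \<in> R \<times> R" and \<delta>: "\<And>l. l < b (Suc i) \<Longrightarrow> C.delta i v l \<in> K"
  shows "(\<lambda>j\<in>{..<b i}. proj (v j)) \<in> cocycles b D W i"
proof (rule W.cocyclesI)
  show "proj (v j) \<in> carrier W" if "j < b i" for j using proj_closed v that by blast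
  have "coboundary b D W i (\<lambda>j\<in>{..<b i}. proj (v j)) = (\<lambda>l\<in>{..<b (Suc i)}. \<zero>\<^bsub>W\<^esub>)"
  proof
    fix l
    show "coboundary b D W i (\<lambda>j\<in>{..<b i}. proj (v j)) l = (\<lambda>l\<in>{..<b (Suc i)}. \<zero>\<^bsub>W\<^esub>) l"
    proof (cases "l < b (Suc i)")
      case True
      then show ?thesis using coboundary_proj[OF v True] \<delta>[OF True] by (simp add: K_def)
    next
      case False
      then show ?thesis using coboundary_outside[OF False] by simp
    qed
  qed
  then show "mat_map W (b i) (b (Suc i)) (\<lambda>l j. D i j l) (\<lambda>j\<in>{..<b i}. proj (v j)) = (\<lambda>l\<in>{..<b (Suc i)}. \<zero>\<^bsub>W\<^esub>)"
    by (simp add: coboundary_def)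
qed

lemma lift_cochain:
  assumes "w \<in> {..<n} \<rightarrow>\<^sub>E carrier W"
  shows "\<exists>v. (\<forall>j<n. v j \<in> R \<times> R) \<and> w = (\<lambda>j\<in>{..<n}. proj (v j))"
proof -
  have "\<exists>x. x \<in> R \<times> R \<and> w j = proj x" if "j \<in> {..<n}" for j
    using proj_surj[OF PiE_mem[OF assms that]] by blast
  then obtain v where v: "\<And>j. j < n \<Longrightarrow> v j \<in> R \<times> R" "\<And>j. j < n \<Longrightarrow> w j = proj (v j)"
    by (metis lessThan_iff)
  have "(\<lambda>j\<in>{..<n}. proj (v j)) \<in> {..<n} \<rightarrow>\<^sub>E carrier W"
    using proj_closed[OF v(1)] by simp
  then have "w = (\<lambda>j\<in>{..<n}. proj (v j))"
    by (rule PiE_ext[OF assms]) (simp add: v(2))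
  then show ?thesis using v(1) by blast
qed

lemma coboundaries_subset: "coboundaries b D W i \<subseteq> cocycles b D W i"
proof (cases i)
  case 0
  have "(\<lambda>j\<in>{..<b 0}. proj 0) \<in> cocycles b D W 0"
  proof (rule cocycle_proj)
    show "0 \<in> R \<times> R" by (rule P.zeroM)
    show "C.delta 0 (\<lambda>_. 0) l \<in> K" for l
      using P.submodD(2)[OF submod_K] by (simp add: C.delta_def P.scale_zero_right)
  qed
  then show ?thesis unfolding 0 W.coboundaries_simps proj_zero by blast
next
  case (Suc k)
  show ?thesis
  proof
    fix v assume "v \<in> coboundaries b D W i"
    then obtain w where w: "w \<in> {..<b k} \<rightarrow>\<^sub>E carrier W" "v = coboundary b D W k w"
      unfolding Suc W.coboundaries_simps by blast
    obtain u where u': "\<forall>j<b k. u j \<in> R \<times> R" "w = (\<lambda>j\<in>{..<b k}. proj (u j))"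
      using lift_cochain[OF w(1)] by (elim exE conjE) (rule that)
    note u = u'(1)[rule_format] u'(2)
    have "v = (\<lambda>l\<in>{..<b i}. proj (C.delta k u l))"
    proof
      fix l
      show "v l = (\<lambda>l\<in>{..<b i}. proj (C.delta k u l)) l"
      proof (cases "l < b (Suc k)")
        case True
        then show ?thesis using coboundary_proj[OF u(1) True] unfolding w(2) u(2) Suc by simp
      next
        case False
        then show ?thesis using coboundary_outside[OF False] unfolding w(2) Suc by simp
      qed
    qed
    moreover have "(\<lambda>l\<in>{..<b i}. proj (C.delta k u l)) \<in> cocycles b D W i"
    proof (rule cocycle_proj)
      show "C.delta k u j \<in> R \<times> R" if "j < b i" for j
        by (rule C.delta_closed) (use u(1) that Suc in simp_all)
      show "C.delta i (C.delta k u) l \<in> K" if "l < b (Suc i)" for l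
      proof -
        have "C.delta i (C.delta k u) l = 0" unfolding Suc by (rule C.delta_delta) (use that Suc in simp)
        then show ?thesis using P.submodD(2)[OF submod_K] by (simp only:)
      qed
    qed
    ultimately show "v \<in> cocycles b D W i" by simp
  qed
qed

lemma quotient_Ext: "quotient_of_module RR (cocycle_module b D W i) (coboundaries b D W i)"
proof -
  have D: "D i j l \<in> carrier RR" if "j < b i" "l < b (Suc i)" for i j l using D_in_R that by simp
  have "module RR (cocycle_module b D W i)" by (rule W.module_cocycles) (rule D)
  moreover have "submodule (coboundaries b D W i) RR (cocycle_module b D W i)"
    by (rule W.submodule_coboundaries[OF D coboundaries_subset])
  ultimately show ?thesis by (simp add: quotient_of_module_def quotient_of_module_axioms_def)
qed

lemma boundary_of_coboundary:
  assumes v: "\<And>j. j < b i \<Longrightarrow> v j \<in> R \<times> R"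
    and cob: "(\<lambda>j\<in>{..<b i}. proj (v j)) \<in> coboundaries b D W i"
  shows "C.boundary i K v"
proof (cases i)
  case 0
  have "proj (v j) = \<zero>\<^bsub>W\<^esub>" if j: "j < b 0" for j
  proof -
    have "(\<lambda>j\<in>{..<b 0}. proj (v j)) = (\<lambda>j\<in>{..<b 0}. \<zero>\<^bsub>W\<^esub>)" using cob unfolding 0 W.coboundaries_simps by simp
    from fun_cong[OF this, of j] show ?thesis using j by simp
  qed
  then show ?thesis unfolding 0 C.boundary_0 using v 0 by (auto simp: K_def)
next
  case (Suc k)
  obtain w where w: "w \<in> {..<b k} \<rightarrow>\<^sub>E carrier W" "(\<lambda>j\<in>{..<b i}. proj (v j)) = coboundary b D W k w"
    using cob unfolding Suc W.coboundaries_simps by blast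
  obtain u where u': "\<forall>j<b k. u j \<in> R \<times> R" "w = (\<lambda>j\<in>{..<b k}. proj (u j))"
    using lift_cochain[OF w(1)] by (elim exE conjE) (rule that)
  note u = u'(1)[rule_format] u'(2)
  have "v j - C.delta k u j \<in> K" if j: "j < b (Suc k)" for j
  proof -
    have "proj (v j) = coboundary b D W k w j" using fun_cong[OF w(2), of j] j Suc by simp
    also have "\<dots> = proj (C.delta k u j)" unfolding u(2) by (rule coboundary_proj[OF u(1) j])
    finally have "proj (v j) = proj (C.delta k u j)" .
    moreover have "C.delta k u j \<in> R \<times> R" by (rule C.delta_closed) (use u(1) j in simp_all)
    ultimately show ?thesis using proj_diff_in_K[of "v j" "C.delta k u j"] v[of j] j Suc by simp
  qed
  then show ?thesis unfolding Suc C.boundary_Suc using u(1) by blast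
qed

lemma Ext_zero:
  assumes "carrier (Ext_module b D W i) = {\<zero>\<^bsub>Ext_module b D W i\<^esub>}"
  shows "C.ext_zero i K"
  unfolding C.ext_zero_def
proof (intro allI impI)
  fix v assume v: "\<forall>j<b i. v j \<in> R \<times> R" "\<forall>l<b (Suc i). C.delta i v l \<in> K"
  interpret E: quotient_of_module RR "cocycle_module b D W i" "coboundaries b D W i" by (rule quotient_Ext)
  let ?v = "\<lambda>j\<in>{..<b i}. proj (v j)"
  have "?v \<in> cocycles b D W i" using v by (intro cocycle_proj) auto
  then have cv: "?v \<in> carrier (cocycle_module b D W i)" by (simp add: W.cocycle_module_simps)
  then have "coboundaries b D W i +>\<^bsub>cocycle_module b D W i\<^esub> ?v \<in> carrier E.Q" unfolding E.carrier_Q by blast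
  then have "coboundaries b D W i +>\<^bsub>cocycle_module b D W i\<^esub> ?v = coboundaries b D W i"
    using assms E.zero_Q by (simp add: Ext_module_def)
  then have "?v \<in> coboundaries b D W i" using E.coset_eq_zero_iff[OF cv] by blast
  then show "C.boundary i K v" using v by (intro boundary_of_coboundary) auto
qed

text \<open>
  The residue field is one-dimensional over the constants: the classes of two cocycles are
  mapped to two elements of it, which satisfy a nontrivial linear relation, and the isomorphism carries
  this relation back.
\<close>

lemma Ext_one_dimensional:
  assumes iso: "graded_iso RR (Ext_module b D W i) gE (residue_module RR (std_grading S)) gk"
    and v: "v1 \<in> cocycles b D W i" "v2 \<in> cocycles b D W i"
  shows "\<exists>c1 c2. homog c1 0 \<and> homog c2 0 \<and> (c1 \<noteq> 0 \<or> c2 \<noteq> 0) \<and>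
    (\<lambda>j\<in>{..<b i}. c1 \<odot>\<^bsub>W\<^esub> v1 j \<oplus>\<^bsub>W\<^esub> c2 \<odot>\<^bsub>W\<^esub> v2 j) \<in> coboundaries b D W i"
proof -
  let ?Z = "cocycle_module b D W i" and ?B = "coboundaries b D W i"
  interpret E: quotient_of_module RR ?Z ?B by (rule quotient_Ext)
  interpret Q: quotient_of_module RR "self_module RR" irrelevant by (rule quotient_residue)
  obtain h where h: "h \<in> module_Hom RR E.Q kk" "bij_betw h (carrier E.Q) (carrier kk)"
    using iso unfolding graded_iso_def Ext_module_def residue_module_eq by blast
  have hc: "h X \<in> carrier kk" if "X \<in> carrier E.Q" for X using h(1) that by (auto simp: module_Hom_def)
  have hadd: "h (X \<oplus>\<^bsub>E.Q\<^esub> Y) = h X \<oplus>\<^bsub>kk\<^esub> h Y" if "X \<in> carrier E.Q" "Y \<in> carrier E.Q" for X Y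
    using h(1) that by (simp add: module_Hom_def)
  have hsm: "h (r \<odot>\<^bsub>E.Q\<^esub> X) = r \<odot>\<^bsub>kk\<^esub> h X" if "r \<in> R" "X \<in> carrier E.Q" for r X
    using h(1) that by (simp add: module_Hom_def)
  let ?c = "\<lambda>v. ?B +>\<^bsub>?Z\<^esub> v"
  have vZ: "v1 \<in> carrier ?Z" "v2 \<in> carrier ?Z" using v by (simp_all add: W.cocycle_module_simps)
  have cc: "?c z \<in> carrier E.Q" if "z \<in> carrier ?Z" for z unfolding E.carrier_Q using that by blast
  have cself: "carrier (self_module RR) = R" by (simp add: self_module_def)
  obtain r1 where r1: "r1 \<in> R" "h (?c v1) = coset r1"
    using hc[OF cc[OF vZ(1)]] unfolding Q.carrier_Q cself by blast
  obtain r2 where r2: "r2 \<in> R" "h (?c v2) = coset r2"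
    using hc[OF cc[OF vZ(2)]] unfolding Q.carrier_Q cself by blast
  let ?l = "\<lambda>f::expo \<Rightarrow>\<^sub>0 'k. Poly_Mapping.lookup f (0::expo)"
  obtain m1 m2 where m: "m1 \<noteq> 0 \<or> m2 \<noteq> 0" "m1 * ?l r1 + m2 * ?l r2 = 0"
  proof (cases "?l r1 = 0 \<and> ?l r2 = 0")
    case True
    then show ?thesis using that[of 1 0] by simp
  next
    case False
    then show ?thesis using that[of "?l r2" "- ?l r1"] by (auto simp: mult.commute)
  qed
  define c1 where "c1 = Poly_Mapping.single (0::expo) m1"
  define c2 where "c2 = Poly_Mapping.single (0::expo) m2"
  have c: "homog c1 0" "homog c2 0" using homog_single[OF zero_in] deg_zero by (metis c1_def, metis c2_def)
  have cR: "c1 \<in> R" "c2 \<in> R" using c homogD by auto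
  have nz: "c1 \<noteq> 0 \<or> c2 \<noteq> 0"
    using m(1) unfolding c1_def c2_def by (metis lookup_single_eq lookup_zero)
  have irr: "c1 * r1 + c2 * r2 \<in> irrelevant"
    unfolding irrelevant_iff using cR r1(1) r2(1) m(2) lookup_0_mult[OF cR(1) r1(1)] lookup_0_mult[OF cR(2) r2(1)]
    by (simp add: lookup_add add mult c1_def c2_def)
  define z where "z = c1 \<odot>\<^bsub>?Z\<^esub> v1 \<oplus>\<^bsub>?Z\<^esub> c2 \<odot>\<^bsub>?Z\<^esub> v2"
  have sZ: "c1 \<odot>\<^bsub>?Z\<^esub> v1 \<in> carrier ?Z" "c2 \<odot>\<^bsub>?Z\<^esub> v2 \<in> carrier ?Z"
    using E.smult_closed[of c1 v1] E.smult_closed[of c2 v2] cR vZ by simp_all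
  have zZ: "z \<in> carrier ?Z" unfolding z_def using sZ by (rule E.M.a_closed)
  have hcs: "h (?c (c \<odot>\<^bsub>?Z\<^esub> v)) = coset (c * r)" if "c \<in> R" "v \<in> carrier ?Z" "r \<in> R" "h (?c v) = coset r" for c v r
  proof -
    have "?c (c \<odot>\<^bsub>?Z\<^esub> v) = c \<odot>\<^bsub>E.Q\<^esub> ?c v" using E.smult_Q[of c v] that by simp
    then have "h (?c (c \<odot>\<^bsub>?Z\<^esub> v)) = c \<odot>\<^bsub>kk\<^esub> coset r" using hsm[OF that(1) cc[OF that(2)]] that(4) by simp
    then show ?thesis using Q.smult_Q[of c r] that by (simp add: self_module_def)
  qed
  have "h (?c z) = h (?c (c1 \<odot>\<^bsub>?Z\<^esub> v1)) \<oplus>\<^bsub>kk\<^esub> h (?c (c2 \<odot>\<^bsub>?Z\<^esub> v2))"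
    unfolding z_def E.add_Q[OF sZ, symmetric] by (rule hadd[OF cc[OF sZ(1)] cc[OF sZ(2)]])
  also have "\<dots> = coset (c1 * r1) \<oplus>\<^bsub>kk\<^esub> coset (c2 * r2)"
    using hcs[OF cR(1) vZ(1) r1] hcs[OF cR(2) vZ(2) r2] by simp
  also have "\<dots> = coset (c1 * r1 + c2 * r2)"
    using Q.add_Q[of "c1 * r1" "c2 * r2"] cR r1(1) r2(1) by (simp add: self_module_def mult)
  also have "\<dots> = irrelevant" using coset_zero irr by (auto simp: irrelevant_def)
  finally have hz: "h (?c z) = irrelevant" .
  have h0: "h (?c (0 \<odot>\<^bsub>?Z\<^esub> v1)) = irrelevant"
    using hcs[OF zero vZ(1) r1] coset_zero[OF zero] ideal_of_irrelevant by (simp add: ideal_of_def)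
  have z0: "0 \<odot>\<^bsub>?Z\<^esub> v1 = \<zero>\<^bsub>?Z\<^esub>" using E.smult_l_null[OF vZ(1)] by simp
  have "?c z = ?c \<zero>\<^bsub>?Z\<^esub>"
    using h(2) hz h0 cc[OF zZ] cc[of "\<zero>\<^bsub>?Z\<^esub>"] E.M.zero_closed unfolding z0 bij_betw_def inj_on_def by metis
  also have "\<dots> = ?B"
    using E.coset_eq_zero_iff[of "\<zero>\<^bsub>?Z\<^esub>"] E.M.zero_closed
      additive_subgroup.zero_closed[OF abelian_subgroup.axioms(1)[OF E.abelian_subgroup]] by blast
  finally have "z \<in> ?B" using E.coset_eq_zero_iff[OF zZ] by blast
  moreover have "z = (\<lambda>j\<in>{..<b i}. c1 \<odot>\<^bsub>W\<^esub> v1 j \<oplus>\<^bsub>W\<^esub> c2 \<odot>\<^bsub>W\<^esub> v2 j)"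
    unfolding z_def W.cocycle_module_simps by (intro restrict_ext) simp
  ultimately show ?thesis using c nz by blast
qed

lemma delta_pair:
  "C.delta i v l = (\<Sum>j<b i. D i j l * fst (v j), \<Sum>j<b i. D i j l * snd (v j))"
  unfolding C.delta_def pair_scale_def by (rule sum_prod)

text \<open>
  Over \<open>W = R\<^sup>2\<close> a cocycle \<open>f\<close> with values in \<open>R\<close> gives the two cocycles \<open>(f, 0)\<close> and \<open>(0, f)\<close>.  Some
  nontrivial combination \<open>(c1 f, c2 f)\<close> of them is a coboundary, and a nonzero coefficient is
  invertible; so \<open>f\<close> is a coboundary, that is, \<open>Ext\<^sup>i(k, R) = 0\<close>.
\<close>

lemma scalar_boundary:
  assumes K0: "K = {0}"
    and iso: "graded_iso RR (Ext_module b D W i) gE (residue_module RR (std_grading S)) gk"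
    and f: "\<And>j. j < b i \<Longrightarrow> f j \<in> R" "\<And>l. l < b (Suc i) \<Longrightarrow> (\<Sum>j<b i. D i j l * f j) = 0"
  shows "case i of 0 \<Rightarrow> \<forall>j<b 0. f j = 0
    | Suc k \<Rightarrow> \<exists>u. (\<forall>j<b k. u j \<in> R) \<and> (\<forall>j<b i. f j = (\<Sum>l<b k. D k l j * u l))"
proof -
  define v1 where "v1 = (\<lambda>j. (f j, 0 :: expo \<Rightarrow>\<^sub>0 'k))"
  define v2 where "v2 = (\<lambda>j. (0 :: expo \<Rightarrow>\<^sub>0 'k, f j))"
  have v: "v1 j \<in> R \<times> R" "v2 j \<in> R \<times> R" if "j < b i" for j using f(1)[OF that] zero by (auto simp: v1_def v2_def)
  have "C.delta i v1 l = 0" "C.delta i v2 l = 0" if "l < b (Suc i)" for l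
    using f(2)[OF that] unfolding delta_pair v1_def v2_def fst_conv snd_conv
    by (simp_all add: zero_prod_def)
  then have \<delta>: "C.delta i v1 l \<in> K" "C.delta i v2 l \<in> K" if "l < b (Suc i)" for l
    using that unfolding K0 by (simp_all only: singleton_iff)
  have "(\<lambda>j\<in>{..<b i}. proj (v1 j)) \<in> cocycles b D W i" by (rule cocycle_proj[OF v(1) \<delta>(1)])
  moreover have "(\<lambda>j\<in>{..<b i}. proj (v2 j)) \<in> cocycles b D W i" by (rule cocycle_proj[OF v(2) \<delta>(2)])
  ultimately obtain c1 c2 where c: "homog c1 0" "homog c2 0" "c1 \<noteq> 0 \<or> c2 \<noteq> 0" and cob:
    "(\<lambda>j\<in>{..<b i}. c1 \<odot>\<^bsub>W\<^esub> (\<lambda>j\<in>{..<b i}. proj (v1 j)) j \<oplus>\<^bsub>W\<^esub> c2 \<odot>\<^bsub>W\<^esub> (\<lambda>j\<in>{..<b i}. proj (v2 j)) j) \<in> coboundaries b D W i"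
    using Ext_one_dimensional[OF iso] by blast
  have cR: "c1 \<in> R" "c2 \<in> R" using c homogD by auto
  define w where "w = (\<lambda>j. (c1 * f j, c2 * f j))"
  have w: "w j \<in> R \<times> R" if "j < b i" for j using f(1)[OF that] cR mult by (simp add: w_def)
  have "(\<lambda>j\<in>{..<b i}. c1 \<odot>\<^bsub>W\<^esub> (\<lambda>j\<in>{..<b i}. proj (v1 j)) j \<oplus>\<^bsub>W\<^esub> c2 \<odot>\<^bsub>W\<^esub> (\<lambda>j\<in>{..<b i}. proj (v2 j)) j) =
      (\<lambda>j\<in>{..<b i}. proj (w j))"
  proof (rule restrict_ext)
    fix j assume "j \<in> {..<b i}"
    then have j: "j < b i" by simp
    have "w j = pair_scale c1 (v1 j) + pair_scale c2 (v2 j)"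
      by (simp add: w_def v1_def v2_def pair_scale_def)
    then show "c1 \<odot>\<^bsub>W\<^esub> (\<lambda>j\<in>{..<b i}. proj (v1 j)) j \<oplus>\<^bsub>W\<^esub> c2 \<odot>\<^bsub>W\<^esub> (\<lambda>j\<in>{..<b i}. proj (v2 j)) j = proj (w j)"
      using proj_add[OF P.scaleM[OF cR(1) v(1)[OF j]] P.scaleM[OF cR(2) v(2)[OF j]]]
        proj_scale[OF cR(1) v(1)[OF j]] proj_scale[OF cR(2) v(2)[OF j]] j by simp
  qed
  then have bd: "C.boundary i {0} w" using cob boundary_of_coboundary[OF w] K0 by simp
  have unit: "\<exists>t\<in>R. t * c = 1" if "homog c 0" "c \<noteq> 0" for c
    using degree_0_unit[of c] that by (auto simp: homog_def mult.commute)
  show ?thesis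
  proof (cases i)
    case 0
    have "f j = 0" if j: "j < b 0" for j
    proof -
      have "w j = 0" using bd j unfolding 0 C.boundary_0 by simp
      then show ?thesis using c(3) by (auto simp: w_def zero_prod_def)
    qed
    then show ?thesis using 0 by simp
  next
    case (Suc k)
    obtain u where u: "\<And>j. j < b k \<Longrightarrow> u j \<in> R \<times> R" "\<And>j. j < b i \<Longrightarrow> w j = C.delta k u j"
    proof -
      obtain u where u: "\<forall>j<b k. u j \<in> R \<times> R" "\<forall>j<b (Suc k). w j - C.delta k u j \<in> {0}"
        using bd unfolding Suc C.boundary_Suc by (elim exE conjE) (rule that)
      show ?thesis
      proof (rule that)
        show "u j \<in> R \<times> R" if "j < b k" for j using u(1) that by (simp only:)
        show "w j = C.delta k u j" if "j < b i" for j
        proof -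
          have "w j - C.delta k u j = 0" using u(2) that Suc by (simp only: singleton_iff)
          then show ?thesis by (simp only: eq_iff_diff_eq_0[symmetric])
        qed
      qed
    qed
    have uR: "fst (u l) \<in> R" "snd (u l) \<in> R" if "l < b k" for l using u(1)[OF that] by (simp_all only: mem_Times_iff)
    have comps: "c1 * f j = (\<Sum>l<b k. D k l j * fst (u l))" "c2 * f j = (\<Sum>l<b k. D k l j * snd (u l))"
      if "j < b i" for j
      using u(2)[OF that] unfolding w_def delta_pair by (simp_all only: prod.inject)
    have ex: "\<exists>u'. (\<forall>l<b k. u' l \<in> R) \<and> (\<exists>c t. t \<in> R \<and> t * c = 1 \<and> (\<forall>j<b i. c * f j = (\<Sum>l<b k. D k l j * u' l)))"
    proof (cases "c1 = 0")
      case False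
      then obtain t where "t \<in> R" "t * c1 = 1" using unit c(1) by blast
      then show ?thesis
        using comps(1) uR(1) by (intro exI[of _ "\<lambda>l. fst (u l)"] conjI exI[of _ c1] exI[of _ t]) simp_all
    next
      case True
      then obtain t where "t \<in> R" "t * c2 = 1" using unit c(2,3) by blast
      then show ?thesis
        using comps(2) uR(2) by (intro exI[of _ "\<lambda>l. snd (u l)"] conjI exI[of _ c2] exI[of _ t]) simp_all
    qed
    obtain u' c t where u'': "\<forall>l<b k. u' l \<in> R" "t \<in> R" "t * c = 1"
        "\<forall>j<b i. c * f j = (\<Sum>l<b k. D k l j * u' l)"
      using ex by (elim exE conjE) (rule that)
    note u' = u''(1)[rule_format] u''(2,3) u''(4)[rule_format]
    have "f j = (\<Sum>l<b k. D k l j * (t * u' l))" if j: "j < b i" for j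
    proof -
      have "f j = t * (c * f j)" using u'(3) by (simp add: mult.assoc[symmetric])
      also have "\<dots> = (\<Sum>l<b k. D k l j * (t * u' l))"
        unfolding u'(4)[OF j] by (simp add: sum_distrib_left mult.left_commute)
      finally show ?thesis .
    qed
    moreover have "\<forall>l<b k. t * u' l \<in> R" using u' mult by blast
    ultimately show ?thesis unfolding Suc nat.case by (intro exI[of _ "\<lambda>l. t * u' l"]) simp
  qed
qed

lemma Ext_zero_top_of_free:
  assumes K0: "K = {0}"
    and iso: "graded_iso RR (Ext_module b D W i) gE (residue_module RR (std_grading S)) gk"
  shows "C.ext_zero i K"
  unfolding C.ext_zero_def
proof (intro allI impI)
  fix v assume v: "\<forall>j<b i. v j \<in> R \<times> R" "\<forall>l<b (Suc i). C.delta i v l \<in> K"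
  have vR: "fst (v j) \<in> R" "snd (v j) \<in> R" if "j < b i" for j using v(1) that by (auto simp: mem_Times_iff)
  have z: "(\<Sum>j<b i. D i j l * fst (v j)) = 0" "(\<Sum>j<b i. D i j l * snd (v j)) = 0" if "l < b (Suc i)" for l
    using v(2)[rule_format, OF that] unfolding K0 delta_pair by (simp_all add: zero_prod_def)
  note f = scalar_boundary[OF K0 iso vR(1) z(1)] and g = scalar_boundary[OF K0 iso vR(2) z(2)]
  show "C.boundary i K v"
  proof (cases i)
    case 0
    then have "fst (v j) = 0" "snd (v j) = 0" if "j < b 0" for j using f g that by simp_all
    then show ?thesis unfolding 0 C.boundary_0 K0 by (simp add: prod_eq_iff)
  next
    case (Suc k)
    obtain p where p: "\<And>j. j < b k \<Longrightarrow> p j \<in> R" "\<And>j. j < b i \<Longrightarrow> fst (v j) = (\<Sum>l<b k. D k l j * p l)"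
      using f unfolding Suc nat.case by blast
    obtain q where q: "\<And>j. j < b k \<Longrightarrow> q j \<in> R" "\<And>j. j < b i \<Longrightarrow> snd (v j) = (\<Sum>l<b k. D k l j * q l)"
      using g unfolding Suc nat.case by blast
    have "v j - C.delta k (\<lambda>l. (p l, q l)) j \<in> K" if j: "j < b (Suc k)" for j
    proof -
      have "v j = C.delta k (\<lambda>l. (p l, q l)) j"
        using p(2)[of j] q(2)[of j] j Suc unfolding delta_pair by (simp add: prod_eq_iff)
      then show ?thesis unfolding K0 by simp
    qed
    then show ?thesis
      unfolding Suc C.boundary_Suc using p(1) q(1) by (intro exI[of _ "\<lambda>l. (p l, q l)"]) simp
  qed
qed

text \<open>
  The vanishing of all Ext excludes an infinite height.  For finite height \<open>h\<close>, the chains of primes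
  give torsion-freeness, and they exclude \<open>K = 0\<close> because the vanishing would then extend to \<open>h\<close>
  itself.
\<close>

theorem no_generators_in_different_degrees:
  assumes \<delta>: "\<delta> > 0"
    and CM: "Cohen_Macaulay_ring RR" and NG: "nearly_Gorenstein RR (std_grading S) W"
    and Ext: "\<And>i. if enat i = prime_height RR irrelevant
             then graded_iso RR (Ext_module b D W i) (Ext_grading b s D W gW i)
                               (residue_module RR (std_grading S)) (residue_grading RR (std_grading S))
             else carrier (Ext_module b D W i) = {\<zero>\<^bsub>Ext_module b D W i\<^esub>}"
    and n1: "\<not> generates RR W {y1}" and n2: "\<not> generates RR W {y2}"
  shows False
proof -
  have one_K: "(1, 0) \<notin> K" by (rule one_zero_notin_K[OF n2])
  have KM: "K \<noteq> R \<times> R" using one_K one zero by auto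
  have "\<exists>h. prime_height RR irrelevant = enat h"
  proof (rule ccontr)
    assume inf: "\<not> ?thesis"
    have "C.ext_zero i K" for i using Ext[of i] inf Ext_zero by metis
    then have "K = R \<times> R" by (rule C.ext_zero_all_imp_trivial[OF graded_K])
    then show False using KM by blast
  qed
  then obtain h where h: "prime_height RR irrelevant = enat h" by blast
  have E: "C.ext_zero i K" if "i < h" for i
    using Ext[of i] that by (intro Ext_zero) (simp add: h)
  have iso: "graded_iso RR (Ext_module b D W h) (Ext_grading b s D W gW h)
      (residue_module RR (std_grading S)) (residue_grading RR (std_grading S))"
    using Ext[of h] by (simp add: h)
  have height: "p (Suc h) \<noteq> irrelevant"
    if "\<forall>i\<le>Suc h. prime_of R (p i)" "\<forall>i<Suc h. p i \<subset> p (Suc i)" for p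
    using prime_chain_height[OF that] h by auto
  have nz: "K \<noteq> {0}"
  proof
    assume K0: "K = {0}"
    show False
    proof (rule C.not_ext_zero_height[of h K])
      show "C.ext_zero i K" if "i \<le> h" for i
        using E[of i] Ext_zero_top_of_free[OF K0 iso] that by (cases "i = h") simp_all
      show "p (Suc h) \<noteq> irrelevant"
        if "\<forall>i\<le>Suc h. prime_of R (p i)" "\<forall>i<Suc h. p i \<subset> p (Suc i)" for p
        using that by (rule height)
    qed (fact graded_K KM)+
  qed
  show False
  proof (rule two_generators_contradiction[OF \<delta> graded_K _ nz one_K])
    show "y \<in> K" if "P.homM y q" "r \<in> R" "r \<noteq> 0" "pair_scale r y \<in> K" for y q r
    proof (rule C.torsion_free_of_ext_zero[of h K])
      show "p (Suc h) \<noteq> irrelevant"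
        if "\<forall>i\<le>Suc h. prime_of R (p i)" "\<forall>i<Suc h. p i \<subset> p (Suc i)" for p
        using that by (rule height)
    qed (fact E graded_K that)+
    show "(c, - 1) \<notin> K" if "c \<in> R" for c by (rule minus_one_notin_K[OF n1 that])
    show "irrelevant \<subseteq> J" if "ideal_of R J"
      "\<And>f g. f \<in> R \<Longrightarrow> g \<in> R \<Longrightarrow> (\<And>a b. (a, b) \<in> K \<Longrightarrow> a * f + b * g = 0) \<Longrightarrow> f \<in> J \<and> g \<in> J" for J
      by (rule trace_subset_ideal[OF NG that])
    show "\<exists>c\<in>R. r = s * c" if "homog r (e + \<delta>)" "homog s e" "s \<noteq> 0" "\<And>f. homog f 1 \<Longrightarrow> \<exists>g\<in>R. r * f = s * g" for r s e
      by (rule depth_condition[OF CM that])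
  qed
qed

end

section \<open>Levelness\<close>

theorem theorem4p5:
  fixes n :: nat
    and S :: "(nat \<Rightarrow>\<^sub>0 nat) set"
    and W :: "((nat \<Rightarrow>\<^sub>0 nat) \<Rightarrow>\<^sub>0 'k::field, 'c) module"
    and gW :: "int \<Rightarrow> 'c set"
  assumes "affine_semigroup n S"
    and "homogeneous_semigroup n S"
    and "Cohen_Macaulay_ring (semigroup_ring S :: ((nat \<Rightarrow>\<^sub>0 nat) \<Rightarrow>\<^sub>0 'k) ring)"
    and "graded_canonical_module (semigroup_ring S) (std_grading S) W gW"
    and "nearly_Gorenstein (semigroup_ring S) (std_grading S) W"
    and "CM_type (semigroup_ring S) W = 2"
  shows "level (semigroup_ring S) W gW"
proof (rule ccontr)
  assume not_level: "\<not> level (semigroup_ring S) W gW"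
  obtain dg where dg: "graded_semigroup S dg" using graded_semigroup_exists[OF assms(1,2)] by blast
  have "noetherian_ring (semigroup_ring S :: ((nat \<Rightarrow>\<^sub>0 nat) \<Rightarrow>\<^sub>0 'k) ring)"
    using assms(3) by (simp add: Cohen_Macaulay_ring_def)
  moreover have "graded_module (semigroup_ring S) (std_grading S) W gW"
    using assms(4) by (simp add: graded_canonical_module_def)
  ultimately have "graded_module_over_ring S dg W gW"
    using dg by (simp add: graded_module_over_ring_def graded_module_over_ring_axioms_def
        homogeneous_semigroup_ring_def homogeneous_semigroup_ring_axioms_def)
  then interpret G: graded_module_over_ring S dg "TYPE('k)" W gW .
  obtain y1 y2 d1 \<delta> where y: "\<delta> > 0" "y1 \<in> gW d1" "y2 \<in> gW (d1 + int \<delta>)"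
      "generates (semigroup_ring S) W {y1, y2}"
      "\<not> generates (semigroup_ring S) W {y1}" "\<not> generates (semigroup_ring S) W {y2}"
    using G.not_level_generators[OF _ assms(6) not_level] assms(4) by (auto simp: graded_canonical_module_def)
  obtain b s D e where res: "graded_free_resolution G.RR (std_grading S)
      (residue_module G.RR (std_grading S)) (residue_grading G.RR (std_grading S)) b s D e"
    and Ext: "\<And>i. if enat i = prime_height G.RR (graded_max_ideal G.RR (std_grading S))
             then graded_iso G.RR (Ext_module b D W i) (Ext_grading b s D W gW i)
               (residue_module G.RR (std_grading S)) (residue_grading G.RR (std_grading S))
             else carrier (Ext_module b D W i) = {\<zero>\<^bsub>Ext_module b D W i\<^esub>}"
    using assms(4) unfolding graded_canonical_module_def by blast
  interpret M: resolved_module S dg "TYPE('k)" W gW y1 y2 d1 \<delta> b s D e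
    by unfold_locales (use y res in auto)
  show False
    by (rule M.no_generators_in_different_degrees[OF y(1) assms(3,5) Ext[unfolded G.graded_max_ideal_eq] y(5,6)])
qed

end
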